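(* Let $\Omega\subset\mathbb{R}^n$ be an open set and let $(V_i)_i$ be a sequence of $d$-varifolds in $\Omega$ weakly-$*$ converging to some $d$-varifold $V$ and such that $\sup_i\|V_i\|(\Omega)<+\infty$. Fix $(\alpha_i)_i$ and $(\beta_i)_i$ decreasing sequences of positive numbers tending to $0$ and assume that: (i) there exist $0<C_1<C_2$ (independent of $i$) such that for every $i$, for $\|V_i\|$-almost every $x\in\Omega$ and for every $\beta_i<r<d(x,\Omega^c)$, $$C_1\,\omega_d\,r^d\le\|V_i\|(B_r(x))\le C_2\,\omega_d\,r^d;$$ (ii) $$\sup_i\int_{\Omega\times G_{d,n}}E_{\alpha_i}(x,P,V_i)\,dV_i(x,P)<+\infty .$$ Then $V$ is a rectifiable $d$-varifold.
   Context: $d,n$ are integers with $1\le d<n$. $G_{d,n}$ is the set of $d$-dimensional vector subspaces of $\mathbb{R}^n$, with the metric $d(T,P)=\|\Pi_T-\Pi_P\|$, where $\Pi_P$ is the orthogonal projection onto $P$. $B_r(x)$ is the open ball, $\omega_d$ is the volume of the unit ball of $\mathbb{R}^d$, and $d(x,\Omega^c)$ is the distance from $x$ to $\mathbb{R}^n\setminus\Omega$ ($+\infty$ if $\Omega=\mathbb{R}^n$). $d(z,P)$ for $z\in\mathbb{R}^n$ is the Euclidean distance from $z$ to the subspace $P$. A $d$-varifold in $\Omega$ is a positive Radon measure $V$ on $\Omega\times G_{d,n}$. Its mass $\|V\|$ is the positive Radon measure on $\Omega$ given by $\|V\|(B)=V(B\times G_{d,n})$ for Borel $B\subset\Omega$.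 Weak-$*$ convergence $V_i\to V$ means $\int\varphi\,dV_i\to\int\varphi\,dV$ for all $\varphi\in C_c(\Omega\times G_{d,n})$. For $\alpha>0$ the $\alpha$-approximate averaged height excess is $$E_\alpha(x,P,V)=\int_{r=\alpha}^1\frac1{r^d}\int_{y\in B_r(x)\cap\Omega}\left(\frac{d(y-x,P)}{r}\right)^2 d\|V\|(y)\,\frac{dr}{r}.$$ A set $M$ is countably $d$-rectifiable if $M\subset M_0\cup\bigcup_{i\in\mathbb{N}}f_i(\mathbb{R}^d)$ with $f_i:\mathbb{R}^d\to\mathbb{R}^n$ Lipschitz and $\mathcal{H}^d(M_0)=0$. A rectifiable $d$-varifold in $\Omega$ is a $d$-varifold of the form $V=\theta\,\mathcal{H}^d_{|M}\otimes\delta_{T_xM}$, i.e. $\int\varphi\,dV=\int_M\varphi(x,T_xM)\,\theta(x)\,d\mathcal{H}^d(x)$ for all $\varphi\in C_c(\Omega\times G_{d,n})$, where $M$ is countably $d$-rectifiable, $\theta$ is a non-negative Borel function with $\theta>0$ $\mathcal{H}^d$-a.e. on $M$, and $T_xM$ is the approximate tangent space at $x$, i.e. the $d$-plane $T_xM\in G_{d,n}$ such that $r^{-d}\int\varphi(\frac{y-x}{r})\,d\mu(y)\to\theta(x)\int_{T_xM}\varphi\,d\mathcal{H}^d$ as $r\downarrow0$ for all $\varphi\in C_c(\mathbb{R}^n)$, with $\mu=\theta\mathcal{H}^d_{|M}$ (it exists for $\mathcal{H}^d$-a.e. $x\in M$). *)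

theory Defs
  imports "HOL-Analysis.Analysis"
begin

text \<open>
  The linear subspaces of a Euclidean space form a metric space under
  \<open>dist T P = \<parallel>\<Pi>\<^sub>T - \<Pi>\<^sub>P\<parallel>\<close>. The Grassmannian is a subset of this type, so that
  its topology, its Borel sets and its compact sets are those of the type classes.
\<close>

typedef (overloaded) 'a linear_subspace = "{S :: 'a::euclidean_space set. subspace S}"
  morphisms points Abs_linear_subspace
  by (rule exI[of _ "{0}"]) simp

lemma subspace_points [simp]: "subspace (points P)"
  using points by auto

definition orth_proj :: "'a::euclidean_space linear_subspace \<Rightarrow> 'a \<Rightarrow> 'a" where
  "orth_proj P x = (THE y. y \<in> points P \<and> (\<forall>z\<in>points P. orthogonal (x - y) z))"

lemma orth_proj_ex1: "\<exists>!y. y \<in> points P \<and> (\<forall>z\<in>points P. orthogonal (x - y) z)"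
proof -
  obtain y z where yz: "y \<in> span (points P)" "\<And>w. w \<in> span (points P) \<Longrightarrow> orthogonal z w" "x = y + z"
    using orthogonal_subspace_decomp_exists[of "points P" x] by metis
  show ?thesis
  proof (rule ex1I[of _ y])
    show "y \<in> points P \<and> (\<forall>w\<in>points P. orthogonal (x - y) w)"
      using yz by (simp add: span_eq_iff[THEN iffD2])
  next
    fix y' assume y': "y' \<in> points P \<and> (\<forall>w\<in>points P. orthogonal (x - y') w)"
    have y: "y \<in> points P" "\<And>w. w \<in> points P \<Longrightarrow> orthogonal (x - y) w"
      using yz by (simp_all add: span_eq_iff[THEN iffD2])
    have "y - y' \<in> points P"
      using y(1) y' by (simp add: subspace_diff)
    then have "(x - y') \<bullet> (y - y') = 0" "(x - y) \<bullet> (y - y') = 0"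
      using y y' by (auto simp: orthogonal_def)
    then have "(y - y') \<bullet> (y - y') = 0"
      by (simp add: inner_diff_left inner_diff_right)
    then show "y' = y" by simp
  qed
qed

lemma orth_proj_in: "orth_proj P x \<in> points P"
  and orth_proj_orthogonal: "z \<in> points P \<Longrightarrow> orthogonal (x - orth_proj P x) z"
  using theI'[OF orth_proj_ex1, of P x] unfolding orth_proj_def by auto

lemma orth_proj_eqI:
  "y \<in> points P \<Longrightarrow> (\<And>z. z \<in> points P \<Longrightarrow> orthogonal (x - y) z) \<Longrightarrow> orth_proj P x = y"
  using orth_proj_ex1[of P x] orth_proj_in[of P x] orth_proj_orthogonal[of _ P x] by blast

lemma linear_orth_proj: "linear (orth_proj P)"
proof (rule linearI)
  fix x y
  show "orth_proj P (x + y) = orth_proj P x + orth_proj P y"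
  proof (rule orth_proj_eqI)
    show "orth_proj P x + orth_proj P y \<in> points P"
      by (simp add: orth_proj_in subspace_add)
    show "orthogonal (x + y - (orth_proj P x + orth_proj P y)) z" if "z \<in> points P" for z
      using orth_proj_orthogonal[OF that, of x] orth_proj_orthogonal[OF that, of y]
      by (simp add: orthogonal_def inner_diff_left inner_add_left)
  qed
next
  fix c x
  show "orth_proj P (c *\<^sub>R x) = c *\<^sub>R orth_proj P x"
  proof (rule orth_proj_eqI)
    show "c *\<^sub>R orth_proj P x \<in> points P"
      by (simp add: orth_proj_in subspace_scale)
    show "orthogonal (c *\<^sub>R x - c *\<^sub>R orth_proj P x) z" if "z \<in> points P" for z
      using orth_proj_orthogonal[OF that, of x]
      by (simp add: orthogonal_def inner_diff_left)
  qed
qed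

lemma range_orth_proj: "range (orth_proj P) = points P"
proof
  show "range (orth_proj P) \<subseteq> points P" by (auto simp: orth_proj_in)
  have "orth_proj P x = x" if "x \<in> points P" for x
    using that by (intro orth_proj_eqI) (auto simp: orthogonal_def)
  then show "points P \<subseteq> range (orth_proj P)" by (metis rangeI subsetI)
qed

instantiation linear_subspace :: (euclidean_space) metric_space
begin

definition dist_linear_subspace :: "'a linear_subspace \<Rightarrow> 'a linear_subspace \<Rightarrow> real" where
  "dist_linear_subspace T P = onorm (\<lambda>x. orth_proj T x - orth_proj P x)"

definition uniformity_linear_subspace :: "('a linear_subspace \<times> 'a linear_subspace) filter" where
  "uniformity_linear_subspace = (INF e\<in>{0<..}. principal {(x, y). dist x y < e})"

definition open_linear_subspace :: "'a linear_subspace set \<Rightarrow> bool" where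
  "open_linear_subspace U = (\<forall>x\<in>U. eventually (\<lambda>(x', y). x' = x \<longrightarrow> y \<in> U) uniformity)"

instance
proof
  have bl: "bounded_linear (\<lambda>x. orth_proj T x - orth_proj P x)" for T P :: "'a linear_subspace"
    using linear_orth_proj by (intro bounded_linear_sub linear_conv_bounded_linear[THEN iffD1])
  show "dist T P = 0 \<longleftrightarrow> T = P" for T P :: "'a linear_subspace"
  proof
    assume "dist T P = 0"
    then have "\<forall>x. orth_proj T x - orth_proj P x = 0"
      using onorm_eq_0[OF bl] by (simp add: dist_linear_subspace_def)
    then have "orth_proj T = orth_proj P" by auto
    then show "T = P"
      by (metis points_inject range_orth_proj)
  qed (simp add: dist_linear_subspace_def onorm_zero)
  show "dist T P \<le> dist T Q + dist P Q" for T P Q :: "'a linear_subspace"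
  proof -
    have "dist T P = onorm (\<lambda>x. (orth_proj T x - orth_proj Q x) + - (orth_proj P x - orth_proj Q x))"
      by (simp add: dist_linear_subspace_def)
    also have "\<dots> \<le> onorm (\<lambda>x. orth_proj T x - orth_proj Q x) + onorm (\<lambda>x. - (orth_proj P x - orth_proj Q x))"
      by (intro onorm_triangle bl bounded_linear_minus)
    also have "\<dots> = dist T Q + dist P Q"
      unfolding dist_linear_subspace_def by (subst onorm_neg) simp
    finally show ?thesis .
  qed
qed (simp_all add: uniformity_linear_subspace_def open_linear_subspace_def)

end

definition grassmannian :: "nat \<Rightarrow> 'a::euclidean_space linear_subspace set" where
  "grassmannian d = {P. dim (points P) = d}"

text \<open>
  The library's \<^const>\<open>diameter\<close> of an unbounded set is unspecified, hence the explicit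
  boundedness requirement. Empty sets, of diameter 0, may occur in a covering.
\<close>

definition hausdorff_coverings :: "real \<Rightarrow> 'a::metric_space set \<Rightarrow> (nat \<Rightarrow> 'a set) set" where
  "hausdorff_coverings \<delta> A = {C. A \<subseteq> (\<Union>j. C j) \<and> (\<forall>j. bounded (C j) \<and> diameter (C j) \<le> \<delta>)}"

definition hausdorff_size :: "nat \<Rightarrow> real \<Rightarrow> 'a::metric_space set \<Rightarrow> ennreal" where
  "hausdorff_size d \<delta> A =
    (INF C\<in>hausdorff_coverings \<delta> A. \<Sum>j. ennreal (unit_ball_vol (real d) * (diameter (C j) / 2) ^ d))"

definition hausdorff_outer :: "nat \<Rightarrow> 'a::metric_space set \<Rightarrow> ennreal" where
  "hausdorff_outer d A = (SUP \<delta>\<in>{0<..}. hausdorff_size d \<delta> A)"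

definition hausdorff_measurable :: "nat \<Rightarrow> 'a::metric_space set \<Rightarrow> bool" where
  "hausdorff_measurable d M \<longleftrightarrow> M \<in> lambda_system UNIV UNIV (hausdorff_outer d)"

text \<open>
  The restriction of the outer measure \<open>\<H>\<^sup>d\<close> to \<open>M\<close>, as a Borel measure.
  By \<open>emeasure_hausdorff_on\<close> below it has the expected values.
\<close>

definition hausdorff_on :: "nat \<Rightarrow> 'a::metric_space set \<Rightarrow> 'a measure" where
  "hausdorff_on d M = measure_of UNIV (sets borel) (\<lambda>B. hausdorff_outer d (B \<inter> M))"

lemma hausdorff_size_mono: "A \<subseteq> B \<Longrightarrow> hausdorff_size d \<delta> A \<le> hausdorff_size d \<delta> B"
  unfolding hausdorff_size_def by (rule INF_superset_mono) (auto simp: hausdorff_coverings_def)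

lemma hausdorff_size_antimono: "\<delta> \<le> \<epsilon> \<Longrightarrow> hausdorff_size d \<epsilon> A \<le> hausdorff_size d \<delta> A"
  unfolding hausdorff_size_def
  by (rule INF_superset_mono) (auto simp: hausdorff_coverings_def intro: order_trans)

lemma hausdorff_outer_mono: "A \<subseteq> B \<Longrightarrow> hausdorff_outer d A \<le> hausdorff_outer d B"
  unfolding hausdorff_outer_def by (intro SUP_mono') (rule hausdorff_size_mono)

lemma hausdorff_size_le_outer: "0 < \<delta> \<Longrightarrow> hausdorff_size d \<delta> A \<le> hausdorff_outer d A"
  unfolding hausdorff_outer_def by (rule SUP_upper) simp

lemma hausdorff_outer_empty:
  assumes "1 \<le> d" shows "hausdorff_outer d {} = 0"
proof -
  have "hausdorff_size d \<delta> ({} :: 'a set) = 0" if "0 < \<delta>" for \<delta>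
  proof -
    have "hausdorff_size d \<delta> ({} :: 'a set)
        \<le> (\<Sum>j. ennreal (unit_ball_vol (real d) * (diameter ((\<lambda>_::nat. {} :: 'a set) j) / 2) ^ d))"
      unfolding hausdorff_size_def using that by (intro INF_lower) (auto simp: hausdorff_coverings_def)
    also have "\<dots> = 0" using assms by (simp add: power_0_left)
    finally show ?thesis by simp
  qed
  then show ?thesis unfolding hausdorff_outer_def by simp
qed

lemma hausdorff_size_UN: "hausdorff_size d \<delta> (\<Union>i::nat. A i) \<le> (\<Sum>i. hausdorff_size d \<delta> (A i))"
proof (cases "(\<Sum>i. hausdorff_size d \<delta> (A i)) < top")
  case False
  then show ?thesis by (simp add: less_top[symmetric])
next
  case True
  let ?w = "\<lambda>S. ennreal (unit_ball_vol (real d) * (diameter S / 2) ^ d)"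
  show ?thesis
  proof (rule ennreal_le_epsilon)
    fix e :: real assume e: "0 < e"
    have fin: "hausdorff_size d \<delta> (A i) < top" for i
      using True ennreal_suminf_lessD by blast
    have "\<exists>C\<in>hausdorff_coverings \<delta> (A i). (\<Sum>j. ?w (C j)) < hausdorff_size d \<delta> (A i) + ennreal (e * (1/2) ^ Suc i)" for i
    proof -
      have "hausdorff_size d \<delta> (A i) < hausdorff_size d \<delta> (A i) + ennreal (e * (1/2) ^ Suc i)"
        using fin[of i] e by (cases "hausdorff_size d \<delta> (A i)") (auto simp: ennreal_plus[symmetric] ennreal_less_iff simp del: ennreal_plus)
      then show ?thesis
        by (subst (asm) hausdorff_size_def) (simp add: INF_less_iff)
    qed
    then obtain C where C: "\<And>i. C i \<in> hausdorff_coverings \<delta> (A i)"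
      "\<And>i. (\<Sum>j. ?w (C i j)) < hausdorff_size d \<delta> (A i) + ennreal (e * (1/2) ^ Suc i)"
      by metis
    define D where "D k = (case prod_decode k of (i, j) \<Rightarrow> C i j)" for k
    have "D \<in> hausdorff_coverings \<delta> (\<Union>i. A i)"
      unfolding hausdorff_coverings_def
    proof (intro CollectI conjI allI subsetI)
      fix x assume "x \<in> (\<Union>i. A i)"
      then obtain i j where "x \<in> C i j" using C(1) unfolding hausdorff_coverings_def by blast
      then have "x \<in> D (prod_encode (i, j))" by (simp add: D_def)
      then show "x \<in> (\<Union>k. D k)" by blast
    next
      fix k show "bounded (D k)" "diameter (D k) \<le> \<delta>"
        using C(1) by (auto simp: D_def hausdorff_coverings_def split: prod.split)
    qed
    then have "hausdorff_size d \<delta> (\<Union>i. A i) \<le> (\<Sum>k. ?w (D k))"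
      unfolding hausdorff_size_def by (rule INF_lower)
    also have "(\<Sum>k. ?w (D k)) = (\<Sum>k. (\<lambda>(i, j). ?w (C i j)) (prod_decode k))"
      by (simp add: D_def split_beta)
    also have "\<dots> = (\<Sum>i. \<Sum>j. ?w (C i j))"
      by (rule suminf_ennreal_2dimen) simp
    also have "\<dots> \<le> (\<Sum>i. hausdorff_size d \<delta> (A i) + ennreal (e * (1/2) ^ Suc i))"
      using C(2) by (intro suminf_le) (auto intro: less_imp_le)
    also have "\<dots> = (\<Sum>i. hausdorff_size d \<delta> (A i)) + (\<Sum>i. ennreal (e * (1/2) ^ Suc i))"
      by (rule suminf_add[symmetric]) auto
    also have "(\<Sum>i. ennreal (e * (1/2) ^ Suc i)) = ennreal (e * 1)"
      using e by (intro suminf_ennreal_eq sums_mult power_half_series) auto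
    finally show "hausdorff_size d \<delta> (\<Union>i. A i) \<le> (\<Sum>i. hausdorff_size d \<delta> (A i)) + ennreal e" by simp
  qed
qed

lemma hausdorff_outer_UN: "hausdorff_outer d (\<Union>i::nat. A i) \<le> (\<Sum>i. hausdorff_outer d (A i))"
proof -
  have "hausdorff_size d \<delta> (\<Union>i. A i) \<le> (\<Sum>i. hausdorff_outer d (A i))" if "0 < \<delta>" for \<delta>
    using hausdorff_size_UN
    by (rule order_trans) (intro suminf_le hausdorff_size_le_outer that, auto)
  then show ?thesis
    by (subst hausdorff_outer_def) (auto intro: SUP_least)
qed

lemma outer_measure_space_hausdorff:
  assumes "1 \<le> d"
  shows "outer_measure_space UNIV (hausdorff_outer d :: 'a::metric_space set \<Rightarrow> ennreal)"
  unfolding outer_measure_space_def positive_def increasing_def countably_subadditive_def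
  using assms by (auto simp: hausdorff_outer_empty hausdorff_outer_mono hausdorff_outer_UN)

lemma hausdorff_outer_Un:
  assumes "1 \<le> d"
  shows "hausdorff_outer d (A \<union> B) \<le> hausdorff_outer d A + hausdorff_outer d B"
proof -
  have "hausdorff_outer d (A \<union> B) = hausdorff_outer d (\<Union>i. binaryset A B i)"
    by (simp add: UN_binaryset_eq)
  also have "\<dots> \<le> (\<Sum>i. hausdorff_outer d (binaryset A B i))"
    by (rule hausdorff_outer_UN)
  also have "\<dots> = hausdorff_outer d A + hausdorff_outer d B"
    using assms by (intro suminf_binaryset_eq) (simp add: hausdorff_outer_empty)
  finally show ?thesis .
qed

lemma hausdorff_outer_separated:
  fixes A B :: "'a::metric_space set"
  assumes d: "1 \<le> d" and eta: "0 < \<eta>" and sep: "\<And>x y. x \<in> A \<Longrightarrow> y \<in> B \<Longrightarrow> \<eta> \<le> dist x y"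
  shows "hausdorff_outer d A + hausdorff_outer d B \<le> hausdorff_outer d (A \<union> B)"
proof -
  let ?w = "\<lambda>S :: 'a set. ennreal (unit_ball_vol (real d) * (diameter S / 2) ^ d)"
  have w0: "?w {} = 0" using d by (simp add: power_0_left)
  have size: "hausdorff_size d \<delta> A + hausdorff_size d \<delta> B \<le> hausdorff_size d \<delta> (A \<union> B)"
    if \<delta>: "0 < \<delta>" "\<delta> < \<eta>" for \<delta>
    unfolding hausdorff_size_def[of d \<delta> "A \<union> B"]
  proof (rule INF_greatest)
    fix C assume C: "C \<in> hausdorff_coverings \<delta> (A \<union> B)"
    define C1 where "C1 j = (if C j \<inter> A = {} then {} else C j)" for j
    define C2 where "C2 j = (if C j \<inter> A = {} then C j else {})" for j
    have "C1 \<in> hausdorff_coverings \<delta> A"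
      using C \<delta> unfolding hausdorff_coverings_def C1_def by (auto dest!: subsetD)
    then have 1: "hausdorff_size d \<delta> A \<le> (\<Sum>j. ?w (C1 j))"
      unfolding hausdorff_size_def by (rule INF_lower)
    have "y \<in> (\<Union>j. C2 j)" if "y \<in> B" for y
    proof -
      obtain j where j: "y \<in> C j" using C \<open>y \<in> B\<close> by (auto simp: hausdorff_coverings_def)
      have "C j \<inter> A = {}"
      proof (rule ccontr)
        assume "C j \<inter> A \<noteq> {}"
        then obtain x where x: "x \<in> C j" "x \<in> A" by blast
        have "dist x y \<le> diameter (C j)"
          using C x j by (intro diameter_bounded_bound) (auto simp: hausdorff_coverings_def)
        also have "\<dots> \<le> \<delta>" using C by (auto simp: hausdorff_coverings_def)
        finally show False using sep[OF x(2) \<open>y \<in> B\<close>] \<delta> by simp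
      qed
      then show ?thesis using j by (auto simp: C2_def)
    qed
    then have "C2 \<in> hausdorff_coverings \<delta> B"
      using C \<delta> by (auto simp: hausdorff_coverings_def C2_def)
    then have 2: "hausdorff_size d \<delta> B \<le> (\<Sum>j. ?w (C2 j))"
      unfolding hausdorff_size_def by (rule INF_lower)
    have "(\<Sum>j. ?w (C1 j)) + (\<Sum>j. ?w (C2 j)) = (\<Sum>j. ?w (C1 j) + ?w (C2 j))"
      by (rule suminf_add) auto
    also have "\<dots> = (\<Sum>j. ?w (C j))"
      by (rule arg_cong[where f = suminf]) (use w0 in \<open>auto simp: C1_def C2_def fun_eq_iff\<close>)
    finally show "hausdorff_size d \<delta> A + hausdorff_size d \<delta> B \<le> (\<Sum>j. ?w (C j))"
      using add_mono[OF 1 2] by simp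
  qed
  have "hausdorff_size d \<delta> A + hausdorff_size d \<epsilon> B \<le> hausdorff_outer d (A \<union> B)"
    if "0 < \<delta>" "0 < \<epsilon>" for \<delta> \<epsilon>
  proof -
    define \<rho> where "\<rho> = min (min \<delta> \<epsilon>) (\<eta> / 2)"
    have \<rho>: "0 < \<rho>" "\<rho> < \<eta>" "\<rho> \<le> \<delta>" "\<rho> \<le> \<epsilon>" using that eta by (auto simp: \<rho>_def)
    have "hausdorff_size d \<delta> A + hausdorff_size d \<epsilon> B \<le> hausdorff_size d \<rho> A + hausdorff_size d \<rho> B"
      using \<rho> by (intro add_mono hausdorff_size_antimono)
    also have "\<dots> \<le> hausdorff_size d \<rho> (A \<union> B)" using \<rho> by (intro size)
    also have "\<dots> \<le> hausdorff_outer d (A \<union> B)" using \<rho> by (intro hausdorff_size_le_outer)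
    finally show ?thesis .
  qed
  then have "hausdorff_size d \<delta> A + hausdorff_outer d B \<le> hausdorff_outer d (A \<union> B)" if "0 < \<delta>" for \<delta>
    unfolding hausdorff_outer_def[of d B] using that
    by (subst ennreal_SUP_add_right) (auto intro!: SUP_least)
  then show ?thesis
    unfolding hausdorff_outer_def[of d A]
    by (subst ennreal_SUP_add_left[symmetric]) (auto intro!: SUP_least)
qed

lemma closed_hausdorff_measurable:
  fixes C :: "'a::metric_space set"
  assumes d: "1 \<le> d" and C: "closed C"
  shows "hausdorff_measurable d C"
proof -
  let ?H = "hausdorff_outer d :: 'a set \<Rightarrow> ennreal"
  have main: "?H (A \<inter> C) + ?H (A - C) \<le> ?H A" if ne: "C \<noteq> {}" and fin: "?H A < top" for A
  proof -
    define R where "R k = {x \<in> A. 1 / real (Suc (Suc k)) \<le> infdist x C \<and> infdist x C < 1 / real (Suc k)}" for k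
    define F where "F k = {x \<in> A. 1 / real (Suc k) \<le> infdist x C}" for k
    have idist: "infdist x C - infdist y C \<le> dist x y" for x y
      using infdist_triangle[of x C y] by simp
    have sum_le: "(\<Sum>k<N. ?H (R (2 * k + p))) \<le> ?H (\<Union>k<N. R (2 * k + p))" for N p
    proof (induction N)
      case 0 then show ?case by simp
    next
      case (Suc N)
      let ?S = "\<Union>k<N. R (2 * k + p)"
      let ?\<eta> = "1 / real (Suc (2 * N + p)) - 1 / real (Suc (Suc (2 * N + p))) :: real"
      have sep: "1 / real (2 * N + p) - 1 / real (Suc (2 * N + p)) \<le> dist x y"
        if "x \<in> ?S" "y \<in> R (2 * N + p)" for x y
      proof -
        obtain k where k: "k < N" "x \<in> R (2 * k + p)" using \<open>x \<in> ?S\<close> by blast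
        have "Suc (Suc (2 * k + p)) \<le> 2 * N + p" using k by simp
        then have "1 / real (2 * N + p) \<le> 1 / real (Suc (Suc (2 * k + p)))"
          by (intro divide_left_mono) auto
        moreover have "1 / real (Suc (Suc (2 * k + p))) \<le> infdist x C" using k by (simp add: R_def)
        moreover have "infdist y C < 1 / real (Suc (2 * N + p))" using that by (simp add: R_def)
        ultimately show ?thesis using idist[of x y] by linarith
      qed
      have "?H ?S + ?H (R (2 * N + p)) \<le> ?H (?S \<union> R (2 * N + p))"
      proof (cases "N = 0")
        case True
        then show ?thesis using d by (simp add: hausdorff_outer_empty)
      next
        case False
        then have "0 < 1 / real (2 * N + p) - 1 / real (Suc (2 * N + p))"
          by (auto intro!: divide_strict_left_mono mult_pos_pos)
        then show ?thesis using sep by (intro hausdorff_outer_separated[OF d]) auto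
      qed
      moreover have "?S \<union> R (2 * N + p) = (\<Union>k<Suc N. R (2 * k + p))"
        by (auto simp: lessThan_Suc)
      ultimately show ?case
        unfolding sum.lessThan_Suc by (metis (no_types, lifting) Suc.IH add_right_mono order_trans)
    qed
    have half: "(\<Sum>k. ?H (R (2 * k + p))) \<le> ?H A" for p
    proof (rule suminf_le_const)
      show "summable (\<lambda>k. ?H (R (2 * k + p)))" by simp
      show "(\<Sum>k<N. ?H (R (2 * k + p))) \<le> ?H A" for N
        using sum_le by (rule order_trans) (rule hausdorff_outer_mono, auto simp: R_def)
    qed
    have tot: "(\<Sum>k. ?H (R k)) < top"
    proof -
      have "(\<Sum>k<N. ?H (R k)) \<le> ?H A + ?H A" for N
      proof -
        have "(\<Sum>k<N. ?H (R k)) \<le> (\<Sum>k<2 * N. ?H (R k))"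
          by (rule sum_mono2) auto
        also have "\<dots> = (\<Sum>k<N. ?H (R (2 * k + 0))) + (\<Sum>k<N. ?H (R (2 * k + 1)))"
          by (induction N) (auto simp: ac_simps)
        also have "\<dots> \<le> (\<Sum>k. ?H (R (2 * k + 0))) + (\<Sum>k. ?H (R (2 * k + 1)))"
          by (intro add_mono sum_le_suminf) auto
        also have "\<dots> \<le> ?H A + ?H A" by (intro add_mono half)
        finally show ?thesis .
      qed
      then have "(\<Sum>k. ?H (R k)) \<le> ?H A + ?H A" by (intro suminf_le_const) auto
      also have "\<dots> < top" using fin by simp
      finally show ?thesis .
    qed
    have cover: "A - C \<subseteq> F k \<union> (\<Union>j. R (j + k))" for k
    proof
      fix x assume x: "x \<in> A - C"
      have pos: "0 < infdist x C"
        using x C ne by (metis DiffE in_closed_iff_infdist_zero infdist_nonneg less_eq_real_def)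
      show "x \<in> F k \<union> (\<Union>j. R (j + k))"
      proof (cases "1 / real (Suc k) \<le> infdist x C")
        case True then show ?thesis using x by (auto simp: F_def)
      next
        case False
        obtain n where n: "1 / real (Suc n) < infdist x C"
          using pos nat_approx_posE by metis
        define m where "m = (LEAST m. 1 / real (Suc m) \<le> infdist x C)"
        have m: "1 / real (Suc m) \<le> infdist x C"
          unfolding m_def by (rule LeastI[of _ n]) (use n in simp)
        have "k < m"
        proof (rule ccontr)
          assume "\<not> k < m"
          then have "1 / real (Suc k) \<le> 1 / real (Suc m)" by (intro divide_left_mono) auto
          then show False using m False by simp
        qed
        then obtain l where l: "m = Suc l" "k \<le> l" by (cases m) auto
        have "\<not> 1 / real (Suc l) \<le> infdist x C"
          using not_less_Least[of l "\<lambda>m. 1 / real (Suc m) \<le> infdist x C"] l m_def by auto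
        then have "x \<in> R l" using m l x by (auto simp: R_def)
        then have "x \<in> R ((l - k) + k)" using l by simp
        then show ?thesis by blast
      qed
    qed
    have step: "?H (A \<inter> C) + ?H (A - C) \<le> ?H A + (\<Sum>j. ?H (R (j + k)))" for k
    proof -
      have "?H (A - C) \<le> ?H (F k \<union> (\<Union>j. R (j + k)))" by (rule hausdorff_outer_mono[OF cover])
      also have "\<dots> \<le> ?H (F k) + ?H (\<Union>j. R (j + k))" by (rule hausdorff_outer_Un[OF d])
      also have "\<dots> \<le> ?H (F k) + (\<Sum>j. ?H (R (j + k)))" by (intro add_left_mono hausdorff_outer_UN)
      finally have "?H (A \<inter> C) + ?H (A - C) \<le> (?H (A \<inter> C) + ?H (F k)) + (\<Sum>j. ?H (R (j + k)))"
        by (simp add: add.assoc add_left_mono)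
      moreover have "?H (A \<inter> C) + ?H (F k) \<le> ?H ((A \<inter> C) \<union> F k)"
      proof (rule hausdorff_outer_separated[OF d, of "1 / real (Suc k)"])
        fix x y assume "x \<in> A \<inter> C" "y \<in> F k"
        then show "1 / real (Suc k) \<le> dist x y"
          using infdist_le[of x C y] by (auto simp: F_def dist_commute)
      qed simp
      moreover have "?H ((A \<inter> C) \<union> F k) \<le> ?H A"
        by (rule hausdorff_outer_mono) (auto simp: F_def)
      ultimately show ?thesis
        by (meson add_right_mono order_trans)
    qed
    have "(\<lambda>k. \<Sum>j. ?H (R (j + k))) \<longlonglongrightarrow> 0"
    proof -
      have fink: "?H (R k) < top" for k using tot ennreal_suminf_lessD by blast
      define f where "f k = enn2real (?H (R k))" for k
      have f: "?H (R k) = ennreal (f k)" "0 \<le> f k" for k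
        using fink[of k] by (auto simp: f_def)
      have sf: "summable f"
        using tot f by (intro summable_suminf_not_top) auto
      have "(\<Sum>j. ?H (R (j + k))) = ennreal (\<Sum>j. f (j + k))" for k
        using f sf by (simp add: suminf_ennreal2 summable_iff_shift)
      moreover have "(\<lambda>k. ennreal (\<Sum>j. f (j + k))) \<longlonglongrightarrow> ennreal 0"
        by (intro tendsto_ennrealI suminf_exist_split2 sf)
      ultimately show ?thesis by simp
    qed
    then have "(\<lambda>k. ?H A + (\<Sum>j. ?H (R (j + k)))) \<longlonglongrightarrow> ?H A + 0"
      by (intro tendsto_add tendsto_const)
    then show ?thesis
      using step by (intro LIMSEQ_le_const) auto
  qed
  have "?H (A \<inter> C) + ?H (A - C) = ?H A" for A
  proof (rule antisym)
    show "?H (A \<inter> C) + ?H (A - C) \<le> ?H A"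
      using main[of A] d by (cases "C = {}"; cases "?H A = top") (auto simp: hausdorff_outer_empty less_top)
    have "?H A \<le> ?H ((A \<inter> C) \<union> (A - C))" by (rule hausdorff_outer_mono) auto
    also have "\<dots> \<le> ?H (A \<inter> C) + ?H (A - C)" by (rule hausdorff_outer_Un[OF d])
    finally show "?H A \<le> ?H (A \<inter> C) + ?H (A - C)" .
  qed
  then show ?thesis
    unfolding hausdorff_measurable_def lambda_system_def
    by (simp add: Int_commute Diff_eq)
qed

lemma measure_space_hausdorff_measurable:
  assumes "1 \<le> d"
  shows "measure_space UNIV (Collect (hausdorff_measurable d :: 'a::metric_space set \<Rightarrow> bool)) (hausdorff_outer d)"
  using sigma_algebra.caratheodory_lemma[OF sigma_algebra_Pow, of UNIV "hausdorff_outer d"]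
    outer_measure_space_hausdorff[OF assms]
  by (simp add: hausdorff_measurable_def[abs_def])

lemma borel_hausdorff_measurable:
  assumes "1 \<le> d" "B \<in> sets borel"
  shows "hausdorff_measurable d (B :: 'a::metric_space set)"
proof -
  interpret sigma_algebra UNIV "Collect (hausdorff_measurable d :: 'a set \<Rightarrow> bool)"
    using measure_space_hausdorff_measurable[OF assms(1), where 'a = 'a] by (simp add: measure_space_def)
  have "sets borel \<subseteq> Collect (hausdorff_measurable d :: 'a set \<Rightarrow> bool)"
    unfolding borel_eq_closed using closed_hausdorff_measurable[OF assms(1)]
    by (auto simp: sets_measure_of intro!: sigma_sets_subset)
  then show ?thesis using assms by blast
qed

lemma space_hausdorff_on [simp]: "space (hausdorff_on d M) = UNIV"
  and sets_hausdorff_on [simp, measurable_cong]: "sets (hausdorff_on d M) = sets borel"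
  using sets.sigma_sets_eq[of borel] by (simp_all add: hausdorff_on_def sets_measure_of_conv)

lemma emeasure_hausdorff_on:
  fixes M :: "'a::metric_space set"
  assumes d: "1 \<le> d" and B: "B \<in> sets borel"
  shows "emeasure (hausdorff_on d M) B = hausdorff_outer d (B \<inter> M)"
proof -
  let ?f = "\<lambda>B. hausdorff_outer d (B \<inter> M)"
  have oms: "outer_measure_space UNIV ?f"
    using d unfolding outer_measure_space_def positive_def increasing_def countably_subadditive_def
    by (auto simp: hausdorff_outer_empty hausdorff_outer_UN[of d "\<lambda>i. _ i \<inter> M"] Int_UN_distrib2[symmetric]
        intro!: hausdorff_outer_mono intro: order_trans[OF _ hausdorff_outer_UN])
  have ms: "measure_space UNIV (lambda_system UNIV UNIV ?f) ?f"
    using sigma_algebra.caratheodory_lemma[OF sigma_algebra_Pow, of UNIV ?f] oms by simp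
  have "sets borel \<subseteq> lambda_system UNIV UNIV ?f"
  proof
    fix B :: "'a set" assume "B \<in> sets borel"
    then have "hausdorff_measurable d B" by (rule borel_hausdorff_measurable[OF d])
    then show "B \<in> lambda_system UNIV UNIV ?f"
      by (auto simp: hausdorff_measurable_def lambda_system_def Int_assoc)
  qed
  then have "measure_space UNIV (sets borel) ?f"
    using measure_down[OF ms] sets.sigma_algebra_axioms[of borel] by simp
  then show ?thesis
    unfolding hausdorff_on_def using B
    by (intro emeasure_measure_of_sigma) (auto simp: measure_space_def)
qed

text \<open>Functions in \<open>C\<^sub>c(S)\<close> are extended by 0 outside \<open>S\<close>.\<close>

definition Cc :: "'a::topological_space set \<Rightarrow> ('a \<Rightarrow> real) set" where
  "Cc S = {\<phi>. continuous_on S \<phi> \<and> (\<exists>K. compact K \<and> K \<subseteq> S \<and> (\<forall>x. x \<notin> K \<longrightarrow> \<phi> x = 0))}"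

definition radon_measure_on :: "'a::topological_space set \<Rightarrow> 'a measure \<Rightarrow> bool" where
  "radon_measure_on S \<mu> \<longleftrightarrow>
    sets \<mu> = sets (restrict_space borel S) \<and>
    (\<forall>K. compact K \<and> K \<subseteq> S \<longrightarrow> emeasure \<mu> K < \<infinity>) \<and>
    (\<forall>B\<in>sets \<mu>. emeasure \<mu> B = (SUP K\<in>{K. compact K \<and> K \<subseteq> B}. emeasure \<mu> K))"

definition varifold :: "nat \<Rightarrow> 'a::euclidean_space set \<Rightarrow> ('a \<times> 'a linear_subspace) measure \<Rightarrow> bool" where
  "varifold d \<Omega> V \<longleftrightarrow> radon_measure_on (\<Omega> \<times> grassmannian d) V"

definition weak_star_converges ::
  "'a::topological_space set \<Rightarrow> (nat \<Rightarrow> 'a measure) \<Rightarrow> 'a measure \<Rightarrow> bool" where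
  "weak_star_converges S \<mu> \<nu> \<longleftrightarrow>
    (\<forall>\<phi>\<in>Cc S. (\<lambda>i. \<integral>z. \<phi> z \<partial>\<mu> i) \<longlonglongrightarrow> (\<integral>z. \<phi> z \<partial>\<nu>))"

definition mass :: "'a::euclidean_space set \<Rightarrow> ('a \<times> 'a linear_subspace) measure \<Rightarrow> 'a measure" where
  "mass \<Omega> V = distr V (restrict_space borel \<Omega>) fst"

lemma space_mass [simp]: "space (mass \<Omega> V) = \<Omega>"
  and sets_mass [simp, measurable_cong]: "sets (mass \<Omega> V) = sets (restrict_space borel \<Omega>)"
  by (simp_all add: mass_def space_restrict_space)

lemma emeasure_mass:
  fixes \<Omega> :: "'a::euclidean_space set"
  assumes V: "varifold d \<Omega> V" and B: "B \<in> sets (restrict_space borel \<Omega>)"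
  shows "emeasure (mass \<Omega> V) B = emeasure V (B \<times> grassmannian d)"
proof -
  have sets: "sets V = sets (restrict_space borel (\<Omega> \<times> grassmannian d))"
    using V by (simp add: varifold_def radon_measure_on_def)
  then have space: "space V = \<Omega> \<times> grassmannian d"
    using sets_eq_imp_space_eq[OF sets] by (simp add: space_restrict_space)
  have "fst \<in> (borel :: ('a \<times> 'a linear_subspace) measure) \<rightarrow>\<^sub>M (borel :: 'a measure)"
    by (intro borel_measurable_continuous_onI continuous_intros)
  then have "fst \<in> restrict_space borel (\<Omega> \<times> (grassmannian d :: 'a linear_subspace set)) \<rightarrow>\<^sub>M restrict_space (borel :: 'a measure) \<Omega>"
    by (intro measurable_restrict_space2 measurable_restrict_space1) (auto simp: space_restrict_space)
  then have "fst \<in> V \<rightarrow>\<^sub>M restrict_space (borel :: 'a measure) \<Omega>"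
    using measurable_cong_sets[OF sets refl] by blast
  then have "emeasure (mass \<Omega> V) B = emeasure V (fst -` B \<inter> space V)"
    unfolding mass_def using B by (rule emeasure_distr)
  also have "fst -` B \<inter> space V = B \<times> grassmannian d"
    using sets.sets_into_space[OF B] by (auto simp: space space_restrict_space)
  finally show ?thesis .
qed

definition dist_to_set :: "'a::metric_space \<Rightarrow> 'a set \<Rightarrow> ereal" where
  "dist_to_set x S = (INF y\<in>S. ereal (dist x y))"

text \<open>
  For \<open>\<alpha> > 1\<close> the domain of integration is empty and the excess is 0.
\<close>

definition height_excess ::
  "nat \<Rightarrow> 'a::euclidean_space set \<Rightarrow> real \<Rightarrow> 'a \<Rightarrow> 'a linear_subspace \<Rightarrow>
    ('a \<times> 'a linear_subspace) measure \<Rightarrow> ennreal" where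
  "height_excess d \<Omega> \<alpha> x P V =
    (\<integral>\<^sup>+r\<in>{\<alpha>..1}.
      (ennreal (1 / r ^ d) *
       (\<integral>\<^sup>+y\<in>ball x r \<inter> \<Omega>. ennreal ((infdist (y - x) (points P) / r)\<^sup>2) \<partial>mass \<Omega> V) *
       ennreal (1 / r)) \<partial>lborel)"

text \<open>
  \<open>\<real>\<^sup>d\<close>, for a number \<open>d\<close>, is the set of real functions on \<open>{..<d}\<close> with the Euclidean distance.
\<close>

definition countably_rectifiable :: "nat \<Rightarrow> 'a::euclidean_space set \<Rightarrow> bool" where
  "countably_rectifiable d M \<longleftrightarrow>
    (\<exists>M0 (f :: nat \<Rightarrow> (nat \<Rightarrow> real) \<Rightarrow> 'a).
      hausdorff_outer d M0 = 0 \<and>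
      (\<forall>i. \<exists>L. \<forall>u\<in>{..<d} \<rightarrow>\<^sub>E UNIV. \<forall>v\<in>{..<d} \<rightarrow>\<^sub>E UNIV.
        dist (f i u) (f i v) \<le> L * L2_set (\<lambda>k. u k - v k) {..<d}) \<and>
      M \<subseteq> M0 \<union> (\<Union>i. f i ` ({..<d} \<rightarrow>\<^sub>E UNIV)))"

definition is_approx_tangent ::
  "nat \<Rightarrow> 'a::euclidean_space set \<Rightarrow> ('a \<Rightarrow> real) \<Rightarrow> 'a \<Rightarrow> 'a linear_subspace \<Rightarrow> bool" where
  "is_approx_tangent d M \<theta> x P \<longleftrightarrow>
    P \<in> grassmannian d \<and>
    (\<forall>\<phi>\<in>Cc UNIV.
      ((\<lambda>r. (1 / r ^ d) * (\<integral>y. \<phi> ((1 / r) *\<^sub>R (y - x)) \<partial>density (hausdorff_on d M) (\<lambda>y. ennreal (\<theta> y))))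
        \<longlongrightarrow> \<theta> x * (\<integral>y. \<phi> y \<partial>hausdorff_on d (points P))) (at_right 0))"

text \<open>
  Where \<open>\<theta> x > 0\<close> there is at most one approximate tangent space. The map \<open>T\<close> below is a Borel
  version of \<open>x \<mapsto> T\<^sub>xM\<close>, which is only determined almost everywhere on \<open>M\<close>; its
  measurability is required because the Bochner integral of a non-measurable function is 0.
\<close>

definition rectifiable_varifold ::
  "nat \<Rightarrow> 'a::euclidean_space set \<Rightarrow> ('a \<times> 'a linear_subspace) measure \<Rightarrow> bool" where
  "rectifiable_varifold d \<Omega> V \<longleftrightarrow>
    varifold d \<Omega> V \<and>
    (\<exists>M \<theta> T.
      M \<subseteq> \<Omega> \<and> hausdorff_measurable d M \<and> countably_rectifiable d M \<and>
      \<theta> \<in> borel_measurable borel \<and> (\<forall>x. 0 \<le> \<theta> x) \<and>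
      hausdorff_outer d {x \<in> M. \<not> 0 < \<theta> x} = 0 \<and>
      T \<in> borel_measurable borel \<and>
      hausdorff_outer d {x \<in> M. \<not> is_approx_tangent d M \<theta> x (T x)} = 0 \<and>
      (\<forall>\<phi>\<in>Cc (\<Omega> \<times> grassmannian d).
        (\<integral>z. \<phi> z \<partial>V) = (\<integral>x. \<phi> (x, T x) * \<theta> x \<partial>hausdorff_on d M)))"

end

theory Submission
  imports Defs
begin

text \<open>
  The excess at \<open>(x, P)\<close> compares the mass with one and the same plane \<open>P\<close> at every scale; finiteness of
  its limit therefore forces genuine tangency at \<open>x\<close>, and the theorem becomes a statement about sets that have
  a tangent plane at each point. Write \<open>\<mu>\<close> for the mass of the limit \<open>V\<close>.

  Passage to the limit. Integrating in \<open>r\<close> first turns the excess into an integral in \<open>y\<close> of a kernel that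
  dominates, up to a constant, \<open>d(y - x, P)\<^sup>2 / |y - x|\<^bsup>d+2\<^esup>\<close> for \<open>\<alpha>\<^sub>i \<le> |y - x| \<le> 1/2\<close>. Continuous compactly supported
  truncations of this kernel can be tested against the products of \<open>V\<^sub>i\<close> with its mass
  (\<open>double_integral_limit\<close>), so the bound on the excess yields \<open>\<integral> d(y - x, P)\<^sup>2 / |y - x|\<^bsup>d+2\<^esup> d\<mu>(y) < \<infinity>\<close>
  near \<open>x\<close>, for \<open>V\<close>-almost every \<open>(x, P)\<close> (\<open>AE_height_kernel_finite\<close>). The density bounds survive on the
  support \<open>S\<close> of \<open>\<mu>\<close>, at all small radii and with worse constants (\<open>density_bounds\<close>). If points \<open>y\<close> of \<open>S\<close>
  with \<open>d(y - x, P) > \<epsilon> |y - x|\<close> accumulated at \<open>x\<close>, each of the balls of radius \<open>\<epsilon> |y - x| / 4\<close> about them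
  would contribute a fixed positive amount to this convergent integral. So near \<open>x\<close> the set \<open>S\<close> lies in
  every cone about \<open>P\<close> (\<open>tangent_cone_of_height_kernel\<close>).

  Rectifiability. By compactness and separability, \<open>\<mu>\<close> is carried by countably many compact pieces, each
  of which lies, seen from any of its points, in a thin cone about one plane \<open>Q\<close> (\<open>flat_pieces\<close>). Such a
  piece is the graph of a Lipschitz map over a subset of \<open>Q\<close> (\<open>nearly_flat_Lipschitz_param\<close>). The density
  bounds make \<open>\<mu>\<close> and \<open>\<H>\<^sup>d\<close> mutually absolutely continuous on the union \<open>M\<close> of the pieces, and
  Radon-Nikodym gives \<open>\<mu> = \<theta> \<H>\<^sup>d\<close> on \<open>M\<close> (\<open>exists_density\<close>).

  Tangent planes. The projection onto \<open>Q\<close> distorts \<open>\<H>\<^sup>d\<close> on a piece of aperture \<open>\<eta>\<close> by at most the factor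
  \<open>(1 - \<eta>)\<^bsup>-d\<^esup>\<close>. Where the piece has full density in \<open>S\<close> and its projection has full density in \<open>Q\<close>, the
  rescalings of \<open>\<mu>\<close> therefore differ little from \<open>\<theta>(x) \<H>\<^sup>d\<close> on \<open>Q\<close>, and this differs little from
  \<open>\<theta>(x) \<H>\<^sup>d\<close> on \<open>P\<close>, with errors that vanish with \<open>\<eta>\<close> (\<open>blowup_estimate\<close>); \<open>\<eta> \<rightarrow> 0\<close> makes \<open>P\<close> the approximate tangent plane. Both density
  statements follow from one covering argument (\<open>hausdorff_outer_le_of_lower_density\<close>). Approximate tangent
  planes are unique, so \<open>P = T(x)\<close> almost everywhere and \<open>V\<close> has the required form.
\<close>

section \<open>Coverings and densities for Hausdorff measure\<close>

lemma ennreal_le_mult_INF: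
  assumes "0 < a" "\<And>i. i \<in> I \<Longrightarrow> x \<le> ennreal a * f i"
  shows "x \<le> ennreal a * (INF i\<in>I. f i)"
proof -
  have inv: "ennreal a * (ennreal (1 / a) * y) = y" "ennreal (1 / a) * (ennreal a * y) = y" for y
  proof -
    have "ennreal a * ennreal (1 / a) = 1" "ennreal (1 / a) * ennreal a = 1"
      using assms(1) by (auto simp flip: ennreal_mult)
    then show "ennreal a * (ennreal (1 / a) * y) = y" "ennreal (1 / a) * (ennreal a * y) = y"
      unfolding mult.assoc[symmetric] by simp_all
  qed
  have "ennreal (1 / a) * x \<le> f i" if "i \<in> I" for i
    using mult_left_mono[OF assms(2)[OF that], of "ennreal (1 / a)"] by (simp add: inv)
  then have "ennreal (1 / a) * x \<le> (INF i\<in>I. f i)" by (intro INF_greatest)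
  then have "ennreal a * (ennreal (1 / a) * x) \<le> ennreal a * (INF i\<in>I. f i)" by (intro mult_left_mono) auto
  then show ?thesis by (simp only: inv)
qed

text \<open>
  Coverings found by Vitali's lemma or by a grid come with index sets of their own; this converts them to
  the sequences in the definition of the measure.
\<close>

lemma hausdorff_size_le_countable_cover:
  fixes A :: "'a::metric_space set" and C :: "'i \<Rightarrow> 'a set"
  assumes d: "1 \<le> d" and "0 \<le> \<delta>" and I: "countable I" and cov: "A \<subseteq> (\<Union>i\<in>I. C i)"
    and C: "\<And>i. i \<in> I \<Longrightarrow> bounded (C i)" "\<And>i. i \<in> I \<Longrightarrow> diameter (C i) \<le> \<delta>"
  shows "hausdorff_size d \<delta> A
    \<le> (\<integral>\<^sup>+i. ennreal (unit_ball_vol (real d) * (diameter (C i) / 2) ^ d) \<partial>count_space I)"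
proof -
  let ?w = "\<lambda>S :: 'a set. ennreal (unit_ball_vol (real d) * (diameter S / 2) ^ d)"
  define e where "e = to_nat_on I"
  have inj: "inj_on e I" using I by (simp add: e_def inj_on_to_nat_on)
  define D where "D n = (if n \<in> e ` I then C (the_inv_into I e n) else {})" for n
  have D: "D (e i) = C i" if "i \<in> I" for i
    using that inj by (simp add: D_def the_inv_into_f_f)
  have "D \<in> hausdorff_coverings \<delta> A"
    unfolding hausdorff_coverings_def
  proof (intro CollectI conjI allI subsetI)
    fix x assume "x \<in> A"
    then obtain i where "i \<in> I" "x \<in> C i" using cov by blast
    then show "x \<in> (\<Union>n. D n)" using D by blast
  next
    fix n show "bounded (D n)" "diameter (D n) \<le> \<delta>"
      using C \<open>0 \<le> \<delta>\<close> inj by (auto simp: D_def the_inv_into_f_f)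
  qed
  then have "hausdorff_size d \<delta> A \<le> (\<Sum>n. ?w (D n))"
    unfolding hausdorff_size_def by (rule INF_lower)
  also have "\<dots> = (\<integral>\<^sup>+n. ?w (D n) \<partial>count_space UNIV)"
    by (simp add: nn_integral_count_space_nat)
  also have "\<dots> = (\<integral>\<^sup>+n. ?w (D n) \<partial>count_space (e ` I))"
    using d by (intro nn_integral_count_space_eq) (auto simp: D_def power_0_left)
  also have "\<dots> = (\<integral>\<^sup>+i. ?w (D (e i)) \<partial>count_space I)"
    using inj by (subst nn_integral_bij_count_space[of e I "e ` I"]) (auto simp: bij_betw_def)
  also have "\<dots> = (\<integral>\<^sup>+i. ?w (C i) \<partial>count_space I)"
    using D by (intro nn_integral_cong) simp
  finally show ?thesis .
qed

lemma hausdorff_outer_null_mono: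
  "hausdorff_outer d B = 0 \<Longrightarrow> A \<subseteq> B \<Longrightarrow> hausdorff_outer d A = 0"
  using hausdorff_outer_mono[of A B d] by simp

lemma hausdorff_outer_null_UN:
  assumes "countable I" "1 \<le> d" "\<And>i. i \<in> I \<Longrightarrow> hausdorff_outer d (A i :: 'a::metric_space set) = 0"
  shows "hausdorff_outer d (\<Union>i\<in>I. A i) = 0"
proof (cases "I = {}")
  case True then show ?thesis using assms by (simp add: hausdorff_outer_empty)
next
  case False
  then have "(\<Union>i\<in>I. A i) = (\<Union>n. A (from_nat_into I n))"
    using range_from_nat_into[OF False assms(1)] by (metis image_image)
  moreover have "hausdorff_outer d (\<Union>n. A (from_nat_into I n)) \<le> (\<Sum>n. hausdorff_outer d (A (from_nat_into I n)))"
    by (rule hausdorff_outer_UN)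
  moreover have "\<dots> = 0" using assms False by (simp add: from_nat_into)
  ultimately show ?thesis by simp
qed

lemma hausdorff_outer_Lipschitz_image:
  fixes f :: "'a::metric_space \<Rightarrow> 'b::metric_space"
  assumes d: "1 \<le> d" and L: "0 < L"
    and f: "\<And>x y. x \<in> A \<Longrightarrow> y \<in> A \<Longrightarrow> dist (f x) (f y) \<le> L * dist x y"
  shows "hausdorff_outer d (f ` A) \<le> ennreal (L ^ d) * hausdorff_outer d A"
proof -
  let ?w = "\<lambda>r. ennreal (unit_ball_vol (real d) * (r / 2) ^ d)"
  have diam: "bounded (f ` (A \<inter> S)) \<and> diameter (f ` (A \<inter> S)) \<le> L * diameter S" if S: "bounded S" for S
  proof -
    have *: "dist (f x) (f y) \<le> L * diameter S" if "x \<in> A \<inter> S" "y \<in> A \<inter> S" for x y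
    proof -
      have "dist (f x) (f y) \<le> L * dist x y" using that by (intro f) auto
      also have "\<dots> \<le> L * diameter S" using L that S
        by (intro mult_left_mono diameter_bounded_bound) auto
      finally show ?thesis .
    qed
    have "bounded (f ` (A \<inter> S))"
      using * by (auto simp: bounded_two_points)
    moreover have "diameter (f ` (A \<inter> S)) \<le> L * diameter S"
    proof (cases "f ` (A \<inter> S) = {}")
      case True then show ?thesis using L diameter_ge_0[OF S] by simp
    next
      case False
      then show ?thesis unfolding diameter_def[of "f ` (A \<inter> S)"] if_not_P[OF False]
        by (intro cSUP_least) (use * in auto)
    qed
    ultimately show ?thesis by blast
  qed
  have size: "hausdorff_size d (L * \<delta>) (f ` A) \<le> ennreal (L ^ d) * hausdorff_size d \<delta> A" for \<delta>
  proof -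
    have "hausdorff_size d (L * \<delta>) (f ` A) \<le> ennreal (L ^ d) * (\<Sum>j. ?w (diameter (C j)))"
      if C: "C \<in> hausdorff_coverings \<delta> A" for C
    proof -
      have C': "\<And>j. bounded (C j)" "\<And>j. diameter (C j) \<le> \<delta>" "A \<subseteq> (\<Union>j. C j)"
        using C by (auto simp: hausdorff_coverings_def)
      have "(\<lambda>j. f ` (A \<inter> C j)) \<in> hausdorff_coverings (L * \<delta>) (f ` A)"
        unfolding hausdorff_coverings_def
      proof (intro CollectI conjI allI)
        show "f ` A \<subseteq> (\<Union>j. f ` (A \<inter> C j))" using C'(3) by blast
        fix j
        show "bounded (f ` (A \<inter> C j))" using diam C' by blast
        have "diameter (f ` (A \<inter> C j)) \<le> L * diameter (C j)" using diam C' by blast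
        also have "\<dots> \<le> L * \<delta>" using C' L by (intro mult_left_mono) auto
        finally show "diameter (f ` (A \<inter> C j)) \<le> L * \<delta>" .
      qed
      then have "hausdorff_size d (L * \<delta>) (f ` A) \<le> (\<Sum>j. ?w (diameter (f ` (A \<inter> C j))))"
        unfolding hausdorff_size_def by (rule INF_lower)
      also have "\<dots> \<le> (\<Sum>j. ennreal (L ^ d) * ?w (diameter (C j)))"
      proof (intro suminf_le)
        fix j
        have "unit_ball_vol (real d) * (diameter (f ` (A \<inter> C j)) / 2) ^ d
            \<le> unit_ball_vol (real d) * ((L * diameter (C j)) / 2) ^ d"
          using diam[OF C'(1)] diameter_ge_0[of "f ` (A \<inter> C j)"]
          by (intro mult_left_mono power_mono divide_right_mono) auto
        also have "\<dots> = L ^ d * (unit_ball_vol (real d) * (diameter (C j) / 2) ^ d)"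
          by (simp add: power_mult_distrib power_divide)
        finally show "?w (diameter (f ` (A \<inter> C j))) \<le> ennreal (L ^ d) * ?w (diameter (C j))"
          using L diameter_ge_0[OF C'(1)] by (subst ennreal_mult[symmetric]) (auto intro: ennreal_leI)
      qed auto
      also have "\<dots> = ennreal (L ^ d) * (\<Sum>j. ?w (diameter (C j)))"
        by (rule ennreal_suminf_cmult)
      finally show ?thesis .
    qed
    then show ?thesis
      unfolding hausdorff_size_def[of d \<delta> A] using L by (intro ennreal_le_mult_INF) auto
  qed
  show ?thesis
    unfolding hausdorff_outer_def[of d "f ` A"]
  proof (rule SUP_least)
    fix \<delta> :: real assume "\<delta> \<in> {0<..}"
    then have "0 < \<delta> / L" "L * (\<delta> / L) = \<delta>" using L by auto
    then have "hausdorff_size d \<delta> (f ` A) \<le> ennreal (L ^ d) * hausdorff_size d (\<delta> / L) A"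
      using size[of "\<delta> / L"] by simp
    also have "\<dots> \<le> ennreal (L ^ d) * hausdorff_outer d A"
      by (intro mult_left_mono hausdorff_size_le_outer \<open>0 < \<delta> / L\<close>) auto
    finally show "hausdorff_size d \<delta> (f ` A) \<le> ennreal (L ^ d) * hausdorff_outer d A" .
  qed
qed

text \<open>
  Vitali's covering lemma selects disjoint balls inside \<open>U\<close> whose fivefold enlargements cover \<open>N\<close>; the
  lower density bound pays for each enlarged ball with the \<open>\<nu>\<close>-mass of the original one. This single
  estimate serves three purposes below: it bounds \<open>\<H>\<^sup>d\<close> by the mass, and it gives the density theorem both
  for the mass and for the projected pieces in a plane.
\<close>

lemma hausdorff_outer_le_of_lower_density:
  fixes N U :: "'a::euclidean_space set" and \<nu> :: "'a measure"
  assumes d: "1 \<le> d" and sets: "sets \<nu> = sets borel" and c: "0 < c" and U: "open U" "N \<subseteq> U"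
    and dens: "\<And>x \<rho>. x \<in> N \<Longrightarrow> 0 < \<rho> \<Longrightarrow> \<exists>r. 0 < r \<and> r < \<rho> \<and> ennreal (c * r ^ d) \<le> emeasure \<nu> (cball x r)"
  shows "hausdorff_outer d N \<le> ennreal (unit_ball_vol (real d) * 5 ^ d / c) * emeasure \<nu> U"
  unfolding hausdorff_outer_def
proof (rule SUP_least)
  fix \<delta> :: real assume "\<delta> \<in> {0<..}"
  then have \<delta>: "0 < \<delta>" by simp
  let ?c = "unit_ball_vol (real d) * 5 ^ d / c"
  define K where "K = {(x, r). x \<in> N \<and> 0 < r \<and> r \<le> \<delta> / 10 \<and> cball x r \<subseteq> U \<and> ennreal (c * r ^ d) \<le> emeasure \<nu> (cball x r)}"
  have "N \<subseteq> (\<Union>z\<in>K. cball (fst z) (snd z))"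
  proof
    fix x assume x: "x \<in> N"
    then obtain e where e: "0 < e" "cball x e \<subseteq> U" using U by (meson open_contains_cball subsetD)
    obtain r where r: "0 < r" "r < min e (\<delta> / 10)" "ennreal (c * r ^ d) \<le> emeasure \<nu> (cball x r)"
      using dens[OF x, of "min e (\<delta> / 10)"] e \<delta> by auto
    then have "(x, r) \<in> K" using x e subset_cball[of r e x] by (auto simp: K_def)
    then show "x \<in> (\<Union>z\<in>K. cball (fst z) (snd z))" using r by force
  qed
  moreover have "\<And>z. z \<in> K \<Longrightarrow> 0 < snd z \<and> snd z \<le> \<delta> / 10" by (auto simp: K_def)
  ultimately obtain C where C: "countable C" "C \<subseteq> K"
     "pairwise (\<lambda>i j. disjnt (cball (fst i) (snd i)) (cball (fst j) (snd j))) C"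
     "N \<subseteq> (\<Union>i\<in>C. cball (fst i) (5 * snd i))"
    by (rule Vitali_covering_lemma_cballs)
  have diam: "diameter (cball (fst z) (5 * snd z)) = 10 * snd z" if "z \<in> C" for z
  proof -
    have "0 < snd z" using that C(2) by (auto simp: K_def)
    then show ?thesis by simp
  qed
  have "hausdorff_size d \<delta> N
      \<le> (\<integral>\<^sup>+z. ennreal (unit_ball_vol (real d) * (diameter (cball (fst z) (5 * snd z)) / 2) ^ d) \<partial>count_space C)"
  proof (intro hausdorff_size_le_countable_cover d C)
    show "diameter (cball (fst z) (5 * snd z)) \<le> \<delta>" if "z \<in> C" for z
      using diam[OF that] that C(2) by (auto simp: K_def)
  qed (use \<delta> in auto)
  also have "\<dots> \<le> (\<integral>\<^sup>+z. ennreal ?c * emeasure \<nu> (cball (fst z) (snd z)) \<partial>count_space C)"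
  proof (intro nn_integral_mono)
    fix z assume "z \<in> space (count_space C)"
    then have z: "z \<in> C" by simp
    have "ennreal (unit_ball_vol (real d) * (diameter (cball (fst z) (5 * snd z)) / 2) ^ d)
        = ennreal (?c * (c * snd z ^ d))"
    proof -
      have "10 * snd z / 2 = 5 * snd z" by simp
      then show ?thesis unfolding diam[OF z] using c by (simp add: power_mult_distrib[of 5])
    qed
    also have "\<dots> = ennreal ?c * ennreal (c * snd z ^ d)"
      using c by (subst ennreal_mult') auto
    also have "\<dots> \<le> ennreal ?c * emeasure \<nu> (cball (fst z) (snd z))"
      using z C(2) by (intro mult_left_mono) (auto simp: K_def)
    finally show "ennreal (unit_ball_vol (real d) * (diameter (cball (fst z) (5 * snd z)) / 2) ^ d)
      \<le> ennreal ?c * emeasure \<nu> (cball (fst z) (snd z))" .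
  qed
  also have "\<dots> = ennreal ?c * (\<integral>\<^sup>+z. emeasure \<nu> (cball (fst z) (snd z)) \<partial>count_space C)"
    by (rule nn_integral_cmult) simp
  also have "(\<integral>\<^sup>+z. emeasure \<nu> (cball (fst z) (snd z)) \<partial>count_space C) = emeasure \<nu> (\<Union>z\<in>C. cball (fst z) (snd z))"
    using C(1,3) by (intro emeasure_UN_countable[symmetric])
      (auto simp: sets disjoint_family_on_def pairwise_def disjnt_def)
  also have "\<dots> \<le> emeasure \<nu> U"
  proof (rule emeasure_mono)
    show "(\<Union>z\<in>C. cball (fst z) (snd z)) \<subseteq> U"
    proof (rule UN_least)
      fix z assume "z \<in> C"
      then have "z \<in> K" using C(2) by blast
      then show "cball (fst z) (snd z) \<subseteq> U" by (cases z) (simp add: K_def)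
    qed
  qed (use U in \<open>simp add: sets\<close>)
  finally show "hausdorff_size d \<delta> N \<le> ennreal ?c * emeasure \<nu> U"
    by (simp add: mult_left_mono)
qed

text \<open>
  Outer regularity makes the open set in the previous estimate as small as desired. The constant \<open>c\<close> may
  depend on the point: split \<open>N\<close> according to \<open>c > 1 / (k + 1)\<close>.
\<close>

lemma hausdorff_null_of_lower_density:
  fixes N B :: "'a::euclidean_space set" and \<nu> :: "'a measure"
  assumes d: "1 \<le> d" and sets: "sets \<nu> = sets borel" and fin: "emeasure \<nu> (space \<nu>) < \<infinity>"
    and B: "B \<in> sets borel" "emeasure \<nu> B = 0"
    and N: "N \<subseteq> B" and c: "\<And>x. x \<in> N \<Longrightarrow> \<exists>c>0. \<forall>\<rho>>0. \<exists>r. 0 < r \<and> r < \<rho> \<and> ennreal (c * r ^ d) \<le> emeasure \<nu> (cball x r)"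
  shows "hausdorff_outer d N = 0"
proof -
  define A where "A k = {x \<in> N. \<forall>\<rho>>0. \<exists>r. 0 < r \<and> r < \<rho> \<and> ennreal (1 / Suc k * r ^ d) \<le> emeasure \<nu> (cball x r)}" for k
  have "N \<subseteq> (\<Union>k. A k)"
  proof
    fix x assume x: "x \<in> N"
    then obtain c where c: "c > 0" "\<forall>\<rho>>0. \<exists>r. 0 < r \<and> r < \<rho> \<and> ennreal (c * r ^ d) \<le> emeasure \<nu> (cball x r)"
      using assms(7) by blast
    obtain k where k: "1 / Suc k < c" using c nat_approx_posE by metis
    have "\<exists>r. 0 < r \<and> r < \<rho> \<and> ennreal (1 / Suc k * r ^ d) \<le> emeasure \<nu> (cball x r)" if "\<rho> > 0" for \<rho>
    proof -
      obtain r where r: "0 < r" "r < \<rho>" "ennreal (c * r ^ d) \<le> emeasure \<nu> (cball x r)" using c \<open>\<rho> > 0\<close> by blast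
      have "ennreal (1 / Suc k * r ^ d) \<le> ennreal (c * r ^ d)"
        using k r by (intro ennreal_leI mult_right_mono) auto
      then show ?thesis using r by (metis order_trans)
    qed
    then show "x \<in> (\<Union>k. A k)" using x by (auto simp: A_def)
  qed
  moreover have "hausdorff_outer d (\<Union>k. A k) = 0"
  proof (rule hausdorff_outer_null_UN[OF _ d])
    fix k
    let ?c = "unit_ball_vol (real d) * 5 ^ d / (1 / Suc k)"
    have le: "hausdorff_outer d (A k) \<le> ennreal ?c * emeasure \<nu> U" if "open U" "B \<subseteq> U" for U
      using that N by (intro hausdorff_outer_le_of_lower_density[OF d sets]) (auto simp: A_def)
    have inf: "(INF U\<in>{U. B \<subseteq> U \<and> open U}. emeasure \<nu> U) = 0"
      using outer_regular[OF sets _ B(1)] fin B by simp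
    show "hausdorff_outer d (A k) = 0"
    proof (rule ccontr)
      assume *: "hausdorff_outer d (A k) \<noteq> 0"
      have "hausdorff_outer d (A k) \<le> ennreal ?c * (INF U\<in>{U. B \<subseteq> U \<and> open U}. emeasure \<nu> U)"
        using le unit_ball_vol_pos[of "real d"] by (intro ennreal_le_mult_INF) auto
      then have "hausdorff_outer d (A k) \<le> 0" using inf by simp
      then show False using * by simp
    qed
  qed simp
  ultimately show ?thesis by (rule hausdorff_outer_null_mono[rotated])
qed

text \<open>
  The converse comparison: a covering set of diameter \<open>\<delta>\<close> that meets \<open>N\<close> lies in a closed ball of radius \<open>\<delta>\<close>
  centred in \<open>N\<close>. As \<open>N\<close> may fail to be measurable, the conclusion is a null superset.
\<close>

lemma null_superset_of_upper_density:
  fixes N :: "'a::euclidean_space set" and \<nu> :: "'a measure"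
  assumes d: "1 \<le> d" and sets: "sets \<nu> = sets borel" and c: "0 < c" "0 < \<rho>"
    and dens: "\<And>x r. x \<in> N \<Longrightarrow> 0 < r \<Longrightarrow> r < \<rho> \<Longrightarrow> emeasure \<nu> (ball x r) \<le> ennreal (c * r ^ d)"
    and N: "hausdorff_outer d N = 0"
  shows "\<exists>N'\<in>null_sets \<nu>. N \<subseteq> N'"
proof -
  have cb: "emeasure \<nu> (cball x r) \<le> ennreal (c * r ^ d)" if x: "x \<in> N" and r: "0 \<le> r" "r < \<rho>" for x r
  proof -
    \<comment> \<open>A covering set may be a single point, so the bound is needed for closed balls of radius 0 as well.\<close>
    have "((\<lambda>s. ennreal (c * s ^ d)) \<longlongrightarrow> ennreal (c * r ^ d)) (at_right r)"
      by (intro tendsto_ennrealI tendsto_intros)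
    moreover have "eventually (\<lambda>s. emeasure \<nu> (cball x r) \<le> ennreal (c * s ^ d)) (at_right r)"
      unfolding eventually_at_right[OF r(2)]
    proof (intro exI[of _ \<rho>] conjI allI impI r)
      fix s assume s: "r < s" "s < \<rho>"
      have "emeasure \<nu> (cball x r) \<le> emeasure \<nu> (ball x s)"
        using s by (intro emeasure_mono) (auto simp: sets)
      also have "\<dots> \<le> ennreal (c * s ^ d)" using s r by (intro dens x) auto
      finally show "emeasure \<nu> (cball x r) \<le> ennreal (c * s ^ d)" .
    qed
    ultimately show ?thesis by (rule tendsto_lowerbound) simp
  qed
  define k where "k = c * 2 ^ d / unit_ball_vol (real d)"
  have k: "0 < k" using c unit_ball_vol_pos[of "real d"] unfolding k_def by (intro divide_pos_pos mult_pos_pos zero_less_power) simp_all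
  have "\<exists>E\<in>sets borel. N \<subseteq> E \<and> emeasure \<nu> E \<le> ennreal (1 / Suc m)" for m
  proof -
    define e where "e = 1 / Suc m / k"
    have e: "0 < e" using k unfolding e_def by (intro divide_pos_pos) simp_all
    have "hausdorff_size d (\<rho> / 2) N = 0"
      using hausdorff_size_le_outer[of "\<rho> / 2" d N] N c by simp
    then have "hausdorff_size d (\<rho> / 2) N < ennreal e" using e by simp
    then have "\<exists>C\<in>hausdorff_coverings (\<rho> / 2) N.
        (\<Sum>j. ennreal (unit_ball_vol (real d) * (diameter (C j) / 2) ^ d)) < ennreal e"
      by (subst (asm) hausdorff_size_def) (simp add: INF_less_iff)
    then obtain C where C: "C \<in> hausdorff_coverings (\<rho> / 2) N"
      and s: "(\<Sum>j. ennreal (unit_ball_vol (real d) * (diameter (C j) / 2) ^ d)) < ennreal e"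
      by metis
    have C': "\<And>j. bounded (C j)" "\<And>j. diameter (C j) \<le> \<rho> / 2" "N \<subseteq> (\<Union>j. C j)"
      using C by (auto simp: hausdorff_coverings_def)
    define p where "p j = (SOME x. x \<in> C j \<inter> N)" for j
    define E where "E j = (if C j \<inter> N = {} then {} else cball (p j) (diameter (C j)))" for j
    have p: "p j \<in> C j \<inter> N" if "C j \<inter> N \<noteq> {}" for j
    proof -
      have "\<exists>x. x \<in> C j \<inter> N" using that by blast
      then show ?thesis unfolding p_def by (rule someI_ex)
    qed
    have Eb: "E j \<in> sets borel" for j by (simp add: E_def)
    have E: "C j \<inter> N \<subseteq> E j" for j
    proof
      fix y assume y: "y \<in> C j \<inter> N"
      then have "p j \<in> C j" "E j = cball (p j) (diameter (C j))" using p[of j] by (auto simp: E_def)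
      then show "y \<in> E j" using diameter_bounded_bound[OF C'(1)[of j], of "p j" y] y by simp
    qed
    have "emeasure \<nu> (E j) \<le> ennreal k * ennreal (unit_ball_vol (real d) * (diameter (C j) / 2) ^ d)" for j
    proof (cases "C j \<inter> N = {}")
      case True then show ?thesis by (simp add: E_def)
    next
      case False
      have "emeasure \<nu> (E j) = emeasure \<nu> (cball (p j) (diameter (C j)))" using False by (simp add: E_def)
      also have "\<dots> \<le> ennreal (c * diameter (C j) ^ d)"
        using p[OF False] C'(2)[of j] c diameter_ge_0[OF C'(1)[of j]] by (intro cb) auto
      also have "\<dots> = ennreal (k * (unit_ball_vol (real d) * (diameter (C j) / 2) ^ d))"
      proof -
        have "unit_ball_vol (real d) \<noteq> 0" using unit_ball_vol_pos[of "real d"] by linarith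
        then show ?thesis unfolding k_def by (simp add: power_divide)
      qed
      also have "\<dots> = ennreal k * ennreal (unit_ball_vol (real d) * (diameter (C j) / 2) ^ d)"
        using less_imp_le[OF k] by (rule ennreal_mult')
      finally show ?thesis .
    qed
    then have "(\<Sum>j. emeasure \<nu> (E j)) \<le> (\<Sum>j. ennreal k * ennreal (unit_ball_vol (real d) * (diameter (C j) / 2) ^ d))"
      by (intro suminf_le summableI)
    also have "\<dots> = ennreal k * (\<Sum>j. ennreal (unit_ball_vol (real d) * (diameter (C j) / 2) ^ d))"
      by (rule ennreal_suminf_cmult)
    also have "\<dots> \<le> ennreal k * ennreal e" by (intro mult_left_mono less_imp_le[OF s] zero_le)
    also have "\<dots> = ennreal (1 / Suc m)"
    proof -
      have "ennreal k * ennreal e = ennreal (k * e)" using k e by (simp add: ennreal_mult)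
      then show ?thesis using k by (simp add: e_def)
    qed
    finally have "(\<Sum>j. emeasure \<nu> (E j)) \<le> ennreal (1 / Suc m)" .
    moreover have "emeasure \<nu> (\<Union>j. E j) \<le> (\<Sum>j. emeasure \<nu> (E j))"
      using Eb by (intro emeasure_subadditive_countably) (auto simp: sets)
    ultimately have "emeasure \<nu> (\<Union>j. E j) \<le> ennreal (1 / Suc m)" by (meson order_trans)
    moreover have "N \<subseteq> (\<Union>j. E j)"
    proof
      fix y assume y: "y \<in> N"
      then obtain j where "y \<in> C j" using C'(3) by blast
      then show "y \<in> (\<Union>j. E j)" using E[of j] y by blast
    qed
    moreover have "(\<Union>j. E j) \<in> sets borel" using Eb by simp
    ultimately show ?thesis by metis
  qed
  then obtain E where E: "\<And>m. E m \<in> sets borel" "\<And>m. N \<subseteq> E m" "\<And>m. emeasure \<nu> (E m) \<le> ennreal (1 / Suc m)"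
    by metis
  have "emeasure \<nu> (\<Inter>m. E m) \<le> ennreal (1 / Suc m)" for m
    by (rule order_trans[OF emeasure_mono E(3)]) (auto simp: sets E)
  moreover have "(\<lambda>m. ennreal (1 / Suc m)) \<longlonglongrightarrow> ennreal 0"
    by (intro tendsto_ennrealI) (use LIMSEQ_Suc[OF lim_1_over_n] in simp)
  ultimately have "emeasure \<nu> (\<Inter>m. E m) \<le> ennreal 0"
    by (intro LIMSEQ_le_const) auto
  then show ?thesis using E by (intro bexI[of _ "\<Inter>m. E m"]) (auto simp: null_sets_def sets)
qed

section \<open>The space of linear subspaces\<close>

lemma orth_proj_fixed: "x \<in> points P \<Longrightarrow> orth_proj P x = x"
  by (intro orth_proj_eqI) (auto simp: orthogonal_def)

lemma bounded_linear_orth_proj: "bounded_linear (orth_proj P)"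
  using linear_orth_proj linear_conv_bounded_linear by blast

lemma orth_proj_pythagoras: "(norm x)\<^sup>2 = (norm (orth_proj P x))\<^sup>2 + (norm (x - orth_proj P x))\<^sup>2"
proof -
  have "orth_proj P x \<bullet> (x - orth_proj P x) = 0"
    using orth_proj_orthogonal[OF orth_proj_in, of x P x] by (simp add: orthogonal_def inner_commute)
  then have "(norm (orth_proj P x + (x - orth_proj P x)))\<^sup>2 = (norm (orth_proj P x))\<^sup>2 + (norm (x - orth_proj P x))\<^sup>2"
    by (intro norm_add_Pythagorean) (simp add: orthogonal_def)
  then show ?thesis by simp
qed

lemma norm_orth_proj_le: "norm (orth_proj P x) \<le> norm x"
proof (rule power2_le_imp_le)
  show "(norm (orth_proj P x))\<^sup>2 \<le> (norm x)\<^sup>2" using orth_proj_pythagoras[of x P] by simp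
qed simp

lemma orth_proj_diff: "orth_proj P (x - y) = orth_proj P x - orth_proj P y"
  by (rule linear_diff[OF linear_orth_proj])

lemma inner_orth_proj: "orth_proj P x \<bullet> y = x \<bullet> orth_proj P y"
proof -
  have "(x - orth_proj P x) \<bullet> orth_proj P y = 0" "(y - orth_proj P y) \<bullet> orth_proj P x = 0"
    using orth_proj_orthogonal[OF orth_proj_in] unfolding orthogonal_def by blast+
  then show ?thesis by (simp add: inner_diff_left) (simp add: inner_commute)
qed

text \<open>
  The excess is defined by distances to a plane; the proof works with the norm of the normal component.
\<close>

lemma infdist_points: "infdist x (points P) = norm (x - orth_proj P x)"
proof -
  have ne: "points P \<noteq> {}" using orth_proj_in by blast
  have 1: "infdist x (points P) \<le> norm (x - orth_proj P x)"
    using infdist_le[OF orth_proj_in, of x P x] by (simp add: dist_norm)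
  have "norm (x - orth_proj P x) \<le> dist x z" if z: "z \<in> points P" for z
  proof (rule power2_le_imp_le)
    have "orthogonal (x - orth_proj P x) (orth_proj P x - z)"
      using z by (intro orth_proj_orthogonal subspace_diff orth_proj_in) auto
    then have "(norm ((x - orth_proj P x) + (orth_proj P x - z)))\<^sup>2 = (norm (x - orth_proj P x))\<^sup>2 + (norm (orth_proj P x - z))\<^sup>2"
      by (rule norm_add_Pythagorean)
    then show "(norm (x - orth_proj P x))\<^sup>2 \<le> (dist x z)\<^sup>2" by (simp add: dist_norm)
  qed simp
  then have "norm (x - orth_proj P x) \<le> infdist x (points P)"
    unfolding infdist_notempty[OF ne] by (intro cINF_greatest ne)
  with 1 show ?thesis by simp
qed

text \<open>
  The metric on subspaces is by construction that of the orthogonal projections, so \<open>proj_blinfun\<close> is an isometric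
  embedding into a normed space. Continuity, compactness and separability are inherited from there.
\<close>

definition proj_blinfun :: "'a::euclidean_space linear_subspace \<Rightarrow> 'a \<Rightarrow>\<^sub>L 'a" where
  "proj_blinfun P = Blinfun (orth_proj P)"

lemma proj_blinfun_apply [simp]: "blinfun_apply (proj_blinfun P) x = orth_proj P x"
  by (simp add: proj_blinfun_def bounded_linear_Blinfun_apply[OF bounded_linear_orth_proj])

lemma dist_proj_blinfun: "dist (proj_blinfun T) (proj_blinfun P) = dist T P"
proof -
  have "blinfun_apply (proj_blinfun T - proj_blinfun P) = (\<lambda>x. orth_proj T x - orth_proj P x)"
    by (auto simp: blinfun.diff_left)
  then show ?thesis by (simp add: dist_norm norm_blinfun.rep_eq dist_linear_subspace_def)
qed

lemma continuous_proj_blinfun [continuous_intros]: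
  assumes "continuous_on A f" shows "continuous_on A (\<lambda>x. proj_blinfun (f x))"
proof -
  have "continuous_on UNIV proj_blinfun" by (auto simp: continuous_on_iff dist_proj_blinfun)
  from continuous_on_compose2[OF this assms] show ?thesis by simp
qed

lemma continuous_on_orth_proj [continuous_intros]:
  assumes "continuous_on A f" "continuous_on A g"
  shows "continuous_on A (\<lambda>x. orth_proj (f x) (g x))"
proof -
  have "continuous_on A (\<lambda>x. blinfun_apply (proj_blinfun (f x)) (g x))"
    using assms by (intro continuous_intros)
  then show ?thesis by simp
qed

lemma norm_orth_proj_dist: "norm (orth_proj T x - orth_proj P x) \<le> dist T P * norm x"
proof -
  have "norm (blinfun_apply (proj_blinfun T - proj_blinfun P) x) \<le> norm (proj_blinfun T - proj_blinfun P) * norm x"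
    by (rule norm_blinfun)
  then show ?thesis
    by (simp add: blinfun.diff_left dist_proj_blinfun flip: dist_norm[of "proj_blinfun T"])
qed

text \<open>
  The orthogonal projections are the self-adjoint idempotents of norm at most 1, a closed and bounded
  set in a finite-dimensional space.
\<close>

lemma compact_linear_subspaces: "compact (UNIV :: 'a::euclidean_space linear_subspace set)"
proof -
  define E where "E = {A :: 'a \<Rightarrow>\<^sub>L 'a. (\<forall>x. norm (A x) \<le> norm x) \<and> (\<forall>x. A (A x) = A x) \<and> (\<forall>x y. A x \<bullet> y = x \<bullet> A y)}"
  have "E = (\<Inter>x. {A. norm (blinfun_apply A x) \<le> norm x}) \<inter> (\<Inter>x. {A. blinfun_apply A (blinfun_apply A x) = blinfun_apply A x})
      \<inter> (\<Inter>x. \<Inter>y. {A. blinfun_apply A x \<bullet> y = x \<bullet> blinfun_apply A y})"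
    by (auto simp: E_def)
  also have "closed \<dots>"
    by (intro closed_Int closed_INT ballI closed_Collect_le closed_Collect_eq continuous_intros)
  finally have "closed E" .
  moreover have "bounded E"
  proof (rule boundedI)
    fix A assume "A \<in> E"
    then show "norm A \<le> 1"
      unfolding norm_blinfun.rep_eq by (intro onorm_bound) (auto simp: E_def)
  qed
  ultimately have "compact E" by (simp add: compact_eq_bounded_closed)
  have surj: "\<exists>P. proj_blinfun P = A" if A: "A \<in> E" for A
  proof -
    have sub: "subspace (range A)"
      by (intro linear_subspace_image subspace_UNIV bounded_linear.linear blinfun.bounded_linear_right)
    define P where "P = Abs_linear_subspace (range A)"
    have P: "points P = range A" unfolding P_def using sub by (intro Abs_linear_subspace_inverse) auto
    have "orth_proj P x = A x" for x
    proof (rule orth_proj_eqI)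
      fix z assume "z \<in> points P"
      then obtain w where "z = A w" using P by auto
      then show "orthogonal (x - A x) z"
        using A by (simp add: E_def orthogonal_def inner_diff_left)
    qed (auto simp: P)
    then have "proj_blinfun P = A" by (intro blinfun_eqI) simp
    then show ?thesis by blast
  qed
  have mem: "proj_blinfun P \<in> E" for P
    by (auto simp: E_def norm_orth_proj_le orth_proj_fixed orth_proj_in inner_orth_proj)
  define g where "g A = (SOME P. proj_blinfun P = A)" for A :: "'a \<Rightarrow>\<^sub>L 'a"
  have g: "proj_blinfun (g A) = A" if "A \<in> E" for A
    using surj[OF that] unfolding g_def by (rule someI_ex)
  have "g (proj_blinfun P) = P" for P
    using g[OF mem, of P] dist_proj_blinfun[of "g (proj_blinfun P)" P] by simp
  then have "UNIV = g ` E" using mem by (metis UNIV_eq_I image_eqI)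
  moreover have "continuous_on E g"
    unfolding continuous_on_iff by (metis dist_proj_blinfun g)
  ultimately show ?thesis using \<open>compact E\<close> compact_continuous_image by metis
qed

text \<open>
  Second countability identifies the Borel sets of \<open>\<real>\<^sup>n \<times> G\<close> with the product \<open>\<sigma>\<close>-algebra and provides the countably
  many reference planes of the decomposition into flat pieces.
\<close>

instance linear_subspace :: (euclidean_space) second_countable_topology
proof
  have "\<exists>F. finite F \<and> (\<Union>x\<in>F. ball x (1 / Suc n)) = (UNIV :: 'a linear_subspace set)" for n
  proof -
    have "UNIV \<subseteq> (\<Union>x\<in>UNIV. ball x (1 / Suc n) :: 'a linear_subspace set)" by auto
    from compactE_image[OF compact_linear_subspaces _ this] obtain F :: "'a linear_subspace set"
      where "finite F" "UNIV \<subseteq> (\<Union>x\<in>F. ball x (1 / Suc n))" by auto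
    then show ?thesis by auto
  qed
  then obtain F :: "nat \<Rightarrow> 'a linear_subspace set"
    where F: "\<And>n. finite (F n)" "\<And>n. (\<Union>x\<in>F n. ball x (1 / Suc n)) = UNIV" by metis
  define B where "B = (\<Union>n. (\<lambda>x. ball x (1 / Suc n)) ` F n)"
  have "countable B" unfolding B_def using F(1) by (intro countable_UN countable_image) (auto intro: countable_finite)
  moreover have "topological_basis B"
  proof (rule topological_basisI)
    show "open b" if "b \<in> B" for b using that by (auto simp: B_def)
    fix O' and x :: "'a linear_subspace" assume O: "open O'" "x \<in> O'"
    then obtain e where e: "e > 0" "ball x e \<subseteq> O'" by (meson openE)
    obtain n where n: "1 / Suc n < e / 2" using e nat_approx_posE[of "e / 2"] by auto
    obtain y where y: "y \<in> F n" "x \<in> ball y (1 / Suc n)" using F(2)[of n] by blast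
    have "ball y (1 / Suc n) \<subseteq> ball x e"
    proof
      fix z assume "z \<in> ball y (1 / Suc n)"
      then have "dist x z < 1 / Suc n + 1 / Suc n"
        using y(2) dist_triangle[of x z y] by (simp add: dist_commute)
      then show "z \<in> ball x e" using n by simp
    qed
    then show "\<exists>B'\<in>B. x \<in> B' \<and> B' \<subseteq> O'" using y e by (auto simp: B_def)
  qed
  ultimately show "\<exists>B::'a linear_subspace set set. countable B \<and> open = generate_topology B"
    by (blast intro: topological_basis_imp_subbasis)
qed

text \<open>
  If \<open>\<parallel>\<Pi>\<^sub>T - \<Pi>\<^sub>P\<parallel> < 1\<close> then \<open>\<Pi>\<^sub>T\<close> is injective on \<open>P\<close>. Hence the dimension is locally constant, and each
  Grassmannian is open and closed.
\<close>

lemma dim_le_of_dist_less_1: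
  assumes "dist T P < 1" shows "dim (points P) \<le> dim (points T)"
proof -
  have inj: "inj_on (orth_proj T) (points P)"
  proof (rule inj_onI)
    fix x y assume xy: "x \<in> points P" "y \<in> points P" "orth_proj T x = orth_proj T y"
    define z where "z = x - y"
    have z: "z \<in> points P" "orth_proj T z = 0" using xy by (auto simp: z_def subspace_diff orth_proj_diff)
    then have "norm z \<le> dist T P * norm z"
      using norm_orth_proj_dist[of T z P] by (simp add: orth_proj_fixed)
    then have "norm z = 0" using assms by (metis mult_less_cancel_right2 norm_ge_zero not_le order_le_less zero_less_norm_iff)
    then show "x = y" by (simp add: z_def)
  qed
  have sp: "span (points P) = points P" by (simp add: span_eq_iff)
  have "dim (points P) = dim (orth_proj T ` points P)"
    using inj by (intro dim_image_eq[symmetric] linear_orth_proj) (simp add: sp)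
  also have "\<dots> \<le> dim (points T)" by (intro dim_subset) (auto simp: orth_proj_in)
  finally show ?thesis .
qed

lemma grassmannian_ball: "P \<in> grassmannian d \<Longrightarrow> dist P T < 1 \<Longrightarrow> T \<in> grassmannian d"
  using dim_le_of_dist_less_1[of T P] dim_le_of_dist_less_1[of P T]
  by (simp add: grassmannian_def dist_commute)

lemma open_grassmannian: "open (grassmannian d)"
  unfolding open_dist
  by (metis dist_commute grassmannian_ball zero_less_one)

lemma closed_grassmannian: "closed (grassmannian d)"
proof -
  have "- grassmannian d = (\<Union>k\<in>-{d}. grassmannian k :: 'a linear_subspace set)" by (auto simp: grassmannian_def)
  then show ?thesis unfolding closed_def by (auto intro: open_UN open_grassmannian)
qed

lemma compact_grassmannian: "compact (grassmannian d)"
  using compact_Int_closed[OF compact_linear_subspaces closed_grassmannian] by simp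

lemma subspace_coordinates:
  fixes P :: "'a::euclidean_space linear_subspace"
  assumes "P \<in> grassmannian d"
  obtains b :: "nat \<Rightarrow> 'a" where "\<And>i. i < d \<Longrightarrow> norm (b i) = 1" "\<And>i j. i < d \<Longrightarrow> j < d \<Longrightarrow> i \<noteq> j \<Longrightarrow> b i \<bullet> b j = 0"
    "\<And>x. x \<in> points P \<Longrightarrow> x = (\<Sum>i<d. (x \<bullet> b i) *\<^sub>R b i)" "\<And>i. i < d \<Longrightarrow> b i \<in> points P"
proof -
  obtain B where B: "B \<subseteq> points P" "pairwise orthogonal B" "\<And>x. x \<in> B \<Longrightarrow> norm x = 1"
     "independent B" "card B = dim (points P)" "span B = points P"
    using orthonormal_basis_subspace[OF subspace_points, of P] by metis
  have fin: "finite B" using B(4) by (rule finiteI_independent)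
  have "card B = d" using B(5) assms by (simp add: grassmannian_def)
  then obtain b where b: "bij_betw b {..<d} B"
    using ex_bij_betw_nat_finite[OF fin] by (auto simp: atLeast0LessThan)
  have orth: "b i \<bullet> b j = 0" if "i < d" "j < d" "i \<noteq> j" for i j
    using that b B(2) unfolding bij_betw_def pairwise_def inj_on_def orthogonal_def by (metis imageI lessThan_iff)
  have n1: "norm (b i) = 1" if "i < d" for i using that b B(3) unfolding bij_betw_def by blast
  have "x = (\<Sum>i<d. (x \<bullet> b i) *\<^sub>R b i)" if x: "x \<in> points P" for x
  proof -
    define y where "y = x - (\<Sum>i<d. (x \<bullet> b i) *\<^sub>R b i)"
    have "y \<bullet> b j = 0" if "j < d" for j
    proof -
      have "(\<Sum>i<d. (x \<bullet> b i) * (b i \<bullet> b j)) = (\<Sum>i<d. if i = j then x \<bullet> b j else 0)"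
        using that orth n1 by (intro sum.cong) (auto simp: dot_square_norm)
      then show ?thesis using that by (simp add: y_def inner_diff_left inner_sum_left)
    qed
    then have "\<And>z. z \<in> B \<Longrightarrow> y \<bullet> z = 0" using b unfolding bij_betw_def by auto
    then have "orthogonal y z" if "z \<in> span B" for z
      using that by (auto simp: orthogonal_def intro!: orthogonal_to_span[OF that, unfolded orthogonal_def])
    moreover have "y \<in> span B"
      using x b B(1) unfolding B(6) y_def bij_betw_def
      by (intro subspace_diff subspace_sum subspace_scale) auto
    ultimately have "y \<bullet> y = 0" by (auto simp: orthogonal_def)
    then show ?thesis by (simp add: y_def)
  qed
  then show ?thesis using that[of b] n1 orth b B(1) unfolding bij_betw_def by blast
qed

text \<open>
  A cube of side \<open>2R\<close> in the plane splits into \<open>N\<^sup>d\<close> cubes of diameter at most \<open>2Rd/N\<close>. The bound is crude, but it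
  is the same for all planes, which keeps the errors in the blow-up argument uniform.
\<close>

lemma hausdorff_outer_subspace_ball:
  fixes P :: "'a::euclidean_space linear_subspace"
  assumes d: "1 \<le> d" and P: "P \<in> grassmannian d" and R0: "0 < R"
  shows "hausdorff_outer d (points P \<inter> cball 0 R) \<le> ennreal (unit_ball_vol (real d) * (real d * R) ^ d)"
proof -
  obtain b where b: "\<And>i. i < d \<Longrightarrow> norm (b i) = 1" "\<And>x. x \<in> points P \<Longrightarrow> x = (\<Sum>i<d. (x \<bullet> b i) *\<^sub>R b i)"
    using subspace_coordinates[OF P] by metis
  define C where "C = unit_ball_vol (real d) * (real d * R) ^ d"
  show ?thesis
    unfolding C_def[symmetric] hausdorff_outer_def
  proof (rule SUP_least)
    fix \<delta> :: real assume "\<delta> \<in> {0<..}"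
    then have \<delta>: "0 < \<delta>" by simp
    obtain N :: nat where N: "N > 2 * R * real d / \<delta>" using reals_Archimedean2 by blast
    have N0: "0 < real N" using N R0 \<delta> by (meson divide_nonneg_pos le_less_trans mult_nonneg_nonneg of_nat_0_le_iff less_imp_le zero_le_numeral)
    have Nd: "2 * R * real d / N \<le> \<delta>" using N \<delta> N0 by (simp add: field_simps)
    define I where "I = (PiE {..<d} (\<lambda>_. {..<N}) :: (nat \<Rightarrow> nat) set)"
    define h where "h = 2 * R / N"
    have h: "0 < h" using R0 N0 by (simp add: h_def)
    define S where "S k = {x \<in> points P. \<forall>i<d. - R + h * real (k i) \<le> x \<bullet> b i \<and> x \<bullet> b i \<le> - R + h * real (Suc (k i))}" for k :: "nat \<Rightarrow> nat"
    have S: "dist x y \<le> real d * h" if "x \<in> S k" "y \<in> S k" for x y k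
    proof -
      have xy: "x \<in> points P" "y \<in> points P" using that by (auto simp: S_def)
      have "x - y = (\<Sum>i<d. ((x - y) \<bullet> b i) *\<^sub>R b i)" using xy by (intro b(2) subspace_diff) auto
      then have "dist x y = norm (\<Sum>i<d. ((x - y) \<bullet> b i) *\<^sub>R b i)" by (simp add: dist_norm)
      also have "\<dots> \<le> (\<Sum>i<d. h)"
      proof (rule sum_norm_le)
        fix i assume i: "i \<in> {..<d}"
        have "- R + h * real (k i) \<le> x \<bullet> b i" "x \<bullet> b i \<le> - R + h * real (Suc (k i))"
          "- R + h * real (k i) \<le> y \<bullet> b i" "y \<bullet> b i \<le> - R + h * real (Suc (k i))"
          using that i by (auto simp: S_def)
        then have "\<bar>(x - y) \<bullet> b i\<bar> \<le> h" by (simp add: inner_diff_left algebra_simps abs_le_iff)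
        then show "norm (((x - y) \<bullet> b i) *\<^sub>R b i) \<le> h" using b(1) i by simp
      qed
      finally show ?thesis by simp
    qed
    have bd: "bounded (S k)" for k using S[of _ k] by (auto simp: bounded_two_points)
    have diam: "diameter (S k) \<le> real d * h" for k
    proof (cases "S k = {}")
      case True then show ?thesis using h by simp
    next
      case False then show ?thesis unfolding diameter_def if_not_P[OF False]
        by (intro cSUP_least) (use S in auto)
    qed
    have "hausdorff_size d \<delta> (points P \<inter> cball 0 R)
      \<le> (\<integral>\<^sup>+k. ennreal (unit_ball_vol (real d) * (diameter (S k) / 2) ^ d) \<partial>count_space I)"
    proof (intro hausdorff_size_le_countable_cover d)
      show "countable I" unfolding I_def by (intro countable_PiE) auto
      show "diameter (S k) \<le> \<delta>" for k using diam[of k] Nd by (simp add: h_def field_simps)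
      show "points P \<inter> cball 0 R \<subseteq> (\<Union>k\<in>I. S k)"
      proof
        fix x assume x: "x \<in> points P \<inter> cball 0 R"
        have xb: "\<bar>x \<bullet> b i\<bar> \<le> R" if "i < d" for i
          using Cauchy_Schwarz_ineq2[of x "b i"] b(1)[OF that] x by simp
        have "\<exists>m<N. - R + h * real m \<le> x \<bullet> b i \<and> x \<bullet> b i \<le> - R + h * real (Suc m)" if i: "i < d" for i
        proof -
          define t where "t = (x \<bullet> b i + R) / h"
          have t: "0 \<le> t" "t \<le> N"
          proof -
            have "0 \<le> x \<bullet> b i + R" "x \<bullet> b i + R \<le> real N * h"
              using xb[OF i] N0 unfolding h_def by (simp_all add: abs_le_iff)
            then show "0 \<le> t" "t \<le> N" using h by (simp_all add: t_def divide_le_eq)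
          qed
          have xt: "x \<bullet> b i = - R + h * t" using h by (simp add: t_def)
          show ?thesis
          proof (cases "t = N")
            case True
            \<comment> \<open>The right end point of the interval belongs to the last cell.\<close>
            then show ?thesis using N0 h xt by (intro exI[of _ "N - 1"]) (auto simp: of_nat_diff)
          next
            case False
            define m where "m = nat \<lfloor>t\<rfloor>"
            have m: "real m \<le> t" "t \<le> real (Suc m)" using t(1) by (auto simp: m_def) linarith+
            have "m < N" using m(1) t(2) False by linarith
            moreover have "- R + h * real m \<le> x \<bullet> b i" using m(1) h by (simp add: xt)
            moreover have "x \<bullet> b i \<le> - R + h * real (Suc m)" unfolding xt using m(2) h
              by (intro add_left_mono mult_left_mono) auto
            ultimately show ?thesis by blast
          qed
        qed
        then obtain k where k: "\<And>i. i < d \<Longrightarrow> k i < N \<and> - R + h * real (k i) \<le> x \<bullet> b i \<and> x \<bullet> b i \<le> - R + h * real (Suc (k i))"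
          by metis
        have "restrict k {..<d} \<in> I" using k by (auto simp: I_def)
        moreover have "x \<in> S (restrict k {..<d})" using k x by (auto simp: S_def)
        ultimately show "x \<in> (\<Union>k\<in>I. S k)" by blast
      qed
    qed (use bd \<delta> in auto)
    also have "\<dots> \<le> (\<integral>\<^sup>+k. ennreal (unit_ball_vol (real d) * (real d * h / 2) ^ d) \<partial>count_space I)"
      using diam bd
      by (intro nn_integral_mono ennreal_leI mult_left_mono power_mono divide_right_mono) (auto intro: diameter_ge_0)
    also have "\<dots> = ennreal (unit_ball_vol (real d) * (real d * h / 2) ^ d) * emeasure (count_space I) I"
      by simp
    also have "emeasure (count_space I) I = ennreal (real N ^ d)"
    proof -
      have "finite I" unfolding I_def by (intro finite_PiE) auto
      moreover have "card I = N ^ d" unfolding I_def by (subst card_PiE) auto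
      ultimately show ?thesis by (simp add: emeasure_count_space ennreal_of_nat_eq_real_of_nat)
    qed
    also have "ennreal (unit_ball_vol (real d) * (real d * h / 2) ^ d) * ennreal (real N ^ d)
      = ennreal (unit_ball_vol (real d) * (real d * h / 2) ^ d * real N ^ d)"
      using h by (intro ennreal_mult[symmetric]) auto
    also have "unit_ball_vol (real d) * (real d * h / 2) ^ d * real N ^ d = C"
    proof -
      have "real d * h / 2 * real N = real d * R" using N0 by (simp add: h_def)
      then have "(real d * h / 2) ^ d * real N ^ d = (real d * R) ^ d" by (metis power_mult_distrib)
      then show ?thesis by (simp only: C_def mult.assoc)
    qed
    finally show "hausdorff_size d \<delta> (points P \<inter> cball 0 R) \<le> ennreal C" .
  qed
qed

lemma hausdorff_outer_subspace_finite:
  fixes P :: "'a::euclidean_space linear_subspace"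
  assumes "1 \<le> d" "P \<in> grassmannian d" "bounded B"
  shows "hausdorff_outer d (points P \<inter> B) < \<infinity>"
proof -
  obtain R where R: "0 < R" "B \<subseteq> cball 0 R"
    using assms(3) by (auto simp: bounded_pos subset_iff)
  have "hausdorff_outer d (points P \<inter> B) \<le> hausdorff_outer d (points P \<inter> cball 0 R)"
    using R by (intro hausdorff_outer_mono) auto
  also have "\<dots> \<le> ennreal (unit_ball_vol (real d) * (real d * R) ^ d)"
    by (intro hausdorff_outer_subspace_ball assms R)
  also have "\<dots> < \<infinity>" by simp
  finally show ?thesis .
qed

section \<open>Passage to the limit\<close>

text \<open>
  An increasing sequence of continuous functions with compact support in \<open>\<Omega>\<close> that converges to 1 on \<open>\<Omega>\<close>.
  The distance to the complement is replaced by 1 when \<open>\<Omega>\<close> is the whole space, because \<open>infdist x {} = 0\<close>.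
\<close>

definition cutoff :: "'a::euclidean_space set \<Rightarrow> nat \<Rightarrow> 'a \<Rightarrow> real" where
  "cutoff \<Omega> m x = min 1 (max 0 (real m * (if \<Omega> = UNIV then 1 else infdist x (- \<Omega>)) - 1))
    * min 1 (max 0 (real m - norm x))"

lemma cutoff_bounds: "0 \<le> cutoff \<Omega> m x" "cutoff \<Omega> m x \<le> 1"
  by (auto simp: cutoff_def intro!: mult_nonneg_nonneg mult_le_one)

lemma continuous_on_cutoff [continuous_intros]:
  assumes "continuous_on A f" shows "continuous_on A (\<lambda>x. cutoff \<Omega> m (f x))"
proof -
  have "continuous_on UNIV (cutoff \<Omega> m)"
    unfolding cutoff_def by (cases "\<Omega> = UNIV") (auto intro!: continuous_intros)
  from continuous_on_compose2[OF this assms] show ?thesis by simp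
qed

lemma cutoff_mono: "m \<le> n \<Longrightarrow> cutoff \<Omega> m x \<le> cutoff \<Omega> n x"
  unfolding cutoff_def
  by (intro mult_mono min.mono max.mono diff_right_mono mult_right_mono order_refl) (auto simp: infdist_nonneg)

lemma cutoff_support:
  assumes "open \<Omega>"
  shows "\<exists>K. compact K \<and> K \<subseteq> \<Omega> \<and> (\<forall>x. x \<notin> K \<longrightarrow> cutoff \<Omega> m x = 0)"
proof (cases "\<Omega> = UNIV")
  case True
  then show ?thesis by (intro exI[of _ "cball 0 (real m)"]) (auto simp: cutoff_def)
next
  case False
  define K where "K = {x. 1 \<le> real m * infdist x (- \<Omega>)} \<inter> cball 0 (real m)"
  have "closed {x. 1 \<le> real m * infdist x (- \<Omega>)}"
    by (intro closed_Collect_le continuous_intros)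
  then have "compact K" unfolding K_def by (intro closed_Int_compact) auto
  moreover have "K \<subseteq> \<Omega>"
  proof
    fix x assume x: "x \<in> K"
    show "x \<in> \<Omega>"
    proof (rule ccontr)
      assume "x \<notin> \<Omega>"
      then have "infdist x (- \<Omega>) = 0" by (intro infdist_zero) auto
      then show False using x by (simp add: K_def)
    qed
  qed
  moreover have "cutoff \<Omega> m x = 0" if "x \<notin> K" for x
    using that False by (auto simp: K_def cutoff_def)
  ultimately show ?thesis by blast
qed

lemma cutoff_eventually_1:
  assumes "open \<Omega>" "x \<in> \<Omega>"
  shows "\<exists>m. \<forall>n\<ge>m. cutoff \<Omega> n x = 1"
proof -
  define D where "D = (if \<Omega> = UNIV then 1 else infdist x (- \<Omega>))"
  have D: "0 < D"
  proof (cases "\<Omega> = UNIV")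
    case False
    have "closed (- \<Omega>)" "- \<Omega> \<noteq> {}" "x \<notin> - \<Omega>" using assms False by auto
    then show ?thesis using False infdist_pos_not_in_closed[of "- \<Omega>" x] by (simp add: D_def)
  qed (simp add: D_def)
  obtain m where m: "real m > 2 / D" using reals_Archimedean2 by blast
  obtain k where k: "real k > norm x + 1" using reals_Archimedean2 by blast
  have "cutoff \<Omega> n x = 1" if n: "n \<ge> max m k" for n
  proof -
    have "2 / D < real n" "norm x + 1 < real n" using n m k by auto
    then have "2 < real n * D" using D by (simp add: field_simps)
    then show ?thesis using \<open>norm x + 1 < real n\<close> unfolding cutoff_def D_def[symmetric] by simp
  qed
  then show ?thesis by blast
qed

text \<open>
  The varifolds are regarded as Borel measures on \<open>\<real>\<^sup>n \<times> G\<close>, where \<open>G\<close> is the compact space of all linear subspaces. A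
  test function then has compact support as soon as its support projects into a compact subset of \<open>\<Omega>\<close>.
\<close>

locale varifold_sequence =
  fixes d :: nat and \<Omega> :: "'a::euclidean_space set"
    and Ws :: "nat \<Rightarrow> ('a \<times> 'a linear_subspace) measure"
    and W :: "('a \<times> 'a linear_subspace) measure" and \<Lambda> :: real
  assumes d: "1 \<le> d" and open_\<Omega>: "open \<Omega>"
    and sets_Ws [measurable_cong]: "\<And>i. sets (Ws i) = sets borel" and sets_W [measurable_cong]: "sets W = sets borel"
    and Ws_bound: "\<And>i. emeasure (Ws i) UNIV \<le> ennreal \<Lambda>"
    and W_compact: "\<And>K. compact K \<Longrightarrow> K \<subseteq> \<Omega> \<Longrightarrow> emeasure W (K \<times> UNIV) < \<infinity>"
    and W_conc: "emeasure W (- (\<Omega> \<times> UNIV)) = 0"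
    and conv: "\<And>(f :: _ \<Rightarrow> real) K. continuous_on UNIV f \<Longrightarrow> compact K \<Longrightarrow> K \<subseteq> \<Omega> \<Longrightarrow> (\<And>z. fst z \<notin> K \<Longrightarrow> f z = 0)
      \<Longrightarrow> (\<lambda>i. \<integral>z. f z \<partial>Ws i) \<longlonglongrightarrow> (\<integral>z. f z \<partial>W)"
begin

definition "\<mu>s i = distr (Ws i) borel fst"
definition "\<mu> = distr W borel fst"

lemma space_Ws [simp]: "space (Ws i) = UNIV" and space_W [simp]: "space W = UNIV"
  using sets_eq_imp_space_eq[OF sets_Ws] sets_eq_imp_space_eq[OF sets_W] by simp_all

lemma sets_\<mu>s [simp, measurable_cong]: "sets (\<mu>s i) = sets borel"
  and sets_\<mu> [simp, measurable_cong]: "sets \<mu> = sets borel"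
  and space_\<mu>s [simp]: "space (\<mu>s i) = UNIV" and space_\<mu> [simp]: "space \<mu> = UNIV"
  by (simp_all add: \<mu>s_def \<mu>_def)

lemma fst_measurable [measurable]: "fst \<in> borel_measurable (borel :: ('a \<times> 'a linear_subspace) measure)"
  by (intro borel_measurable_continuous_onI continuous_intros)

lemma fst_measurable_Ws [measurable]: "fst \<in> borel_measurable (Ws i)"
  and fst_measurable_W [measurable]: "fst \<in> borel_measurable W"
  by measurable

lemma AE_W_\<Omega>: "AE z in W. fst z \<in> \<Omega>"
proof (rule AE_I[of _ _ "- (\<Omega> \<times> UNIV)"])
  show "- (\<Omega> \<times> UNIV) \<in> sets W"
    unfolding sets_W by (rule borel_comp[OF borel_open[OF open_Times[OF open_\<Omega> open_UNIV]]])
qed (use W_conc in auto)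

lemma finite_Ws: "finite_measure (Ws i)"
  using Ws_bound[of i] by (intro finite_measureI) (auto simp: top_unique)

lemma integrable_compact_support:
  assumes f: "continuous_on UNIV f" "compact K" "K \<subseteq> \<Omega>" "\<And>z. fst z \<notin> K \<Longrightarrow> f z = 0"
  shows "integrable W (f :: _ \<Rightarrow> real)"
proof -
  have "compact (K \<times> (UNIV :: 'a linear_subspace set))"
    using f(2) compact_linear_subspaces by (rule compact_Times)
  then have "bounded (f ` (K \<times> UNIV))"
    using f(1) by (intro compact_imp_bounded compact_continuous_image) (auto intro: continuous_on_subset)
  then obtain B where B: "\<And>z. z \<in> K \<times> UNIV \<Longrightarrow> norm (f z) \<le> B"
    unfolding bounded_iff by blast
  have cK: "closed (K \<times> (UNIV :: 'a linear_subspace set))" using f(2) by (intro closed_Times compact_imp_closed[OF f(2)] closed_UNIV)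
  have "integrable W (\<lambda>z. indicator (K \<times> UNIV) z *\<^sub>R f z)"
  proof (rule integrableI_bounded_set_indicator)
    show "K \<times> UNIV \<in> sets W" using cK by (simp add: sets_W)
    show "f \<in> borel_measurable W" using f(1) by (simp add: borel_measurable_continuous_onI measurable_cong_sets[OF sets_W refl])
    show "emeasure W (K \<times> UNIV) < \<infinity>" using f by (intro W_compact)
    show "AE z in W. z \<in> K \<times> UNIV \<longrightarrow> norm (f z) \<le> B" using B by auto
  qed
  moreover have "(\<lambda>z. indicator (K \<times> UNIV) z *\<^sub>R f z) = f"
    using f(4) by (auto simp: indicator_def fun_eq_iff)
  ultimately show ?thesis by (simp only:)
qed

text \<open>
  The masses of the \<open>V\<^sub>i\<close> are bounded, so testing with the cutoff functions and monotone convergence bound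
  the mass of the limit.
\<close>

lemma emeasure_W_le: "emeasure W UNIV \<le> ennreal \<Lambda>"
proof -
  have *: "(\<integral>\<^sup>+z. ennreal (cutoff \<Omega> m (fst z)) \<partial>W) \<le> ennreal \<Lambda>" for m
  proof -
    obtain K where K: "compact K" "K \<subseteq> \<Omega>" "\<And>x. x \<notin> K \<Longrightarrow> cutoff \<Omega> m x = 0"
      using cutoff_support[OF open_\<Omega>, of m] by blast
    have c: "continuous_on UNIV (\<lambda>z::'a \<times> 'a linear_subspace. cutoff \<Omega> m (fst z))" by (intro continuous_intros)
    have int: "integrable W (\<lambda>z. cutoff \<Omega> m (fst z))"
      using integrable_compact_support[OF c K(1,2)] K(3) by simp
    have lim: "(\<lambda>i. \<integral>z. cutoff \<Omega> m (fst z) \<partial>Ws i) \<longlonglongrightarrow> (\<integral>z. cutoff \<Omega> m (fst z) \<partial>W)"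
      using conv[OF c K(1,2)] K(3) by simp
    have "(\<integral>z. cutoff \<Omega> m (fst z) \<partial>Ws i) \<le> enn2real (ennreal \<Lambda>)" for i
    proof -
      interpret finite_measure "Ws i" by (rule finite_Ws)
      have "(\<integral>z. cutoff \<Omega> m (fst z) \<partial>Ws i) \<le> (\<integral>z. 1 \<partial>Ws i)"
        by (rule integral_mono') (auto simp: cutoff_bounds)
      also have "\<dots> = measure (Ws i) UNIV" by simp
      also have "\<dots> \<le> enn2real (ennreal \<Lambda>)"
        unfolding measure_def using Ws_bound[of i] by (intro enn2real_mono) auto
      finally show ?thesis .
    qed
    then have "(\<integral>z. cutoff \<Omega> m (fst z) \<partial>W) \<le> enn2real (ennreal \<Lambda>)"
      by (intro LIMSEQ_le_const2[OF lim]) blast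
    moreover have "(\<integral>\<^sup>+z. ennreal (cutoff \<Omega> m (fst z)) \<partial>W) = ennreal (\<integral>z. cutoff \<Omega> m (fst z) \<partial>W)"
      using int by (intro nn_integral_eq_integral) (auto simp: cutoff_bounds)
    ultimately have "(\<integral>\<^sup>+z. ennreal (cutoff \<Omega> m (fst z)) \<partial>W) \<le> ennreal (enn2real (ennreal \<Lambda>))"
      by (metis ennreal_leI)
    then show ?thesis by (simp only: ennreal_enn2real[OF ennreal_less_top])
  qed
  have "emeasure W UNIV \<le> (\<integral>\<^sup>+z. 1 \<partial>W)" by simp
  also have "\<dots> \<le> (\<integral>\<^sup>+z. (SUP m. ennreal (cutoff \<Omega> m (fst z))) \<partial>W)"
  proof (rule nn_integral_mono_AE)
    show "AE z in W. 1 \<le> (SUP m. ennreal (cutoff \<Omega> m (fst z)))"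
      using AE_W_\<Omega>
    proof eventually_elim
      case (elim z)
      then obtain m where "cutoff \<Omega> m (fst z) = 1" using cutoff_eventually_1[OF open_\<Omega>, of "fst z"] by auto
      then show ?case by (metis SUP_upper UNIV_I ennreal_1)
    qed
  qed
  also have "\<dots> = (SUP m. \<integral>\<^sup>+z. ennreal (cutoff \<Omega> m (fst z)) \<partial>W)"
  proof (rule nn_integral_monotone_convergence_SUP)
    show "incseq (\<lambda>m z. ennreal (cutoff \<Omega> m (fst z)))"
      by (auto simp: incseq_def le_fun_def cutoff_mono intro: ennreal_leI)
    fix m show "(\<lambda>z. ennreal (cutoff \<Omega> m (fst z))) \<in> borel_measurable W"
      using borel_measurable_continuous_onI[OF continuous_on_cutoff[OF continuous_on_id], of \<Omega> m] by measurable
  qed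
  also have "\<dots> \<le> ennreal \<Lambda>" using * by (intro SUP_least)
  finally show ?thesis .
qed

lemma finite_W: "finite_measure W"
  using emeasure_W_le by (intro finite_measureI) (auto simp: top_unique)

lemma finite_\<mu>s: "finite_measure (\<mu>s i)" and finite_\<mu>: "finite_measure \<mu>"
  unfolding \<mu>s_def \<mu>_def
  by (auto intro!: finite_measure.finite_measure_distr finite_Ws finite_W)

lemma emeasure_\<mu>_le: "emeasure \<mu> UNIV \<le> ennreal \<Lambda>" and emeasure_\<mu>s_le: "emeasure (\<mu>s i) UNIV \<le> ennreal \<Lambda>"
  unfolding \<mu>s_def \<mu>_def using emeasure_W_le Ws_bound[of i] by (simp_all add: emeasure_distr)

lemma conv_\<mu>:
  assumes "continuous_on UNIV g" "compact K" "K \<subseteq> \<Omega>" "\<And>x. x \<notin> K \<Longrightarrow> g x = (0::real)"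
  shows "(\<lambda>i. \<integral>x. g x \<partial>\<mu>s i) \<longlonglongrightarrow> (\<integral>x. g x \<partial>\<mu>)"
proof -
  have g: "g \<in> borel_measurable borel" using assms(1) by (rule borel_measurable_continuous_onI)
  have "(\<lambda>i. \<integral>z. g (fst z) \<partial>Ws i) \<longlonglongrightarrow> (\<integral>z. g (fst z) \<partial>W)"
  proof (rule conv[OF _ assms(2,3)])
    show "continuous_on UNIV (\<lambda>z::'a \<times> 'a linear_subspace. g (fst z))"
      by (rule continuous_on_compose2[OF assms(1)]) (auto intro: continuous_intros)
  qed (rule assms(4))
  then show ?thesis unfolding \<mu>s_def \<mu>_def using g by (simp add: integral_distr)
qed

text \<open>
  A continuous function between the indicators of two concentric balls transfers mass bounds
  between the sequence and its limit, at the cost of slightly changing the radius.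
\<close>

lemma ball_test_function:
  assumes "0 < s" "s < t" "cball x t \<subseteq> \<Omega>"
  obtains a l where "a \<longlonglongrightarrow> l" "\<And>i. measure (\<mu>s i) (cball x s) \<le> a i" "\<And>i. a i \<le> measure (\<mu>s i) (cball x t)"
    "measure \<mu> (cball x s) \<le> l" "l \<le> measure \<mu> (cball x t)"
proof -
  define g where "g y = max 0 (min 1 ((t - dist x y) / (t - s)))" for y
  have g: "continuous_on UNIV g" unfolding g_def using assms by (intro continuous_intros) auto
  have b: "indicat_real (cball x s) y \<le> g y" "g y \<le> indicat_real (cball x t) y" for y
    using assms by (auto simp: g_def indicator_def divide_le_0_iff)
  have sand: "measure N (cball x s) \<le> (\<integral>y. g y \<partial>N) \<and> (\<integral>y. g y \<partial>N) \<le> measure N (cball x t)"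
    if N: "finite_measure N" "sets N = sets borel" for N
  proof -
    interpret finite_measure N by fact
    have [simp]: "space N = UNIV" using sets_eq_imp_space_eq[OF N(2)] by simp
    have gm: "g \<in> borel_measurable N" using g by (simp add: borel_measurable_continuous_onI measurable_cong_sets[OF N(2) refl])
    have gi: "integrable N g" by (rule integrable_const_bound[of _ 1]) (auto simp: g_def gm)
    have "(\<integral>y. indicat_real (cball x s) y \<partial>N) \<le> (\<integral>y. g y \<partial>N)"
      using N b by (intro integral_mono gi integrable_real_indicator) (auto simp: emeasure_eq_measure)
    moreover have "(\<integral>y. g y \<partial>N) \<le> (\<integral>y. indicat_real (cball x t) y \<partial>N)"
      using N b by (intro integral_mono gi integrable_real_indicator) (auto simp: emeasure_eq_measure)
    ultimately show ?thesis using N by simp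
  qed
  have "(\<lambda>i. \<integral>x. g x \<partial>\<mu>s i) \<longlonglongrightarrow> (\<integral>x. g x \<partial>\<mu>)"
  proof (rule conv_\<mu>[OF g _ assms(3)])
    fix y assume "y \<notin> cball x t"
    then show "g y = 0" using b[of y] by (simp add: g_def)
  qed simp
  then show ?thesis
    using that[of "\<lambda>i. \<integral>x. g x \<partial>\<mu>s i"] sand[OF finite_\<mu> sets_\<mu>] sand[OF finite_\<mu>s sets_\<mu>s] by blast
qed

definition "supp = {x \<in> \<Omega>. \<forall>r>0. 0 < measure \<mu> (cball x r)}"

text \<open>
  A point \<open>x\<close> of the support is a limit of points at which the density bounds for \<open>V\<^sub>i\<close> hold; since \<open>\<beta>\<^sub>i \<rightarrow> 0\<close>, any
  fixed radius is eventually admissible. The factors 1/4, 3 and 8 absorb the change of centre and the change of radius.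
\<close>

lemma density_bounds:
  assumes \<beta>: "\<beta> \<longlonglongrightarrow> 0"
    and dens: "\<And>i. AE x in \<mu>s i. \<forall>r R. \<beta> i < r \<and> r < R \<and> ball x R \<subseteq> \<Omega> \<longrightarrow>
       c0 * r ^ d \<le> measure (\<mu>s i) (ball x r) \<and> measure (\<mu>s i) (ball x r) \<le> c1 * r ^ d"
    and x: "x \<in> supp" and r: "0 < r" "cball x (8 * r) \<subseteq> \<Omega>"
  shows "c0 * (r / 4) ^ d \<le> measure \<mu> (cball x r)" "measure \<mu> (cball x r) \<le> c1 * (3 * r) ^ d"
proof -
  have sub: "cball x t \<subseteq> \<Omega>" if "t \<le> 8 * r" for t using r(2) subset_cball[OF that, of x] by blast
  have ev\<beta>: "eventually (\<lambda>i. \<beta> i < r / 8) sequentially"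
    using order_tendstoD(2)[OF \<beta>, of "r / 8"] r by simp
  have evp: "eventually (\<lambda>i. 0 < measure (\<mu>s i) (cball x (r / 8))) sequentially"
  proof -
    obtain a l where a: "a \<longlonglongrightarrow> l" "\<And>i. measure (\<mu>s i) (cball x (r / 16)) \<le> a i" "\<And>i. a i \<le> measure (\<mu>s i) (cball x (r / 8))"
      "measure \<mu> (cball x (r / 16)) \<le> l" "l \<le> measure \<mu> (cball x (r / 8))"
      by (rule ball_test_function[of "r / 16" "r / 8" x]) (use r in \<open>simp_all add: sub\<close>)
    have "0 < measure \<mu> (cball x (r / 16))" using x r by (simp add: supp_def)
    then have "0 < l" using a(4) by linarith
    then have "eventually (\<lambda>i. 0 < a i) sequentially" using a(1) by (rule order_tendstoD(1)[rotated])
    then show ?thesis by eventually_elim (use a(3) less_le_trans in blast)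
  qed
  have good: "eventually (\<lambda>i. c0 * (r / 4) ^ d \<le> measure (\<mu>s i) (cball x (r / 2)) \<and> measure (\<mu>s i) (cball x (2 * r)) \<le> c1 * (3 * r) ^ d) sequentially"
    using ev\<beta> evp
  proof eventually_elim
    case (elim i)
    interpret finite_measure "\<mu>s i" by (rule finite_\<mu>s)
    have "\<exists>y\<in>cball x (r / 8). \<forall>r R. \<beta> i < r \<and> r < R \<and> ball y R \<subseteq> \<Omega> \<longrightarrow>
       c0 * r ^ d \<le> measure (\<mu>s i) (ball y r) \<and> measure (\<mu>s i) (ball y r) \<le> c1 * r ^ d"
    proof (rule ccontr)
      assume *: "\<not> ?thesis"
      have "AE y in \<mu>s i. y \<notin> cball x (r / 8)"
        using dens[of i] by eventually_elim (use * in blast)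
      then have "cball x (r / 8) \<in> null_sets (\<mu>s i)"
        by (subst AE_iff_null_sets) auto
      then have "emeasure (\<mu>s i) (cball x (r / 8)) = 0" by (rule null_setsD1)
      then show False using elim by (simp add: measure_def)
    qed
    then obtain y where y0: "y \<in> cball x (r / 8)"
      and y2: "\<forall>r R. \<beta> i < r \<and> r < R \<and> ball y R \<subseteq> \<Omega> \<longrightarrow>
       c0 * r ^ d \<le> measure (\<mu>s i) (ball y r) \<and> measure (\<mu>s i) (ball y r) \<le> c1 * r ^ d" by blast
    have y: "dist x y \<le> r / 8" using y0 by simp
    have y2: "\<And>r R. \<beta> i < r \<Longrightarrow> r < R \<Longrightarrow> ball y R \<subseteq> \<Omega> \<Longrightarrow>
       c0 * r ^ d \<le> measure (\<mu>s i) (ball y r) \<and> measure (\<mu>s i) (ball y r) \<le> c1 * r ^ d"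
      using y2 by blast
    have "ball y (7 * r) \<subseteq> cball x (8 * r)"
    proof
      fix z assume "z \<in> ball y (7 * r)"
      then show "z \<in> cball x (8 * r)" using y dist_triangle[of x z y] r by simp
    qed
    then have yb: "ball y (7 * r) \<subseteq> \<Omega>" using r(2) by blast
    have "c0 * (r / 4) ^ d \<le> measure (\<mu>s i) (ball y (r / 4))"
      using y2[OF _ _ yb, of "r / 4"] elim r by simp
    also have "\<dots> \<le> measure (\<mu>s i) (cball x (r / 2))"
    proof (rule finite_measure_mono)
      show "ball y (r / 4) \<subseteq> cball x (r / 2)"
      proof
        fix z assume "z \<in> ball y (r / 4)"
        then show "z \<in> cball x (r / 2)" using y dist_triangle[of x z y] r by simp
      qed
    qed simp
    finally have 1: "c0 * (r / 4) ^ d \<le> measure (\<mu>s i) (cball x (r / 2))" .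
    have "measure (\<mu>s i) (cball x (2 * r)) \<le> measure (\<mu>s i) (ball y (3 * r))"
    proof (rule finite_measure_mono)
      show "cball x (2 * r) \<subseteq> ball y (3 * r)"
      proof
        fix z assume "z \<in> cball x (2 * r)"
        then show "z \<in> ball y (3 * r)" using y dist_triangle[of y z x] r by (simp add: dist_commute)
      qed
    qed simp
    also have "\<dots> \<le> c1 * (3 * r) ^ d" using y2[OF _ _ yb, of "3 * r"] elim r by simp
    finally show ?case using 1 by simp
  qed
  obtain a l where a: "a \<longlonglongrightarrow> l" "\<And>i. measure (\<mu>s i) (cball x (r / 2)) \<le> a i" "\<And>i. a i \<le> measure (\<mu>s i) (cball x (r))"
      "measure \<mu> (cball x (r / 2)) \<le> l" "l \<le> measure \<mu> (cball x (r))"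
      by (rule ball_test_function[of "r / 2" "r" x]) (use r in \<open>simp_all add: sub\<close>)
  have "c0 * (r / 4) ^ d \<le> l"
    by (rule tendsto_lowerbound[OF a(1)]) (use good in \<open>eventually_elim, use a(2) order_trans in blast\<close>, simp)
  then show "c0 * (r / 4) ^ d \<le> measure \<mu> (cball x r)" using a(5) by simp
  obtain a l where a: "a \<longlonglongrightarrow> l" "\<And>i. measure (\<mu>s i) (cball x (r)) \<le> a i" "\<And>i. a i \<le> measure (\<mu>s i) (cball x (2 * r))"
      "measure \<mu> (cball x (r)) \<le> l" "l \<le> measure \<mu> (cball x (2 * r))"
      by (rule ball_test_function[of "r" "2 * r" x]) (use r in \<open>simp_all add: sub\<close>)
  have "l \<le> c1 * (3 * r) ^ d"
    by (rule tendsto_upperbound[OF a(1)]) (use good in \<open>eventually_elim, use a(3) order_trans in blast\<close>, simp)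
  then show "measure \<mu> (cball x r) \<le> c1 * (3 * r) ^ d" using a(4) by simp
qed

text \<open>
  A continuous approximation from below, increasing in \<open>m\<close>, of \<open>s \<mapsto> s\<^bsup>-(d+2)\<^esup>\<close> on \<open>0 < s < 1/2\<close>. It vanishes for
  \<open>s \<le> 1 / (m + 1)\<close>, so once \<open>\<alpha>\<^sub>i < 1 / (m + 1)\<close> it is non-zero only at scales that the excess of \<open>V\<^sub>i\<close> covers.
  The factor \<open>max 0 (1/2 - s)\<close> cuts off at scale 1/2, and the maximum in the denominator keeps the quotient continuous at 0.
\<close>

definition kernel_weight :: "nat \<Rightarrow> real \<Rightarrow> real" where
  "kernel_weight m s = min 1 (max 0 (real (Suc m) * s - 1)) * max 0 (1 / 2 - s) / (max s (1 / real (Suc m))) ^ (d + 2)"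

lemma kernel_weight_nonneg: "0 \<le> kernel_weight m s"
  unfolding kernel_weight_def
  by (intro divide_nonneg_nonneg mult_nonneg_nonneg zero_le_power) (auto simp: le_max_iff_disj)

lemma continuous_on_kernel_weight [continuous_intros]:
  assumes "continuous_on A f" shows "continuous_on A (\<lambda>x. kernel_weight m (f x))"
  unfolding kernel_weight_def
proof (intro continuous_intros assms ballI)
  fix x show "max (f x) (1 / real (Suc m)) ^ (d + 2) \<noteq> 0"
    by (smt (verit) divide_pos_pos of_nat_0_less_iff power_eq_0_iff zero_less_Suc zero_less_one)
qed

lemma kernel_weight_small: "s \<le> 1 / real (Suc m) \<Longrightarrow> kernel_weight m s = 0"
proof -
  assume "s \<le> 1 / real (Suc m)"
  then have "real (Suc m) * s \<le> 1" by (simp add: field_simps)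
  then have "min 1 (max 0 (real (Suc m) * s - 1)) = 0" by simp
  then show ?thesis unfolding kernel_weight_def by simp
qed

lemma kernel_weight_large: "1 / real (Suc m) \<le> s \<Longrightarrow> kernel_weight m s = min 1 (max 0 (real (Suc m) * s - 1)) * max 0 (1 / 2 - s) / s ^ (d + 2)"
  unfolding kernel_weight_def by (simp add: max_def)

lemma kernel_weight_le: "0 < s \<Longrightarrow> kernel_weight m s \<le> 1 / s ^ (d + 2)"
proof (cases "1 / real (Suc m) \<le> s")
  case True
  assume s: "0 < s"
  have "min 1 (max 0 (real (Suc m) * s - 1)) * max 0 (1 / 2 - s) \<le> 1 * 1"
    using s by (intro mult_mono) auto
  then show ?thesis unfolding kernel_weight_large[OF True] using s by (intro divide_right_mono) auto
next
  case False
  assume "0 < s"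
  then show ?thesis using kernel_weight_small[of s m] False by simp
qed

lemma kernel_weight_far: "1 / 2 \<le> s \<Longrightarrow> kernel_weight m s = 0"
  unfolding kernel_weight_def by simp

lemma kernel_weight_mono: "m \<le> n \<Longrightarrow> kernel_weight m s \<le> kernel_weight n s"
proof (cases "1 / real (Suc m) \<le> s")
  case True
  assume mn: "m \<le> n"
  have s: "0 < s" using True by (smt (verit) divide_pos_pos of_nat_0_less_iff zero_less_Suc)
  have "1 / real (Suc n) \<le> 1 / real (Suc m)" using mn by (simp add: frac_le)
  then have T2: "1 / real (Suc n) \<le> s" using True by linarith
  have "real (Suc m) * s \<le> real (Suc n) * s" using mn s by (intro mult_right_mono) auto
  then have "min 1 (max 0 (real (Suc m) * s - 1)) * max 0 (1 / 2 - s) \<le> min 1 (max 0 (real (Suc n) * s - 1)) * max 0 (1 / 2 - s)"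
    by (intro mult_right_mono min.mono max.mono) auto
  then show ?thesis unfolding kernel_weight_large[OF True] kernel_weight_large[OF T2] using s by (intro divide_right_mono) auto
next
  case False
  then show ?thesis using kernel_weight_small[of s m] kernel_weight_nonneg[of n s] by simp
qed

lemma kernel_weight_eventually:
  assumes "0 < s" "s \<le> 1 / 4"
  shows "\<exists>m0. \<forall>m\<ge>m0. 1 / (4 * s ^ (d + 2)) \<le> kernel_weight m s"
proof -
  obtain m0 where m0: "real m0 > 2 / s" using reals_Archimedean2 by blast
  have "1 / (4 * s ^ (d + 2)) \<le> kernel_weight m s" if "m \<ge> m0" for m
  proof -
    have "2 / s < real (Suc m)" using m0 that by linarith
    then have 2: "2 < real (Suc m) * s" using assms by (simp add: field_simps)
    then have "1 \<le> real (Suc m) * s" by linarith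
    then have "1 / real (Suc m) \<le> s" by (simp add: divide_le_eq mult.commute)
    note large = kernel_weight_large[OF this]
    have "min 1 (max 0 (real (Suc m) * s - 1)) = 1" using 2 by simp
    then have "kernel_weight m s = (1 / 2 - s) / s ^ (d + 2)" using large assms by simp
    also have "\<dots> \<ge> (1 / 4) / s ^ (d + 2)" using assms by (intro divide_right_mono) auto
    finally show ?thesis by simp
  qed
  then show ?thesis by blast
qed

definition excess_kernel :: "nat \<Rightarrow> 'a \<times> 'a linear_subspace \<Rightarrow> 'a \<Rightarrow> real" where
  "excess_kernel m z y = cutoff \<Omega> m (fst z) * cutoff \<Omega> m y * kernel_weight m (dist (fst z) y)
     * (norm ((y - fst z) - orth_proj (snd z) (y - fst z)))\<^sup>2"

lemma excess_kernel_nonneg: "0 \<le> excess_kernel m z y"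
  unfolding excess_kernel_def by (intro mult_nonneg_nonneg cutoff_bounds kernel_weight_nonneg) auto

lemma excess_kernel_mono: "m \<le> n \<Longrightarrow> excess_kernel m z y \<le> excess_kernel n z y"
  unfolding excess_kernel_def
  by (intro mult_mono cutoff_mono kernel_weight_mono mult_nonneg_nonneg cutoff_bounds kernel_weight_nonneg) auto

lemma continuous_on_excess_kernel: "continuous_on UNIV (\<lambda>p. excess_kernel m (fst p) (snd p))"
  unfolding excess_kernel_def by (intro continuous_intros)

end

lemma equicontinuous_uniform_limit:
  fixes F :: "nat \<Rightarrow> 'b::metric_space \<Rightarrow> real"
  assumes K: "compact K" and pt: "\<And>z. z \<in> K \<Longrightarrow> (\<lambda>i. F i z) \<longlonglongrightarrow> G z"
    and eq: "\<And>e. 0 < e \<Longrightarrow> \<exists>\<delta>>0. \<forall>z\<in>K. \<forall>w\<in>K. dist z w < \<delta> \<longrightarrow> (\<forall>i. \<bar>F i z - F i w\<bar> \<le> e) \<and> \<bar>G z - G w\<bar> \<le> e"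
    and e: "0 < e"
  shows "eventually (\<lambda>i. \<forall>z\<in>K. \<bar>F i z - G z\<bar> \<le> e) sequentially"
proof -
  obtain \<delta> where \<delta>: "\<delta> > 0" "\<And>z w i. z \<in> K \<Longrightarrow> w \<in> K \<Longrightarrow> dist z w < \<delta> \<Longrightarrow> \<bar>F i z - F i w\<bar> \<le> e / 3"
     "\<And>z w. z \<in> K \<Longrightarrow> w \<in> K \<Longrightarrow> dist z w < \<delta> \<Longrightarrow> \<bar>G z - G w\<bar> \<le> e / 3"
    using eq[of "e / 3"] e by (metis divide_pos_pos zero_less_numeral)
  have "K \<subseteq> (\<Union>z\<in>K. ball z \<delta>)" using \<delta>(1) by auto
  from compactE_image[OF K _ this] obtain C where C: "C \<subseteq> K" "finite C" "K \<subseteq> (\<Union>z\<in>C. ball z \<delta>)" by auto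
  have "eventually (\<lambda>i. \<forall>z\<in>C. \<bar>F i z - G z\<bar> < e / 3) sequentially"
  proof (rule eventually_ball_finite[OF C(2)], rule ballI)
    fix z assume "z \<in> C"
    then have "(\<lambda>i. F i z) \<longlonglongrightarrow> G z" using C pt by auto
    from tendstoD[OF this, of "e / 3"] show "eventually (\<lambda>i. \<bar>F i z - G z\<bar> < e / 3) sequentially"
      using e by (simp add: dist_real_def)
  qed
  then show ?thesis
  proof eventually_elim
    case (elim i)
    show ?case
    proof
      fix z assume z: "z \<in> K"
      then obtain w where w: "w \<in> C" "dist w z < \<delta>" using C by auto
      then have "\<bar>F i z - F i w\<bar> \<le> e / 3" "\<bar>G z - G w\<bar> \<le> e / 3"
        using \<delta>(2)[of z w i] \<delta>(3)[of z w] z C by (auto simp: dist_commute)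
      moreover have "\<bar>F i w - G w\<bar> < e / 3" using elim w by blast
      ultimately show "\<bar>F i z - G z\<bar> \<le> e" by linarith
    qed
  qed
qed

lemma continuous_parametric_integral:
  fixes f :: "'b::metric_space \<times> 'c::{second_countable_topology,metric_space} \<Rightarrow> real"
  assumes f: "continuous_on UNIV f" and B: "\<And>p. \<bar>f p\<bar> \<le> B" and N: "finite_measure N" "sets N = sets borel"
  shows "continuous_on UNIV (\<lambda>z. \<integral>y. f (z, y) \<partial>N)"
proof -
  interpret finite_measure N by fact
  have m: "(\<lambda>y. f (z, y)) \<in> borel_measurable N" for z
  proof -
    have "continuous_on UNIV (\<lambda>y. f (z, y))" by (rule continuous_on_compose2[OF f]) (auto intro: continuous_intros)
    then show ?thesis by (simp add: borel_measurable_continuous_onI measurable_cong_sets[OF N(2) refl])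
  qed
  show ?thesis
    unfolding continuous_on_sequentially
  proof (intro allI ballI impI)
    fix u :: "nat \<Rightarrow> 'b" and z assume u: "(\<forall>n. u n \<in> UNIV) \<and> u \<longlonglongrightarrow> z"
    show "((\<lambda>z. \<integral>y. f (z, y) \<partial>N) \<circ> u) \<longlonglongrightarrow> (\<integral>y. f (z, y) \<partial>N)"
      unfolding o_def
    proof (rule integral_dominated_convergence[where w = "\<lambda>_. B"])
      show "AE y in N. (\<lambda>i. f (u i, y)) \<longlonglongrightarrow> f (z, y)"
      proof (rule AE_I2)
        fix y :: 'c
        have "(\<lambda>i. (u i, y)) \<longlonglongrightarrow> (z, y)" using u by (intro tendsto_intros) auto
        then show "(\<lambda>i. f (u i, y)) \<longlonglongrightarrow> f (z, y)"
          using f by (metis UNIV_I continuous_on_eq_continuous_at isCont_tendsto_compose open_UNIV)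
      qed
    qed (use m B in auto)
  qed
qed

lemma norm_lebesgue_integral_le:
  fixes f :: "'b \<Rightarrow> real"
  assumes "\<And>x. norm (f x) \<le> g x" "integrable M f" "integrable M g"
  shows "norm (\<integral>x. f x \<partial>M) \<le> (\<integral>x. g x \<partial>M)"
  using assms by (intro order_trans[OF integral_norm_bound integral_mono]) auto

context varifold_sequence begin

definition "mass_bound = max 0 \<Lambda>"

lemma mass_bound_nonneg: "0 \<le> mass_bound" by (simp add: mass_bound_def)

lemma measure_le_mass_bound:
  "measure (Ws i) UNIV \<le> mass_bound" "measure W UNIV \<le> mass_bound"
  "measure (\<mu>s i) UNIV \<le> mass_bound" "measure \<mu> UNIV \<le> mass_bound"
proof -
  have L: "ennreal \<Lambda> = ennreal mass_bound" by (simp add: mass_bound_def max_def ennreal_neg)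
  show "measure (Ws i) UNIV \<le> mass_bound" "measure W UNIV \<le> mass_bound"
    "measure (\<mu>s i) UNIV \<le> mass_bound" "measure \<mu> UNIV \<le> mass_bound"
    unfolding measure_def using Ws_bound[of i] emeasure_W_le emeasure_\<mu>s_le[of i] emeasure_\<mu>_le mass_bound_nonneg
    unfolding L by (simp_all add: enn2real_leI)
qed

text \<open>
  The inner integrals \<open>\<integral> \<Phi>(z, y) d\<mu>\<^sub>i(y)\<close> converge for each \<open>z\<close> and are equicontinuous in \<open>z\<close>, because \<open>\<Phi>\<close> is uniformly
  continuous and the masses are bounded. So they converge uniformly on compact sets, and the outer
  integration against \<open>V\<^sub>i\<close> passes to the limit.
\<close>

lemma double_integral_limit:
  fixes \<Phi> :: "('a \<times> 'a linear_subspace) \<times> 'a \<Rightarrow> real"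
  assumes \<Phi>: "continuous_on UNIV \<Phi>" and K: "compact K" "K \<subseteq> \<Omega>"
    and supp: "\<And>z y. fst z \<notin> K \<or> y \<notin> K \<Longrightarrow> \<Phi> (z, y) = 0"
  shows "(\<lambda>i. \<integral>z. (\<integral>y. \<Phi> (z, y) \<partial>\<mu>s i) \<partial>Ws i) \<longlonglongrightarrow> (\<integral>z. (\<integral>y. \<Phi> (z, y) \<partial>\<mu>) \<partial>W)"
proof -
  define Z where "Z = K \<times> (UNIV :: 'a linear_subspace set)"
  have Z: "compact Z" unfolding Z_def by (intro compact_Times K compact_linear_subspaces)
  have ZK: "compact (Z \<times> K)" by (intro compact_Times Z K)
  have \<Phi>c: "continuous_on (Z \<times> K) \<Phi>" using \<Phi> by (rule continuous_on_subset) simp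
  have "bounded (\<Phi> ` (Z \<times> K))" using ZK \<Phi>c by (intro compact_imp_bounded compact_continuous_image)
  then obtain B0 where B0: "\<And>p. p \<in> Z \<times> K \<Longrightarrow> norm (\<Phi> p) \<le> B0" unfolding bounded_iff by blast
  define B where "B = max 0 B0"
  have B: "\<bar>\<Phi> p\<bar> \<le> B" for p
  proof (cases "p \<in> Z \<times> K")
    case True then show ?thesis using B0[OF True] by (simp add: B_def)
  next
    case False
    then have "\<Phi> (fst p, snd p) = 0" by (intro supp) (auto simp: Z_def mem_Times_iff)
    then show ?thesis by (simp add: B_def)
  qed
  define F where "F i z = (\<integral>y. \<Phi> (z, y) \<partial>\<mu>s i)" for i z
  define G where "G z = (\<integral>y. \<Phi> (z, y) \<partial>\<mu>)" for z
  have Fc: "continuous_on UNIV (F i)" for i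
    unfolding F_def by (rule continuous_parametric_integral[OF \<Phi> B finite_\<mu>s sets_\<mu>s])
  have Gc: "continuous_on UNIV G"
    unfolding G_def by (rule continuous_parametric_integral[OF \<Phi> B finite_\<mu> sets_\<mu>])
  have F0: "F i z = 0" and G0: "G z = 0" if "fst z \<notin> K" for i z
    using supp[of z] that by (simp_all add: F_def G_def)
  have y_cont: "continuous_on UNIV (\<lambda>y. \<Phi> (z, y))" for z
    by (rule continuous_on_compose2[OF \<Phi>]) (auto intro: continuous_intros)
  have pt: "(\<lambda>i. F i z) \<longlonglongrightarrow> G z" for z
    unfolding F_def G_def by (rule conv_\<mu>[OF y_cont K]) (simp add: supp)
  have diff: "\<bar>(\<integral>y. \<Phi> (z, y) \<partial>N) - (\<integral>y. \<Phi> (w, y) \<partial>N)\<bar> \<le> e * mass_bound"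
    if N: "finite_measure N" "sets N = sets borel" "measure N UNIV \<le> mass_bound" and e: "0 \<le> e"
      and le: "\<And>y. y \<in> K \<Longrightarrow> \<bar>\<Phi> (z, y) - \<Phi> (w, y)\<bar> \<le> e" for N z w e
  proof -
    interpret finite_measure N by fact
    have [simp]: "space N = UNIV" using sets_eq_imp_space_eq[OF N(2)] by simp
    have int: "integrable N (\<lambda>y. \<Phi> (z, y))" for z
      by (rule integrable_const_bound[of _ B])
        (use B y_cont in \<open>auto simp: borel_measurable_continuous_onI measurable_cong_sets[OF N(2) refl]\<close>)
    have "\<bar>(\<integral>y. \<Phi> (z, y) \<partial>N) - (\<integral>y. \<Phi> (w, y) \<partial>N)\<bar> = norm (\<integral>y. \<Phi> (z, y) - \<Phi> (w, y) \<partial>N)"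
      using int by simp
    also have "\<dots> \<le> (\<integral>y. e \<partial>N)"
    proof (rule norm_lebesgue_integral_le)
      fix y show "norm (\<Phi> (z, y) - \<Phi> (w, y)) \<le> e"
        using le[of y] supp[of z y] supp[of w y] e by (cases "y \<in> K") auto
    qed (use int in auto)
    also have "\<dots> = e * measure N UNIV" by simp
    also have "\<dots> \<le> e * mass_bound" using N(3) e by (rule mult_left_mono)
    finally show ?thesis .
  qed
  have unif: "eventually (\<lambda>i. \<forall>z\<in>Z. \<bar>F i z - G z\<bar> \<le> e) sequentially" if e: "0 < e" for e
  proof (rule equicontinuous_uniform_limit[OF Z pt _ e])
    fix e :: real assume e: "0 < e"
    define e' where "e' = e / (mass_bound + 1)"
    have e': "0 < e'" "e' * mass_bound \<le> e"
      using e mass_bound_nonneg by (auto simp: e'_def divide_simps)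
    have "\<forall>e>0. \<exists>d>0. \<forall>p\<in>Z \<times> K. \<forall>q\<in>Z \<times> K. dist q p < d \<longrightarrow> dist (\<Phi> q) (\<Phi> p) < e"
      using compact_uniformly_continuous[OF \<Phi>c ZK] unfolding uniformly_continuous_on_def .
    then have "\<exists>d>0. \<forall>p\<in>Z \<times> K. \<forall>q\<in>Z \<times> K. dist q p < d \<longrightarrow> dist (\<Phi> q) (\<Phi> p) < e'"
      using e'(1) by (metis (no_types, lifting))
    then obtain \<delta> where \<delta>: "\<delta> > 0" "\<And>p q. p \<in> Z \<times> K \<Longrightarrow> q \<in> Z \<times> K \<Longrightarrow> dist q p < \<delta> \<Longrightarrow> dist (\<Phi> q) (\<Phi> p) < e'"
      by metis
    have \<Phi>e: "\<bar>\<Phi> (z, y) - \<Phi> (w, y)\<bar> \<le> e'" if "z \<in> Z" "w \<in> Z" "dist z w < \<delta>" "y \<in> K" for z w y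
    proof -
      have "dist (z, y) (w, y) = dist z w" by (simp add: dist_prod_def)
      then show ?thesis using \<delta>(2)[of "(w, y)" "(z, y)"] that by (simp add: dist_real_def)
    qed
    have "(\<forall>i. \<bar>F i z - F i w\<bar> \<le> e) \<and> \<bar>G z - G w\<bar> \<le> e" if "z \<in> Z" "w \<in> Z" "dist z w < \<delta>" for z w
    proof -
      have le: "\<And>y. y \<in> K \<Longrightarrow> \<bar>\<Phi> (z, y) - \<Phi> (w, y)\<bar> \<le> e'"
        using that by (intro \<Phi>e) auto
      have "\<bar>F i z - F i w\<bar> \<le> e" for i
        using diff[OF finite_\<mu>s sets_\<mu>s measure_le_mass_bound(3) less_imp_le[OF e'(1)] le, of i] e'(2)
        unfolding F_def by linarith
      moreover have "\<bar>G z - G w\<bar> \<le> e"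
        using diff[OF finite_\<mu> sets_\<mu> measure_le_mass_bound(4) less_imp_le[OF e'(1)] le] e'(2)
        unfolding G_def by linarith
      ultimately show ?thesis by blast
    qed
    then show "\<exists>\<delta>>0. \<forall>z\<in>Z. \<forall>w\<in>Z. dist z w < \<delta> \<longrightarrow> (\<forall>i. \<bar>F i z - F i w\<bar> \<le> e) \<and> \<bar>G z - G w\<bar> \<le> e"
      using \<delta>(1) by blast
  qed
  have Fb: "\<bar>F i z\<bar> \<le> B * mass_bound" and Gb: "\<bar>G z\<bar> \<le> B * mass_bound" for i z
  proof -
    have "\<bar>\<integral>y. \<Phi> (z, y) \<partial>N\<bar> \<le> B * mass_bound"
      if N: "finite_measure N" "sets N = sets borel" "measure N UNIV \<le> mass_bound" for N
    proof -
      interpret finite_measure N by fact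
      have [simp]: "space N = UNIV" using sets_eq_imp_space_eq[OF N(2)] by simp
      have int: "integrable N (\<lambda>y. \<Phi> (z, y))" for z
        by (rule integrable_const_bound[of _ B])
          (use B y_cont in \<open>auto simp: borel_measurable_continuous_onI measurable_cong_sets[OF N(2) refl]\<close>)
      have "norm (\<integral>y. \<Phi> (z, y) \<partial>N) \<le> (\<integral>y. B \<partial>N)"
        by (rule norm_lebesgue_integral_le) (use int B in auto)
      also have "\<dots> = B * measure N UNIV" by simp
      also have "\<dots> \<le> B * mass_bound" using N(3) by (rule mult_left_mono) (simp add: B_def)
      finally show ?thesis by simp
    qed
    then show "\<bar>F i z\<bar> \<le> B * mass_bound" "\<bar>G z\<bar> \<le> B * mass_bound"
      unfolding F_def G_def using finite_\<mu>s finite_\<mu> measure_le_mass_bound by auto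
  qed
  have Fi: "integrable (Ws i) (F i)" and Gi: "integrable (Ws i) G" for i
  proof -
    interpret finite_measure "Ws i" by (rule finite_Ws)
    show "integrable (Ws i) (F i)" "integrable (Ws i) G"
      by (rule integrable_const_bound[of _ "B * mass_bound"];
        use Fb Gb Fc Gc in \<open>auto simp: borel_measurable_continuous_onI measurable_cong_sets[OF sets_Ws refl]\<close>)+
  qed
  have "(\<lambda>i. (\<integral>z. F i z \<partial>Ws i) - (\<integral>z. G z \<partial>Ws i)) \<longlonglongrightarrow> 0"
  proof (rule tendstoI)
    fix e :: real assume e: "0 < e"
    define e' where "e' = e / (mass_bound + 1)"
    have e': "0 < e'" "e' * mass_bound < e"
      using e mass_bound_nonneg by (auto simp: e'_def divide_simps)
    show "eventually (\<lambda>i. dist ((\<integral>z. F i z \<partial>Ws i) - (\<integral>z. G z \<partial>Ws i)) 0 < e) sequentially"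
      using unif[OF e'(1)]
    proof eventually_elim
      case (elim i)
      interpret finite_measure "Ws i" by (rule finite_Ws)
      have "dist ((\<integral>z. F i z \<partial>Ws i) - (\<integral>z. G z \<partial>Ws i)) 0 = norm (\<integral>z. F i z - G z \<partial>Ws i)"
        using Fi Gi by simp
      also have "\<dots> \<le> (\<integral>z. e' \<partial>Ws i)"
      proof (rule norm_lebesgue_integral_le)
        fix z show "norm (F i z - G z) \<le> e'"
        proof (cases "fst z \<in> K")
          case True
          then have "z \<in> Z" by (simp add: Z_def mem_Times_iff)
          then show ?thesis using elim by simp
        qed (use F0[of z i] G0[of z] e'(1) in simp)
      qed (use Fi Gi in auto)
      also have "\<dots> = e' * measure (Ws i) UNIV" by simp
      also have "\<dots> \<le> e' * mass_bound" using measure_le_mass_bound e'(1) by (intro mult_left_mono) auto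
      finally show ?case using e'(2) by linarith
    qed
  qed
  moreover have "(\<lambda>i. \<integral>z. G z \<partial>Ws i) \<longlonglongrightarrow> (\<integral>z. G z \<partial>W)"
    by (rule conv[OF Gc K]) (rule G0)
  ultimately have "(\<lambda>i. ((\<integral>z. F i z \<partial>Ws i) - (\<integral>z. G z \<partial>Ws i)) + (\<integral>z. G z \<partial>Ws i)) \<longlonglongrightarrow> 0 + (\<integral>z. G z \<partial>W)"
    by (rule tendsto_add)
  then show ?thesis by (simp add: F_def G_def)
qed

lemma double_nn_integral_eq:
  fixes \<Phi> :: "('a \<times> 'a linear_subspace) \<times> 'a \<Rightarrow> real"
  assumes \<Phi>: "continuous_on UNIV \<Phi>" and B: "\<And>p. 0 \<le> \<Phi> p" "\<And>p. \<Phi> p \<le> B"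
    and N: "finite_measure N" "sets N = sets borel" and M: "finite_measure M" "sets M = sets borel"
  shows "(\<integral>\<^sup>+z. (\<integral>\<^sup>+y. ennreal (\<Phi> (z, y)) \<partial>N) \<partial>M) = ennreal (\<integral>z. (\<integral>y. \<Phi> (z, y) \<partial>N) \<partial>M)"
    "(\<lambda>z. \<integral>\<^sup>+y. ennreal (\<Phi> (z, y)) \<partial>N) \<in> borel_measurable borel"
proof -
  interpret N: finite_measure N by fact
  interpret M: finite_measure M by fact
  have [simp]: "space N = UNIV" "space M = UNIV" using sets_eq_imp_space_eq[OF N(2)] sets_eq_imp_space_eq[OF M(2)] by simp_all
  have y_cont: "continuous_on UNIV (\<lambda>y. \<Phi> (z, y))" for z
    by (rule continuous_on_compose2[OF \<Phi>]) (auto intro: continuous_intros)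
  have int: "integrable N (\<lambda>y. \<Phi> (z, y))" for z
    by (rule N.integrable_const_bound[of _ B])
      (use B y_cont in \<open>auto simp: borel_measurable_continuous_onI measurable_cong_sets[OF N(2) refl]\<close>)
  have 1: "(\<integral>\<^sup>+y. ennreal (\<Phi> (z, y)) \<partial>N) = ennreal (\<integral>y. \<Phi> (z, y) \<partial>N)" for z
    using int B by (intro nn_integral_eq_integral) auto
  have c: "continuous_on UNIV (\<lambda>z. \<integral>y. \<Phi> (z, y) \<partial>N)"
    by (rule continuous_parametric_integral[OF \<Phi> _ N, of B]) (use B in auto)
  then show 2: "(\<lambda>z. \<integral>\<^sup>+y. ennreal (\<Phi> (z, y)) \<partial>N) \<in> borel_measurable borel"
    unfolding 1 by (intro measurable_compose[OF borel_measurable_continuous_onI measurable_ennreal])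
  have b: "norm (\<integral>y. \<Phi> (z, y) \<partial>N) \<le> B * measure N UNIV" for z
  proof -
    have "norm (\<integral>y. \<Phi> (z, y) \<partial>N) \<le> (\<integral>y. B \<partial>N)"
      by (rule norm_lebesgue_integral_le) (use int B in auto)
    then show ?thesis by (simp add: mult.commute)
  qed
  have int2: "integrable M (\<lambda>z. \<integral>y. \<Phi> (z, y) \<partial>N)"
    by (rule M.integrable_const_bound[of _ "B * measure N UNIV"])
      (use b c in \<open>auto simp: borel_measurable_continuous_onI measurable_cong_sets[OF M(2) refl]\<close>)
  show "(\<integral>\<^sup>+z. (\<integral>\<^sup>+y. ennreal (\<Phi> (z, y)) \<partial>N) \<partial>M) = ennreal (\<integral>z. (\<integral>y. \<Phi> (z, y) \<partial>N) \<partial>M)"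
    unfolding 1 using int2 B by (intro nn_integral_eq_integral) (auto intro!: integral_nonneg_AE)
qed

lemma excess_kernel_support:
  "\<exists>K B. compact K \<and> K \<subseteq> \<Omega> \<and> (\<forall>z y. fst z \<notin> K \<or> y \<notin> K \<longrightarrow> excess_kernel m z y = 0) \<and> (\<forall>z y. excess_kernel m z y \<le> B)"
proof -
  obtain K where K: "compact K" "K \<subseteq> \<Omega>" "\<And>x. x \<notin> K \<Longrightarrow> cutoff \<Omega> m x = 0"
    using cutoff_support[OF open_\<Omega>, of m] by blast
  define T where "T = (K \<times> (UNIV :: 'a linear_subspace set)) \<times> K"
  have "compact T" unfolding T_def by (intro compact_Times K compact_linear_subspaces)
  then have "bounded ((\<lambda>p. excess_kernel m (fst p) (snd p)) ` T)"
    by (intro compact_imp_bounded compact_continuous_image continuous_on_subset[OF continuous_on_excess_kernel]) auto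
  then obtain B where B: "\<And>p. p \<in> T \<Longrightarrow> norm (excess_kernel m (fst p) (snd p)) \<le> B" unfolding bounded_iff by blast
  have 0: "fst z \<notin> K \<or> y \<notin> K \<Longrightarrow> excess_kernel m z y = 0" for z y
    using K(3) by (auto simp: excess_kernel_def)
  have "excess_kernel m z y \<le> max 0 B" for z y
  proof (cases "fst z \<in> K \<and> y \<in> K")
    case True
    then show ?thesis using B[of "(z, y)"] by (auto simp: T_def mem_Times_iff)
  next
    case False
    then have "excess_kernel m z y = 0" by (intro 0) auto
    then show ?thesis by simp
  qed
  then show ?thesis using K 0 by blast
qed

lemma excess_limit_le:
  assumes "0 \<le> E" and E: "\<And>m. eventually (\<lambda>i. (\<integral>\<^sup>+z. (\<integral>\<^sup>+y. ennreal (excess_kernel m z y) \<partial>\<mu>s i) \<partial>Ws i) \<le> ennreal E) sequentially"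
  shows "(\<integral>\<^sup>+z. (\<integral>\<^sup>+y. ennreal (excess_kernel m z y) \<partial>\<mu>) \<partial>W) \<le> ennreal E"
    "(\<lambda>z. \<integral>\<^sup>+y. ennreal (excess_kernel m z y) \<partial>\<mu>) \<in> borel_measurable borel"
proof -
  obtain K B where K: "compact K" "K \<subseteq> \<Omega>" "\<And>z y. fst z \<notin> K \<or> y \<notin> K \<Longrightarrow> excess_kernel m z y = 0"
    "\<And>z y. excess_kernel m z y \<le> B" using excess_kernel_support by metis
  define \<Phi> where "\<Phi> p = excess_kernel m (fst p) (snd p)" for p
  have c: "continuous_on UNIV \<Phi>" unfolding \<Phi>_def by (rule continuous_on_excess_kernel)
  have b: "\<And>p. 0 \<le> \<Phi> p" "\<And>p. \<Phi> p \<le> B" using K(4) by (auto simp: \<Phi>_def excess_kernel_nonneg)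
  have lim: "(\<lambda>i. \<integral>z. (\<integral>y. \<Phi> (z, y) \<partial>\<mu>s i) \<partial>Ws i) \<longlonglongrightarrow> (\<integral>z. (\<integral>y. \<Phi> (z, y) \<partial>\<mu>) \<partial>W)"
    by (rule double_integral_limit[OF c K(1,2)]) (use K(3) in \<open>auto simp: \<Phi>_def\<close>)
  have "eventually (\<lambda>i. (\<integral>z. (\<integral>y. \<Phi> (z, y) \<partial>\<mu>s i) \<partial>Ws i) \<le> E) sequentially"
    using E[of m]
  proof eventually_elim
    case (elim i)
    then have "(\<integral>\<^sup>+z. (\<integral>\<^sup>+y. ennreal (\<Phi> (z, y)) \<partial>\<mu>s i) \<partial>Ws i) \<le> ennreal E" by (simp add: \<Phi>_def)
    then show ?case
      unfolding double_nn_integral_eq(1)[OF c b finite_\<mu>s sets_\<mu>s finite_Ws sets_Ws]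
      using \<open>0 \<le> E\<close> by (simp add: ennreal_le_iff)
  qed
  then have "(\<integral>z. (\<integral>y. \<Phi> (z, y) \<partial>\<mu>) \<partial>W) \<le> E"
    by (intro tendsto_upperbound[OF lim]) auto
  then have "(\<integral>\<^sup>+z. (\<integral>\<^sup>+y. ennreal (\<Phi> (z, y)) \<partial>\<mu>) \<partial>W) \<le> ennreal E"
    unfolding double_nn_integral_eq(1)[OF c b finite_\<mu> sets_\<mu> finite_W sets_W] by (rule ennreal_leI)
  then show "(\<integral>\<^sup>+z. (\<integral>\<^sup>+y. ennreal (excess_kernel m z y) \<partial>\<mu>) \<partial>W) \<le> ennreal E" by (simp add: \<Phi>_def)
  show "(\<lambda>z. \<integral>\<^sup>+y. ennreal (excess_kernel m z y) \<partial>\<mu>) \<in> borel_measurable borel"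
    using double_nn_integral_eq(2)[OF c b finite_\<mu> sets_\<mu> finite_W sets_W] by (simp add: \<Phi>_def)
qed

text \<open>
  On the ball of radius 1/4 the truncation factor \<open>1/2 - s\<close> of the approximating kernels is at least 1/4.
\<close>

definition height_kernel :: "'a \<times> 'a linear_subspace \<Rightarrow> 'a \<Rightarrow> real" where
  "height_kernel z y = indicat_real (ball (fst z) (1 / 4) \<inter> \<Omega> - {fst z}) y
     * ((norm ((y - fst z) - orth_proj (snd z) (y - fst z)))\<^sup>2 / dist (fst z) y ^ (d + 2))"

lemma excess_kernel_measurable: "excess_kernel m z \<in> borel_measurable borel"
proof -
  have "continuous_on UNIV (excess_kernel m z)"
    using continuous_on_compose2[OF continuous_on_excess_kernel, of UNIV "\<lambda>y. (z, y)"] by (simp add: continuous_intros)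
  then show ?thesis by (rule borel_measurable_continuous_onI)
qed

lemma AE_height_kernel_finite:
  assumes "0 \<le> E" and E: "\<And>m. eventually (\<lambda>i. (\<integral>\<^sup>+z. (\<integral>\<^sup>+y. ennreal (excess_kernel m z y) \<partial>\<mu>s i) \<partial>Ws i) \<le> ennreal E) sequentially"
  shows "AE z in W. (\<integral>\<^sup>+y. ennreal (height_kernel z y) \<partial>\<mu>) < \<infinity>"
proof -
  have meas: "(\<lambda>z. \<integral>\<^sup>+y. ennreal (excess_kernel m z y) \<partial>\<mu>) \<in> borel_measurable W" for m
    using excess_limit_le(2)[OF assms] by (simp add: measurable_cong_sets[OF sets_W refl])
  have "(\<integral>\<^sup>+z. (SUP m. \<integral>\<^sup>+y. ennreal (excess_kernel m z y) \<partial>\<mu>) \<partial>W) = (SUP m. \<integral>\<^sup>+z. (\<integral>\<^sup>+y. ennreal (excess_kernel m z y) \<partial>\<mu>) \<partial>W)"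
    using meas by (intro nn_integral_monotone_convergence_SUP)
      (auto simp: incseq_def le_fun_def intro!: nn_integral_mono ennreal_leI excess_kernel_mono)
  also have "\<dots> \<le> ennreal E" using excess_limit_le(1)[OF assms] by (intro SUP_least)
  also have "\<dots> < \<infinity>" by simp
  finally have "AE z in W. (SUP m. \<integral>\<^sup>+y. ennreal (excess_kernel m z y) \<partial>\<mu>) \<noteq> \<infinity>"
    using meas by (intro nn_integral_PInf_AE) auto
  then show ?thesis using AE_W_\<Omega>
  proof eventually_elim
    case (elim z)
    obtain x P where z: "z = (x, P)" by (cases z)
    have "ennreal (height_kernel z y) \<le> ennreal 4 * (SUP m. ennreal (excess_kernel m z y))" for y
    proof (cases "y \<in> ball x (1 / 4) \<inter> \<Omega> - {x}")
      case True
      define s where "s = dist x y"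
      have s: "0 < s" "s \<le> 1 / 4" using True by (auto simp: s_def)
      obtain m1 where m1: "\<And>m. m \<ge> m1 \<Longrightarrow> cutoff \<Omega> m x = 1" using cutoff_eventually_1[OF open_\<Omega>, of x] elim z by auto
      obtain m2 where m2: "\<And>m. m \<ge> m2 \<Longrightarrow> cutoff \<Omega> m y = 1" using cutoff_eventually_1[OF open_\<Omega>, of y] True by auto
      obtain m3 where m3: "\<And>m. m \<ge> m3 \<Longrightarrow> 1 / (4 * s ^ (d + 2)) \<le> kernel_weight m s" using kernel_weight_eventually[OF s] by auto
      define m where "m = max m1 (max m2 m3)"
      define v where "v = (norm ((y - x) - orth_proj P (y - x)))\<^sup>2"
      have "height_kernel z y = 4 * (1 / (4 * s ^ (d + 2)) * v)"
        using True unfolding height_kernel_def z s_def[symmetric] v_def by (simp add: s_def)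
      also have "\<dots> \<le> 4 * (kernel_weight m s * v)"
        using m3[of m] by (intro mult_left_mono mult_right_mono) (auto simp: m_def v_def)
      also have "\<dots> = 4 * excess_kernel m z y"
        unfolding excess_kernel_def z using m1[of m] m2[of m] by (simp add: m_def s_def v_def)
      finally have "ennreal (height_kernel z y) \<le> ennreal (4 * excess_kernel m z y)" by (rule ennreal_leI)
      also have "\<dots> = ennreal 4 * ennreal (excess_kernel m z y)" by (rule ennreal_mult') simp
      also have "\<dots> \<le> ennreal 4 * (SUP m. ennreal (excess_kernel m z y))" by (intro mult_left_mono SUP_upper) auto
      finally show ?thesis .
    next
      case False
      then show ?thesis by (simp add: height_kernel_def z)
    qed
    then have "(\<integral>\<^sup>+y. ennreal (height_kernel z y) \<partial>\<mu>) \<le> (\<integral>\<^sup>+y. ennreal 4 * (SUP m. ennreal (excess_kernel m z y)) \<partial>\<mu>)"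
      by (intro nn_integral_mono)
    also have "\<dots> = ennreal 4 * (\<integral>\<^sup>+y. (SUP m. ennreal (excess_kernel m z y)) \<partial>\<mu>)"
      using excess_kernel_measurable by (intro nn_integral_cmult) (auto simp: measurable_cong_sets[OF sets_\<mu> refl])
    also have "(\<integral>\<^sup>+y. (SUP m. ennreal (excess_kernel m z y)) \<partial>\<mu>) = (SUP m. \<integral>\<^sup>+y. ennreal (excess_kernel m z y) \<partial>\<mu>)"
      using excess_kernel_measurable by (intro nn_integral_monotone_convergence_SUP)
        (auto simp: incseq_def le_fun_def measurable_cong_sets[OF sets_\<mu> refl] intro!: ennreal_leI excess_kernel_mono)
    also have "ennreal 4 * \<dots> < \<infinity>" using elim(1) by (simp only: ennreal_mult_less_top top.not_eq_extremum infinity_ennreal_def) auto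
    finally show ?case .
  qed
qed

text \<open>
  \<open>P\<close> is a tangent plane of the support at \<open>x\<close> in the strongest sense: all nearby points of the support, not just
  most of the mass, lie in thin cones about \<open>P\<close>.
\<close>

definition tangent_cone :: "'a \<Rightarrow> 'a linear_subspace \<Rightarrow> bool" where
  "tangent_cone x P \<longleftrightarrow> (\<forall>\<epsilon>>0. \<exists>\<rho>>0. \<forall>y\<in>supp. dist x y < \<rho> \<longrightarrow> norm ((y - x) - orth_proj P (y - x)) \<le> \<epsilon> * dist x y)"

lemma height_kernel_measurable: "height_kernel z \<in> borel_measurable borel"
proof -
  have *: "(\<lambda>y. (norm ((y - fst z) - orth_proj (snd z) (y - fst z)))\<^sup>2) \<in> borel_measurable borel"
    by (intro borel_measurable_continuous_onI continuous_intros)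
  have **: "(\<lambda>y. dist (fst z) y ^ (d + 2)) \<in> borel_measurable borel"
    by (intro borel_measurable_continuous_onI continuous_intros)
  show ?thesis
    unfolding height_kernel_def using open_\<Omega> by (intro borel_measurable_times borel_measurable_divide * ** borel_measurable_indicator) auto
qed

text \<open>
  Let \<open>y\<close> be a point of the support at distance \<open>s\<close> from \<open>x\<close> and at distance more than \<open>\<epsilon>s\<close> from \<open>x + P\<close>. On the ball of
  radius \<open>\<epsilon>s/4\<close> about \<open>y\<close> the kernel is at least a constant times \<open>s\<^sup>2 / s\<^bsup>d+2\<^esup>\<close>, and the mass of the ball is at
  least a constant times \<open>s\<^sup>d\<close>. The product does not depend on \<open>s\<close>, whereas the integral over a ball about \<open>x\<close>
  tends to 0 with its radius.
\<close>

lemma tangent_cone_of_height_kernel: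
  assumes c: "0 < c" and low: "\<And>y r. y \<in> supp \<Longrightarrow> 0 < r \<Longrightarrow> cball y (8 * r) \<subseteq> \<Omega> \<Longrightarrow> c * r ^ d \<le> measure \<mu> (cball y r)"
    and x: "x \<in> \<Omega>" and fin: "(\<integral>\<^sup>+y. ennreal (height_kernel (x, P) y) \<partial>\<mu>) < \<infinity>"
  shows "tangent_cone x P"
proof (rule ccontr)
  assume "\<not> tangent_cone x P"
  then obtain e0 where e0: "e0 > 0" "\<And>\<rho>. \<rho> > 0 \<Longrightarrow> \<exists>y\<in>supp. dist x y < \<rho> \<and> e0 * dist x y < norm ((y - x) - orth_proj P (y - x))"
    unfolding tangent_cone_def by (meson not_le)
  define e where "e = min e0 1"
  have e: "0 < e" "e \<le> 1" using e0 by (auto simp: e_def)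
  define \<kappa> where "\<kappa> = (9 / 16) * e\<^sup>2 * (4 / 5) ^ (d + 2) * c * (e / 4) ^ d"
  have \<kappa>: "0 < \<kappa>" using e c by (simp add: \<kappa>_def)
  define k where "k = height_kernel (x, P)"
  have km: "(\<lambda>y. ennreal (k y)) \<in> borel_measurable \<mu>"
    using height_kernel_measurable unfolding k_def by (auto simp: measurable_cong_sets[OF sets_\<mu> refl])
  define N where "N = density \<mu> (\<lambda>y. ennreal (k y))"
  have sN: "sets N = sets borel" "space N = UNIV" by (simp_all add: N_def)
  have N: "emeasure N A = (\<integral>\<^sup>+y. ennreal (k y) * indicator A y \<partial>\<mu>)" if "A \<in> sets borel" for A
    unfolding N_def using km that by (intro emeasure_density) auto
  have Nfin: "emeasure N UNIV \<noteq> \<infinity>" using fin by (simp add: N k_def)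
  \<comment> \<open>The kernel is defined to vanish at x, so the point x itself carries no mass of the density N.\<close>
  have "(\<lambda>n. emeasure N (ball x (1 / Suc n))) \<longlonglongrightarrow> emeasure N (\<Inter>n. ball x (1 / Suc n))"
  proof (rule Lim_emeasure_decseq)
    show "range (\<lambda>n. ball x (1 / Suc n)) \<subseteq> sets N" by (auto simp: sN)
    show "decseq (\<lambda>n. ball x (1 / Suc n))"
      unfolding decseq_def by (intro allI impI subset_ball) (simp add: frac_le)
    show "emeasure N (ball x (1 / Suc n)) \<noteq> \<infinity>" for n
      using Nfin emeasure_mono[of "ball x (1 / Suc n)" UNIV N] by (auto simp: sN top_unique)
  qed
  moreover have "(\<Inter>n. ball x (1 / Suc n)) = {x}"
  proof (intro equalityI subsetI)
    fix y assume y: "y \<in> (\<Inter>n. ball x (1 / Suc n))"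
    show "y \<in> {x}"
    proof (rule ccontr)
      assume "y \<notin> {x}"
      then have "0 < dist x y" by simp
      then obtain n where "1 / Suc n < dist x y" using nat_approx_posE by metis
      moreover have "y \<in> ball x (1 / Suc n)" using y by blast
      ultimately show False by simp
    qed
  qed auto
  moreover have "emeasure N {x} = 0"
  proof -
    have "emeasure N {x} = (\<integral>\<^sup>+y. 0 \<partial>\<mu>)"
      unfolding N[OF borel_closed[OF closed_singleton]] by (intro nn_integral_cong) (auto simp: k_def height_kernel_def indicator_def)
    then show ?thesis by simp
  qed
  ultimately have "(\<lambda>n. emeasure N (ball x (1 / Suc n))) \<longlonglongrightarrow> 0" by simp
  then have "eventually (\<lambda>n. emeasure N (ball x (1 / Suc n)) < ennreal \<kappa>) sequentially"
    using \<kappa> by (intro order_tendstoD(2)) auto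
  then obtain n where n: "emeasure N (ball x (1 / Suc n)) < ennreal \<kappa>" by (auto simp: eventually_sequentially)
  obtain R where R: "R > 0" "ball x R \<subseteq> \<Omega>" using open_\<Omega> x by (meson openE)
  define t where "t = 1 / real (Suc n)"
  have t: "0 < t" by (simp add: t_def)
  define \<rho> where "\<rho> = min (t / 2) (min (1 / 8) (R / 4))"
  have \<rho>: "0 < \<rho>" "\<rho> \<le> t / 2" "\<rho> \<le> 1 / 8" "\<rho> \<le> R / 4" using R t by (auto simp: \<rho>_def)
  obtain y where y: "y \<in> supp" "dist x y < \<rho>" "e0 * dist x y < norm ((y - x) - orth_proj P (y - x))"
    using e0(2)[OF \<rho>(1)] by blast
  define s where "s = dist x y"
  have ys: "e * s < norm ((y - x) - orth_proj P (y - x))"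
    using y(3) mult_right_mono[of e e0 s] by (simp add: s_def e_def)
  have s: "0 < s"
  proof -
    have "s \<noteq> 0"
    proof
      assume "s = 0"
      then have "x = y" by (simp add: s_def)
      then show False using ys by (simp add: s_def linear_0[OF linear_orth_proj])
    qed
    then show ?thesis by (simp add: s_def)
  qed
  have s\<rho>: "s < \<rho>" using y by (simp add: s_def)
  have es: "e * s \<le> s" using e s by (simp add: mult_le_cancel_right1)
  define b where "b = cball y (e * s / 4)"
  have dw: "3 / 4 * s \<le> dist x w" "dist x w \<le> 5 / 4 * s" if "w \<in> b" for w
    using that es dist_triangle[of x w y] dist_triangle[of x y w] unfolding b_def s_def[symmetric] by (auto simp: s_def dist_commute)
  have hw: "3 / 4 * (e * s) \<le> norm ((w - x) - orth_proj P (w - x))" if "w \<in> b" for w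
  proof -
    have "norm ((y - x) - orth_proj P (y - x)) = norm (((w - x) - orth_proj P (w - x)) + ((y - w) - orth_proj P (y - w)))"
      by (simp add: orth_proj_diff algebra_simps)
    also have "\<dots> \<le> norm ((w - x) - orth_proj P (w - x)) + norm ((y - w) - orth_proj P (y - w))" by (rule norm_triangle_ineq)
    also have "norm ((y - w) - orth_proj P (y - w)) \<le> norm (y - w)"
    proof (rule power2_le_imp_le)
      show "(norm ((y - w) - orth_proj P (y - w)))\<^sup>2 \<le> (norm (y - w))\<^sup>2" using orth_proj_pythagoras[of "y - w" P] by simp
    qed simp
    also have "norm (y - w) \<le> e * s / 4" using that by (simp add: b_def dist_norm)
    finally show ?thesis using ys by simp
  qed
  have b\<Omega>: "b \<subseteq> \<Omega>" "cball y (8 * (e * s / 4)) \<subseteq> \<Omega>"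
  proof -
    have "cball y (8 * (e * s / 4)) \<subseteq> ball x R"
    proof
      fix w assume "w \<in> cball y (8 * (e * s / 4))"
      then have "dist x w \<le> s + 2 * s" using dist_triangle[of x w y] es by (simp add: s_def)
      also have "\<dots> < R" using s\<rho> \<rho>(4) R by linarith
      finally show "w \<in> ball x R" by simp
    qed
    then show "cball y (8 * (e * s / 4)) \<subseteq> \<Omega>" using R(2) by blast
    moreover have "b \<subseteq> cball y (8 * (e * s / 4))" unfolding b_def using e s by (intro subset_cball) auto
    ultimately show "b \<subseteq> \<Omega>" by blast
  qed
  \<comment> \<open>A lower bound for the kernel on b: the normal component is at least 3es/4 and the distance to x at most 5s/4.\<close>
  define q where "q = (3 / 4 * (e * s))\<^sup>2 / (5 / 4 * s) ^ (d + 2)"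
  have kq: "q \<le> k w" if w: "w \<in> b" for w
  proof -
    have "dist x w < 1 / 4" using dw(2)[OF w] s\<rho> \<rho>(3) s by linarith
    moreover have "0 < dist x w" using dw(1)[OF w] s by linarith
    moreover have "w \<in> \<Omega>" using b\<Omega>(1) w by blast
    ultimately have kw: "k w = (norm ((w - x) - orth_proj P (w - x)))\<^sup>2 / dist x w ^ (d + 2)"
      by (simp add: k_def height_kernel_def)
    show ?thesis unfolding q_def kw
      using dw[OF w] hw[OF w] s e \<open>0 < dist x w\<close> by (intro frac_le power_mono) auto
  qed
  have q0: "0 \<le> q" using s e by (simp add: q_def)
  have "\<kappa> = q * (c * (e * s / 4) ^ d)"
  proof -
    have "q * (c * (e * s / 4) ^ d) = (9 / 16) * e\<^sup>2 * s\<^sup>2 / ((5 / 4) ^ (d + 2) * s ^ (d + 2)) * (c * ((e / 4) ^ d * s ^ d))"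
      by (simp add: q_def power_mult_distrib power_divide)
    also have "s ^ (d + 2) = s ^ d * s\<^sup>2" by (rule power_add)
    also have "(9 / 16) * e\<^sup>2 * s\<^sup>2 / ((5 / 4) ^ (d + 2) * (s ^ d * s\<^sup>2)) * (c * ((e / 4) ^ d * s ^ d)) = (9 / 16) * e\<^sup>2 / (5 / 4) ^ (d + 2) * (c * (e / 4) ^ d)"
    proof -
      have "A * t / (B * (u * t)) * (c * (D * u)) = A / B * (c * D)" if "t \<noteq> 0" "u \<noteq> 0" for A B D t u :: real
        using that by (simp add: field_simps)
      note cancel = this
      show ?thesis by (rule cancel) (use s in simp_all)
    qed
    also have "\<dots> = \<kappa>" by (simp add: \<kappa>_def power_divide)
    finally show ?thesis by simp
  qed
  also have "\<dots> \<le> q * measure \<mu> b"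
    unfolding b_def using low[OF y(1) _ b\<Omega>(2)] e s q0 by (intro mult_left_mono) auto
  finally have "ennreal \<kappa> \<le> ennreal (q * measure \<mu> b)" by (rule ennreal_leI)
  also have "\<dots> = ennreal q * emeasure \<mu> b"
    using q0 finite_measure.emeasure_eq_measure[OF finite_\<mu>] by (simp add: ennreal_mult)
  also have "\<dots> = (\<integral>\<^sup>+w. ennreal q * indicator b w \<partial>\<mu>)"
    by (rule nn_integral_cmult_indicator[symmetric]) (simp add: b_def)
  also have "\<dots> \<le> (\<integral>\<^sup>+w. ennreal (k w) * indicator b w \<partial>\<mu>)"
    using kq by (intro nn_integral_mono) (auto simp: indicator_def intro: ennreal_leI)
  also have "\<dots> = emeasure N b" by (rule N[symmetric]) (simp add: b_def)
  also have "\<dots> \<le> emeasure N (ball x (1 / Suc n))"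
  proof (rule emeasure_mono)
    show "b \<subseteq> ball x (1 / Suc n)"
    proof
      fix w assume "w \<in> b"
      then have "dist x w \<le> 5 / 4 * s" by (rule dw(2))
      also have "\<dots> < t" using s\<rho> \<rho>(2) s by linarith
      finally show "w \<in> ball x (1 / Suc n)" unfolding t_def by simp
    qed
  qed (simp add: sN)
  finally show False using n by simp
qed

end

section \<open>Nearly flat sets\<close>

lemma nn_integral_le_of_measure_le:
  assumes sets: "sets M = sets N" and le: "\<And>A. A \<in> sets M \<Longrightarrow> emeasure M A \<le> c * emeasure N A"
  shows "(\<integral>\<^sup>+x. f x \<partial>M) \<le> c * (\<integral>\<^sup>+x. f x \<partial>N)"
proof -
  have sp: "space M = space N" using sets by (rule sets_eq_imp_space_eq)
  show ?thesis
    unfolding nn_integral_def[of M]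
  proof (rule SUP_least)
    fix g assume "g \<in> {g. simple_function M g \<and> g \<le> f}"
    then have g: "simple_function M g" "g \<le> f" by auto
    then have gN: "simple_function N g" by (simp add: simple_function_def sets sp)
    have "integral\<^sup>S M g = (\<Sum>x\<in>g ` space M. x * emeasure M (g -` {x} \<inter> space M))" by (simp add: simple_integral_def)
    also have "\<dots> \<le> (\<Sum>x\<in>g ` space M. x * (c * emeasure N (g -` {x} \<inter> space M)))"
    proof (rule sum_mono)
      fix x assume "x \<in> g ` space M"
      have "g -` {x} \<inter> space M \<in> sets M" using g(1) by (rule simple_functionD)
      then show "x * emeasure M (g -` {x} \<inter> space M) \<le> x * (c * emeasure N (g -` {x} \<inter> space M))"
        by (intro mult_left_mono le) auto
    qed
    also have "\<dots> = c * integral\<^sup>S N g"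
      by (simp add: simple_integral_def sp sum_distrib_left mult.left_commute)
    also have "\<dots> = c * integral\<^sup>N N g" using nn_integral_eq_simple_integral[OF gN] by simp
    also have "\<dots> \<le> c * integral\<^sup>N N f" using g(2) by (intro mult_left_mono nn_integral_mono) (auto simp: le_fun_def)
    finally show "integral\<^sup>S M g \<le> c * integral\<^sup>N N f" .
  qed
qed

lemma integrable_bounded_support:
  fixes f :: "'a::euclidean_space \<Rightarrow> real"
  assumes f: "f \<in> borel_measurable borel" and M: "sets M = sets borel"
    and C: "C \<in> sets borel" "emeasure M C < \<infinity>" and B: "\<And>x. \<bar>f x\<bar> \<le> B" and 0: "\<And>x. x \<notin> C \<Longrightarrow> f x = 0"
  shows "integrable M f"
proof -
  have "integrable M (\<lambda>x. indicator C x *\<^sub>R f x)"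
    by (rule integrableI_bounded_set_indicator[where B = B])
      (use assms in \<open>auto simp: measurable_cong_sets[OF M refl]\<close>)
  moreover have "(\<lambda>x. indicator C x *\<^sub>R f x) = f" using 0 by (auto simp: indicator_def fun_eq_iff)
  ultimately show ?thesis by (simp only:)
qed

lemma integral_le_bounded_support:
  fixes f :: "'a::euclidean_space \<Rightarrow> real"
  assumes f: "f \<in> borel_measurable borel" and M: "sets M = sets borel"
    and C: "C \<in> sets borel" "emeasure M C < \<infinity>" and B: "\<And>x. \<bar>f x\<bar> \<le> B" and 0: "\<And>x. x \<notin> C \<Longrightarrow> f x = 0"
  shows "\<bar>\<integral>x. f x \<partial>M\<bar> \<le> B * measure M C"
proof -
  have int: "integrable M f" by (rule integrable_bounded_support[OF assms])
  have ic: "integrable M (\<lambda>x. B * indicat_real C x)"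
    using C M by (intro integrable_mult_right integrable_real_indicator) auto
  have "\<bar>\<integral>x. f x \<partial>M\<bar> \<le> (\<integral>x. \<bar>f x\<bar> \<partial>M)" by (rule integral_abs_bound)
  also have "\<dots> \<le> (\<integral>x. B * indicat_real C x \<partial>M)"
    using int ic B 0 by (intro integral_mono integrable_abs) (auto simp: indicator_def)
  also have "\<dots> = B * measure M C" using C M by simp
  finally show ?thesis .
qed

lemma hausdorff_on_AE_mem:
  assumes "1 \<le> d" "A \<in> sets borel"
  shows "AE x in hausdorff_on d A. x \<in> A"
proof (rule AE_I[of _ _ "- A"])
  show "emeasure (hausdorff_on d A) (- A) = 0"
    using assms by (simp add: emeasure_hausdorff_on borel_comp hausdorff_outer_empty)
qed (use assms in auto)

text \<open>
  Seen from any of its points, \<open>A\<close> lies in the cone of aperture \<open>\<eta>\<close> about \<open>Q\<close>. For \<open>\<eta> < 1\<close> the projection onto \<open>Q\<close> is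
  then injective on \<open>A\<close> with Lipschitz inverse.
\<close>

definition nearly_flat :: "real \<Rightarrow> 'a::euclidean_space linear_subspace \<Rightarrow> 'a set \<Rightarrow> bool" where
  "nearly_flat \<eta> Q A \<longleftrightarrow> (\<forall>y\<in>A. \<forall>z\<in>A. norm ((z - y) - orth_proj Q (z - y)) \<le> \<eta> * norm (z - y))"

lemma nearly_flat_expand:
  assumes "nearly_flat \<eta> Q A" "y \<in> A" "z \<in> A" "\<eta> < 1"
  shows "dist z y \<le> 1 / (1 - \<eta>) * dist (orth_proj Q z) (orth_proj Q y)"
proof -
  have "norm (z - y) \<le> norm ((z - y) - orth_proj Q (z - y)) + norm (orth_proj Q (z - y))"
    by (metis add.commute norm_triangle_sub)
  also have "norm ((z - y) - orth_proj Q (z - y)) \<le> \<eta> * norm (z - y)" using assms by (auto simp: nearly_flat_def)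
  finally have "(1 - \<eta>) * norm (z - y) \<le> norm (orth_proj Q (z - y))" by (simp add: algebra_simps)
  then have "norm (z - y) \<le> norm (orth_proj Q (z - y)) / (1 - \<eta>)"
    using assms(4) by (simp add: pos_le_divide_eq mult.commute)
  then show ?thesis by (simp add: dist_norm orth_proj_diff)
qed

lemma nearly_flat_inverse:
  assumes "nearly_flat \<eta> Q A" "\<eta> < 1"
  obtains g where "\<And>y. y \<in> A \<Longrightarrow> g (orth_proj Q y) = y"
    "\<And>u v. u \<in> orth_proj Q ` A \<Longrightarrow> v \<in> orth_proj Q ` A \<Longrightarrow> dist (g u) (g v) \<le> 1 / (1 - \<eta>) * dist u v"
proof -
  define g where "g u = (SOME y. y \<in> A \<and> orth_proj Q y = u)" for u
  have g: "g (orth_proj Q y) = y" if y: "y \<in> A" for y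
  proof -
    have "\<exists>z. z \<in> A \<and> orth_proj Q z = orth_proj Q y" using y by blast
    then have "g (orth_proj Q y) \<in> A \<and> orth_proj Q (g (orth_proj Q y)) = orth_proj Q y"
      unfolding g_def by (rule someI_ex)
    then show ?thesis using nearly_flat_expand[OF assms(1) y, of "g (orth_proj Q y)"] assms(2) by simp
  qed
  moreover have "dist (g u) (g v) \<le> 1 / (1 - \<eta>) * dist u v" if "u \<in> orth_proj Q ` A" "v \<in> orth_proj Q ` A" for u v
    using that g nearly_flat_expand[OF assms(1) _ _ assms(2)] by auto
  ultimately show ?thesis using that by blast
qed

lemma dist_orth_proj_le: "dist (orth_proj Q x) (orth_proj Q y) \<le> dist x y"
  using norm_orth_proj_le[of Q "x - y"] by (simp add: dist_norm orth_proj_diff)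

lemma hausdorff_outer_orth_proj_le:
  assumes "1 \<le> d" shows "hausdorff_outer d (orth_proj Q ` A) \<le> hausdorff_outer d A"
  using hausdorff_outer_Lipschitz_image[OF assms, of 1 A "orth_proj Q"] by (simp add: dist_orth_proj_le)

lemma hausdorff_outer_nearly_flat_le:
  assumes d: "1 \<le> d" and flat: "nearly_flat \<eta> Q A" "\<eta> < 1" and B: "B \<subseteq> A"
  shows "hausdorff_outer d B \<le> ennreal ((1 / (1 - \<eta>)) ^ d) * hausdorff_outer d (orth_proj Q ` B)"
proof -
  obtain g where g: "\<And>y. y \<in> A \<Longrightarrow> g (orth_proj Q y) = y"
    "\<And>u v. u \<in> orth_proj Q ` A \<Longrightarrow> v \<in> orth_proj Q ` A \<Longrightarrow> dist (g u) (g v) \<le> 1 / (1 - \<eta>) * dist u v"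
    using nearly_flat_inverse[OF flat] by blast
  have "B = g ` orth_proj Q ` B" using g(1) B by (force simp: image_image)
  moreover have "hausdorff_outer d (g ` orth_proj Q ` B) \<le> ennreal ((1 / (1 - \<eta>)) ^ d) * hausdorff_outer d (orth_proj Q ` B)"
    using flat(2) g(2) B by (intro hausdorff_outer_Lipschitz_image d) auto
  ultimately show ?thesis by simp
qed

lemma orth_proj_measurable: "orth_proj Q \<in> borel_measurable borel"
  by (intro borel_measurable_continuous_onI continuous_intros)

text \<open>
  The integrals of a rescaled test function over a nearly flat set and over its projection differ in
  two ways: the function is evaluated at different points, which costs its modulus of continuity \<open>\<omega>\<close>, and the
  measures differ by a factor between 1 and \<open>(1 - \<eta>)\<^bsup>-d\<^esup>\<close>.
\<close>

lemma nearly_flat_integral_compare: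
  fixes A :: "'a::euclidean_space set" and \<phi> :: "'a \<Rightarrow> real"
  assumes d: "1 \<le> d" and flat: "nearly_flat \<eta> Q A" and \<eta>: "0 \<le> \<eta>" "\<eta> \<le> 1 / 2" and A: "closed A" "x \<in> A"
    and \<phi>: "continuous_on UNIV \<phi>" "\<And>z. 0 \<le> \<phi> z" "\<And>z. \<phi> z \<le> B" "\<And>z. R \<le> norm z \<Longrightarrow> \<phi> z = 0"
    and \<omega>: "\<And>z w. dist z w \<le> 2 * \<eta> * R \<Longrightarrow> \<bar>\<phi> z - \<phi> w\<bar> \<le> \<omega>" and R: "0 < R" and r: "0 < r"
    and fin: "\<And>C. bounded C \<Longrightarrow> hausdorff_outer d (A \<inter> C) < \<infinity>"
  shows "\<bar>(\<integral>y. \<phi> ((1 / r) *\<^sub>R (y - x)) \<partial>hausdorff_on d A)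
      - (\<integral>u. \<phi> ((1 / r) *\<^sub>R (u - orth_proj Q x)) \<partial>hausdorff_on d (orth_proj Q ` A))\<bar>
    \<le> \<omega> * measure (hausdorff_on d A) (cball x (2 * R * r))
      + ((1 / (1 - \<eta>)) ^ d - 1) * (B * measure (hausdorff_on d (orth_proj Q ` A)) (cball (orth_proj Q x) (R * r)))"
proof -
  define H where "H = hausdorff_on d A"
  define G where "G = hausdorff_on d (orth_proj Q ` A)"
  \<comment> \<open>The measure D lies between G and L G, because the projection contracts and its inverse on A is Lipschitz.\<close>
  define D where "D = distr H borel (orth_proj Q)"
  define L where "L = (1 / (1 - \<eta>)) ^ d"
  have L: "1 \<le> L" unfolding L_def using \<eta> by (intro one_le_power) auto
  have sets [simp]: "sets H = sets borel" "sets G = sets borel" "sets D = sets borel"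
    by (simp_all add: H_def G_def D_def)
  have pm: "orth_proj Q \<in> measurable H borel" using orth_proj_measurable by (simp add: H_def measurable_cong_sets[OF sets_hausdorff_on refl])
  have D: "emeasure D C = hausdorff_outer d (orth_proj Q -` C \<inter> A)" if C: "C \<in> sets borel" for C
  proof -
    have "orth_proj Q -` C \<in> sets borel" using measurable_sets[OF orth_proj_measurable C] by simp
    then show ?thesis unfolding D_def using pm C by (simp add: emeasure_distr H_def emeasure_hausdorff_on[OF d])
  qed
  have G: "emeasure G C = hausdorff_outer d (orth_proj Q ` (orth_proj Q -` C \<inter> A))" if C: "C \<in> sets borel" for C
  proof -
    have "C \<inter> orth_proj Q ` A = orth_proj Q ` (orth_proj Q -` C \<inter> A)" by blast
    then show ?thesis unfolding G_def using C by (simp add: emeasure_hausdorff_on[OF d])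
  qed
  have GD: "emeasure G C \<le> 1 * emeasure D C" if "C \<in> sets G" for C
    using that hausdorff_outer_orth_proj_le[OF d] by (simp add: D G)
  have DG: "emeasure D C \<le> ennreal L * emeasure G C" if "C \<in> sets D" for C
    using that hausdorff_outer_nearly_flat_le[OF d flat, of "orth_proj Q -` C \<inter> A"] \<eta> by (simp add: D G L_def)
  have Hfin: "emeasure H (cball y s) < \<infinity>" for y s
    using fin[of "cball y s"] by (simp add: H_def emeasure_hausdorff_on[OF d] Int_commute)
  have Dfin: "emeasure D (cball (orth_proj Q x) s) < \<infinity>" for s
  proof -
    have "orth_proj Q -` cball (orth_proj Q x) s \<inter> A \<subseteq> A \<inter> cball x (1 / (1 - \<eta>) * s)"
    proof
      fix y assume y: "y \<in> orth_proj Q -` cball (orth_proj Q x) s \<inter> A"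
      then have "dist x y \<le> 1 / (1 - \<eta>) * dist (orth_proj Q x) (orth_proj Q y)"
        using \<eta> by (intro nearly_flat_expand[OF flat _ A(2)]) auto
      also have "\<dots> \<le> 1 / (1 - \<eta>) * s" using y \<eta> by (intro mult_left_mono) auto
      finally show "y \<in> A \<inter> cball x (1 / (1 - \<eta>) * s)" using y by simp
    qed
    then have "hausdorff_outer d (orth_proj Q -` cball (orth_proj Q x) s \<inter> A) \<le> hausdorff_outer d (A \<inter> cball x (1 / (1 - \<eta>) * s))"
      by (rule hausdorff_outer_mono)
    also have "\<dots> < \<infinity>" by (rule fin) simp
    finally show ?thesis by (simp add: D)
  qed
  have Gfin: "emeasure G (cball (orth_proj Q x) s) < \<infinity>" for s
    using GD[of "cball (orth_proj Q x) s"] Dfin[of s] by simp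
  define \<psi> where "\<psi> u = \<phi> ((1 / r) *\<^sub>R (u - orth_proj Q x))" for u
  have \<psi>c: "continuous_on UNIV \<psi>" unfolding \<psi>_def by (rule continuous_on_compose2[OF \<phi>(1)]) (auto intro!: continuous_intros)
  then have \<psi>m: "\<psi> \<in> borel_measurable borel" by (rule borel_measurable_continuous_onI)
  have \<psi>: "0 \<le> \<psi> u" "\<bar>\<psi> u\<bar> \<le> B" for u using \<phi>(2,3) by (auto simp: \<psi>_def)
  have \<psi>0: "\<psi> u = 0" if "u \<notin> cball (orth_proj Q x) (R * r)" for u
  proof -
    have "R * r < norm (u - orth_proj Q x)" using that by (simp add: dist_norm norm_minus_commute)
    then have "R \<le> norm ((1 / r) *\<^sub>R (u - orth_proj Q x))" using r by (simp add: pos_le_divide_eq)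
    then show ?thesis unfolding \<psi>_def by (rule \<phi>(4))
  qed
  define I1 where "I1 = (\<integral>y. \<phi> ((1 / r) *\<^sub>R (y - x)) \<partial>H)"
  define I2 where "I2 = (\<integral>y. \<psi> (orth_proj Q y) \<partial>H)"
  define I3 where "I3 = (\<integral>u. \<psi> u \<partial>G)"
  have I2D: "I2 = (\<integral>u. \<psi> u \<partial>D)" unfolding I2_def D_def using pm \<psi>m by (simp add: integral_distr)
  have intG: "integrable G \<psi>" and intD: "integrable D \<psi>"
    using Gfin Dfin \<psi> \<psi>0 by (auto intro!: integrable_bounded_support[OF \<psi>m, where C = "cball (orth_proj Q x) (R * r)" and B = B])
  have nnG: "(\<integral>\<^sup>+u. ennreal (\<psi> u) \<partial>G) = ennreal I3" and nnD: "(\<integral>\<^sup>+u. ennreal (\<psi> u) \<partial>D) = ennreal I2"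
    unfolding I3_def I2D using intG intD \<psi>(1) by (auto intro!: nn_integral_eq_integral)
  have I30: "0 \<le> I3" and I20: "0 \<le> I2" unfolding I3_def I2D using \<psi>(1) by (auto intro!: integral_nonneg_AE)
  have "ennreal I3 \<le> ennreal I2"
    using nn_integral_le_of_measure_le[of G D 1 "\<lambda>u. ennreal (\<psi> u)"] GD by (simp add: nnG nnD)
  then have 32: "I3 \<le> I2" using I20 by (simp add: ennreal_le_iff)
  have "ennreal I2 \<le> ennreal L * ennreal I3"
    using nn_integral_le_of_measure_le[of D G "ennreal L" "\<lambda>u. ennreal (\<psi> u)"] DG by (simp add: nnG nnD)
  then have "ennreal I2 \<le> ennreal (L * I3)" using L I30 by (simp add: ennreal_mult)
  then have 23: "I2 \<le> L * I3" using L I30 by (simp add: ennreal_le_iff)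
  have "\<bar>I3\<bar> \<le> B * measure G (cball (orth_proj Q x) (R * r))"
    unfolding I3_def using Gfin \<psi> \<psi>0 by (intro integral_le_bounded_support[OF \<psi>m]) auto
  then have "(L - 1) * I3 \<le> (L - 1) * (B * measure G (cball (orth_proj Q x) (R * r)))"
    using L by (intro mult_left_mono) auto
  then have S2: "\<bar>I2 - I3\<bar> \<le> (L - 1) * (B * measure G (cball (orth_proj Q x) (R * r)))"
    using 32 23 by (simp add: algebra_simps)
  define f where "f y = (\<phi> ((1 / r) *\<^sub>R (y - x)) - \<psi> (orth_proj Q y)) * indicat_real A y" for y
  have m1: "(\<lambda>y. \<phi> ((1 / r) *\<^sub>R (y - x))) \<in> borel_measurable borel"
    by (intro borel_measurable_continuous_onI continuous_on_compose2[OF \<phi>(1)]) (auto intro!: continuous_intros)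
  have m2: "(\<lambda>y. \<psi> (orth_proj Q y)) \<in> borel_measurable borel"
    by (intro measurable_compose[OF orth_proj_measurable \<psi>m])
  have fm: "f \<in> borel_measurable borel"
    unfolding f_def using A(1) m1 m2 by (intro borel_measurable_times borel_measurable_diff borel_measurable_indicator) auto
  have \<omega>0: "0 \<le> \<omega>" using \<omega>[of 0 0] \<eta> R by simp
  have key: "\<bar>f y\<bar> \<le> \<omega> \<and> (y \<notin> cball x (2 * R * r) \<longrightarrow> f y = 0)" for y
  proof (cases "y \<in> A")
    case False then show ?thesis using \<omega>0 by (simp add: f_def)
  next
    case True
    define v where "v = (1 / r) *\<^sub>R (y - x)"
    have pv: "(1 / r) *\<^sub>R (orth_proj Q y - orth_proj Q x) = orth_proj Q v"
      unfolding v_def linear_scale[OF linear_orth_proj] orth_proj_diff ..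
    have fv: "f y = \<phi> v - \<phi> (orth_proj Q v)" using True by (simp add: f_def \<psi>_def pv v_def)
    have nv: "norm v = dist x y / r" using r by (simp add: v_def dist_norm norm_minus_commute)
    have "norm ((y - x) - orth_proj Q (y - x)) \<le> \<eta> * norm (y - x)" using flat True A(2) by (auto simp: nearly_flat_def)
    moreover have "v - orth_proj Q v = (1 / r) *\<^sub>R ((y - x) - orth_proj Q (y - x))"
      unfolding v_def linear_scale[OF linear_orth_proj] by (simp only: scaleR_diff_right)
    ultimately have dv: "norm (v - orth_proj Q v) \<le> \<eta> * norm v"
      using r by (simp add: v_def divide_right_mono)
    have pge: "norm v \<le> 2 * norm (orth_proj Q v)"
    proof -
      have "norm v \<le> norm (v - orth_proj Q v) + norm (orth_proj Q v)" by (metis add.commute norm_triangle_sub)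
      moreover have "\<eta> * norm v \<le> 1 / 2 * norm v" using \<eta> by (intro mult_right_mono) auto
      ultimately show ?thesis using dv by linarith
    qed
    show ?thesis
    proof (cases "norm v < 2 * R")
      case True
      have "dist v (orth_proj Q v) \<le> \<eta> * norm v" using dv by (simp add: dist_norm)
      also have "\<dots> \<le> \<eta> * (2 * R)" using True \<eta> by (intro mult_left_mono) auto
      finally have "\<bar>\<phi> v - \<phi> (orth_proj Q v)\<bar> \<le> \<omega>" by (intro \<omega>) simp
      moreover have "y \<in> cball x (2 * R * r)" using True nv r by (simp add: pos_divide_less_eq)
      ultimately show ?thesis using fv by simp
    next
      case False
      then have "R \<le> norm (orth_proj Q v)" "R \<le> norm v" using pge R by auto
      then have "f y = 0" using \<phi>(4) fv by simp
      then show ?thesis using \<omega>0 by simp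
    qed
  qed
  have "\<bar>\<integral>y. f y \<partial>H\<bar> \<le> \<omega> * measure H (cball x (2 * R * r))"
    using key Hfin by (intro integral_le_bounded_support[OF fm]) auto
  moreover have "(\<integral>y. f y \<partial>H) = I1 - I2"
  proof -
    have i1: "integrable H (\<lambda>y. \<phi> ((1 / r) *\<^sub>R (y - x)))"
    proof (rule integrable_bounded_support[OF m1, where C = "cball x (R * r)" and B = B])
      fix y assume "y \<notin> cball x (R * r)"
      then have "R \<le> norm ((1 / r) *\<^sub>R (y - x))" using r by (simp add: pos_le_divide_eq dist_norm norm_minus_commute)
      then show "\<phi> ((1 / r) *\<^sub>R (y - x)) = 0" by (rule \<phi>(4))
    qed (use Hfin \<phi>(2,3) in auto)
    have "integrable (distr H borel (orth_proj Q)) \<psi>" using intD by (simp add: D_def)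
    then have i2: "integrable H (\<lambda>y. \<psi> (orth_proj Q y))" using pm \<psi>m by (simp add: integrable_distr_eq)
    have "(\<integral>y. f y \<partial>H) = (\<integral>y. \<phi> ((1 / r) *\<^sub>R (y - x)) - \<psi> (orth_proj Q y) \<partial>H)"
    proof (rule integral_cong_AE)
      have "AE y in H. y \<in> A" unfolding H_def using A(1) by (intro hausdorff_on_AE_mem d) auto
      then show "AE y in H. f y = \<phi> ((1 / r) *\<^sub>R (y - x)) - \<psi> (orth_proj Q y)"
        by eventually_elim (simp add: f_def)
    qed (use fm m1 m2 in \<open>simp_all add: measurable_cong_sets[OF sets(1) refl]\<close>)
    also have "\<dots> = I1 - I2" unfolding I1_def I2_def using i1 i2 by simp
    finally show ?thesis .
  qed
  ultimately have "\<bar>I1 - I3\<bar> \<le> \<omega> * measure H (cball x (2 * R * r)) + (L - 1) * (B * measure G (cball (orth_proj Q x) (R * r)))"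
    using S2 by linarith
  then show ?thesis unfolding I1_def I3_def \<psi>_def H_def G_def L_def .
qed

text \<open>
  Homotheties of the plane multiply \<open>\<H>\<^sup>d\<close> by \<open>r\<^sup>d\<close>; the map and its inverse are both Lipschitz with the optimal constant.
\<close>

lemma hausdorff_on_plane_scale:
  fixes Q :: "'a::euclidean_space linear_subspace"
  assumes d: "1 \<le> d" and v: "v \<in> points Q" and r: "0 < r"
  shows "distr (hausdorff_on d (points Q)) borel (\<lambda>u. (1 / r) *\<^sub>R (u - v)) = scale_measure (ennreal (r ^ d)) (hausdorff_on d (points Q))"
proof (rule measure_eqI)
  let ?f = "\<lambda>u. (1 / r) *\<^sub>R (u - v)" and ?g = "\<lambda>w. r *\<^sub>R w + v"
  have fm: "?f \<in> borel_measurable borel" by (intro borel_measurable_continuous_onI continuous_intros)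
  fix B assume "B \<in> sets (distr (hausdorff_on d (points Q)) borel ?f)"
  then have B: "B \<in> sets borel" by simp
  then have fB: "?f -` B \<in> sets borel" using measurable_sets[OF fm B] by simp
  have gf: "?g (?f u) = u" and fg: "?f (?g u) = u" for u using r by auto
  have fQ: "?f u \<in> points Q" if "u \<in> points Q" for u using that v by (intro subspace_scale subspace_diff) auto
  have gQ: "?g u \<in> points Q" if "u \<in> points Q" for u using that v by (intro subspace_scale subspace_add) auto
  have e1: "?f -` B \<inter> points Q = ?g ` (B \<inter> points Q)"
  proof (intro equalityI subsetI)
    fix u assume "u \<in> ?f -` B \<inter> points Q"
    then show "u \<in> ?g ` (B \<inter> points Q)" using gf[of u] fQ[of u] by (intro image_eqI[of _ _ "?f u"]) auto
  next
    fix u assume "u \<in> ?g ` (B \<inter> points Q)"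
    then obtain w where "w \<in> B \<inter> points Q" "u = ?g w" by blast
    then show "u \<in> ?f -` B \<inter> points Q" using fg[of w] gQ[of w] by simp
  qed
  have e2: "B \<inter> points Q = ?f ` (?f -` B \<inter> points Q)"
    unfolding e1 image_image using fg by simp
  have le: "hausdorff_outer d (?f -` B \<inter> points Q) \<le> ennreal (r ^ d) * hausdorff_outer d (B \<inter> points Q)"
    unfolding e1 using r by (intro hausdorff_outer_Lipschitz_image d) (auto simp: dist_norm simp flip: scaleR_diff_right)
  have "hausdorff_outer d (B \<inter> points Q) \<le> ennreal ((1 / r) ^ d) * hausdorff_outer d (?f -` B \<inter> points Q)"
    by (subst e2) (use r in \<open>auto intro!: hausdorff_outer_Lipschitz_image d simp: dist_norm simp flip: scaleR_diff_right\<close>)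
  then have "ennreal (r ^ d) * hausdorff_outer d (B \<inter> points Q) \<le> ennreal (r ^ d) * (ennreal ((1 / r) ^ d) * hausdorff_outer d (?f -` B \<inter> points Q))"
    by (intro mult_left_mono) auto
  also have "\<dots> = hausdorff_outer d (?f -` B \<inter> points Q)"
  proof -
    have "r ^ d * (1 / r) ^ d = 1" using r by (simp add: power_one_over)
    then have "ennreal (r ^ d) * ennreal ((1 / r) ^ d) = 1"
      using r by (simp add: ennreal_mult[symmetric])
    then show ?thesis by (simp add: mult.assoc[symmetric])
  qed
  finally have ge: "ennreal (r ^ d) * hausdorff_outer d (B \<inter> points Q) \<le> hausdorff_outer d (?f -` B \<inter> points Q)" .
  have fm': "?f \<in> measurable (hausdorff_on d (points Q)) borel" using fm by (simp add: measurable_cong_sets[OF sets_hausdorff_on refl])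
  have "emeasure (distr (hausdorff_on d (points Q)) borel ?f) B = hausdorff_outer d (?f -` B \<inter> points Q)"
    using B fB fm' by (simp add: emeasure_distr emeasure_hausdorff_on[OF d])
  also have "\<dots> = ennreal (r ^ d) * hausdorff_outer d (B \<inter> points Q)" using le ge by (rule antisym)
  finally show "emeasure (distr (hausdorff_on d (points Q)) borel ?f) B = emeasure (scale_measure (ennreal (r ^ d)) (hausdorff_on d (points Q))) B"
    using B by (simp add: emeasure_hausdorff_on[OF d])
qed simp

lemma integral_scale_measure_real:
  fixes f :: "'b \<Rightarrow> real"
  assumes "f \<in> borel_measurable M" "0 \<le> c"
  shows "(\<integral>x. f x \<partial>scale_measure (ennreal c) M) = c * (\<integral>x. f x \<partial>M)"
proof -
  have "scale_measure (ennreal c) M = density M (\<lambda>_. ennreal c)"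
    by (rule measure_eqI) (simp_all add: emeasure_density nn_integral_cmult_indicator)
  then show ?thesis using assms by (simp add: integral_density)
qed

lemma integral_plane_scale:
  fixes Q :: "'a::euclidean_space linear_subspace" and \<phi> :: "'a \<Rightarrow> real"
  assumes d: "1 \<le> d" and v: "v \<in> points Q" and r: "0 < r" and \<phi>: "\<phi> \<in> borel_measurable borel"
  shows "(\<integral>u. \<phi> ((1 / r) *\<^sub>R (u - v)) \<partial>hausdorff_on d (points Q)) = r ^ d * (\<integral>u. \<phi> u \<partial>hausdorff_on d (points Q))"
proof -
  have fm: "(\<lambda>u. (1 / r) *\<^sub>R (u - v)) \<in> measurable (hausdorff_on d (points Q)) borel"
    by (auto simp: measurable_cong_sets[OF sets_hausdorff_on refl] intro!: borel_measurable_continuous_onI continuous_intros)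
  have \<phi>': "\<phi> \<in> borel_measurable (hausdorff_on d (points Q))" using \<phi> by (simp add: measurable_cong_sets[OF sets_hausdorff_on refl])
  have "(\<integral>u. \<phi> ((1 / r) *\<^sub>R (u - v)) \<partial>hausdorff_on d (points Q)) = (\<integral>u. \<phi> u \<partial>distr (hausdorff_on d (points Q)) borel (\<lambda>u. (1 / r) *\<^sub>R (u - v)))"
    using fm \<phi> by (simp add: integral_distr)
  also have "\<dots> = r ^ d * (\<integral>u. \<phi> u \<partial>hausdorff_on d (points Q))"
    unfolding hausdorff_on_plane_scale[OF d v r] using \<phi>' r by (intro integral_scale_measure_real) auto
  finally show ?thesis .
qed

text \<open>
  An upper bound for \<open>\<H>\<^sup>d\<close> of the unit ball of any \<open>d\<close>-plane.
\<close>

definition plane_const :: "nat \<Rightarrow> real" where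
  "plane_const d = unit_ball_vol (real d) * real d ^ d"

lemma plane_const_nonneg: "0 \<le> plane_const d"
  by (simp add: plane_const_def)

lemma hausdorff_plane_cball:
  fixes Q :: "'a::euclidean_space linear_subspace"
  assumes d: "1 \<le> d" and Q: "Q \<in> grassmannian d" and v: "v \<in> points Q" and r: "0 < r"
  shows "hausdorff_outer d (points Q \<inter> cball v r) \<le> ennreal (plane_const d * r ^ d)"
proof -
  have "points Q \<inter> cball v r \<subseteq> (\<lambda>w. w + v) ` (points Q \<inter> cball 0 r)"
  proof
    fix u assume u: "u \<in> points Q \<inter> cball v r"
    then have "u - v \<in> points Q \<inter> cball 0 r" using v by (auto simp: dist_norm norm_minus_commute intro: subspace_diff)
    then show "u \<in> (\<lambda>w. w + v) ` (points Q \<inter> cball 0 r)" by (intro image_eqI[of _ _ "u - v"]) auto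
  qed
  then have "hausdorff_outer d (points Q \<inter> cball v r) \<le> hausdorff_outer d ((\<lambda>w. w + v) ` (points Q \<inter> cball 0 r))"
    by (rule hausdorff_outer_mono)
  also have "\<dots> \<le> ennreal (1 ^ d) * hausdorff_outer d (points Q \<inter> cball 0 r)"
    by (intro hausdorff_outer_Lipschitz_image d) auto
  also have "\<dots> \<le> ennreal (unit_ball_vol (real d) * (real d * r) ^ d)"
    using hausdorff_outer_subspace_ball[OF d Q r] by simp
  finally show ?thesis by (simp add: plane_const_def power_mult_distrib mult.assoc)
qed

lemma nearly_flat_plane:
  assumes "dist P Q \<le> \<eta>" shows "nearly_flat \<eta> Q (points P)"
  unfolding nearly_flat_def
proof (intro ballI)
  fix y z assume "y \<in> points P" "z \<in> points P"
  then have "orth_proj P (z - y) = z - y" by (intro orth_proj_fixed subspace_diff) auto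
  then have "norm ((z - y) - orth_proj Q (z - y)) \<le> dist P Q * norm (z - y)"
    using norm_orth_proj_dist[of P "z - y" Q] by simp
  also have "\<dots> \<le> \<eta> * norm (z - y)" using assms by (intro mult_right_mono) auto
  finally show "norm ((z - y) - orth_proj Q (z - y)) \<le> \<eta> * norm (z - y)" .
qed

lemma orth_proj_image_plane:
  assumes P: "P \<in> grassmannian d" and Q: "Q \<in> grassmannian d" and PQ: "dist P Q < 1"
  shows "orth_proj Q ` points P = points Q"
proof (rule subspace_dim_equal)
  have "inj_on (orth_proj Q) (points P)"
  proof (rule inj_onI)
    fix x y assume xy: "x \<in> points P" "y \<in> points P" "orth_proj Q x = orth_proj Q y"
    then show "x = y" using nearly_flat_expand[OF nearly_flat_plane[OF order_refl, of P Q] xy(2,1) PQ] by simp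
  qed
  then have "dim (orth_proj Q ` points P) = dim (points P)"
    by (intro dim_image_eq linear_orth_proj) (simp add: span_eq_iff[THEN iffD2])
  then show "dim (points Q) \<le> dim (orth_proj Q ` points P)" using P Q by (simp add: grassmannian_def)
qed (auto simp: orth_proj_in intro!: linear_subspace_image linear_orth_proj)

text \<open>
  A plane \<open>P\<close> near \<open>Q\<close> is itself a nearly flat set over \<open>Q\<close> whose projection is all of \<open>Q\<close>, so continuity of
  \<open>P \<mapsto> \<integral>\<^sub>P \<phi> d\<H>\<^sup>d\<close> is a case of the comparison for nearly flat sets.
\<close>

lemma plane_integral_close:
  fixes P Q :: "'a::euclidean_space linear_subspace" and \<phi> :: "'a \<Rightarrow> real"
  assumes d: "1 \<le> d" and P: "P \<in> grassmannian d" and Q: "Q \<in> grassmannian d" and PQ: "dist P Q \<le> \<eta>" and \<eta>: "\<eta> \<le> 1 / 2"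
    and \<phi>: "continuous_on UNIV \<phi>" "\<And>z. 0 \<le> \<phi> z" "\<And>z. \<phi> z \<le> B" "\<And>z. R \<le> norm z \<Longrightarrow> \<phi> z = 0"
    and \<omega>: "\<And>z w. dist z w \<le> 2 * \<eta> * R \<Longrightarrow> \<bar>\<phi> z - \<phi> w\<bar> \<le> \<omega>" and R: "0 < R"
  shows "\<bar>(\<integral>y. \<phi> y \<partial>hausdorff_on d (points P)) - (\<integral>y. \<phi> y \<partial>hausdorff_on d (points Q))\<bar>
    \<le> \<omega> * (plane_const d * (2 * R) ^ d) + ((1 / (1 - \<eta>)) ^ d - 1) * (B * (plane_const d * R ^ d))"
proof -
  have \<eta>0: "0 \<le> \<eta>" using PQ zero_le_dist[of P Q] by linarith
  have im: "orth_proj Q ` points P = points Q" using PQ \<eta> by (intro orth_proj_image_plane[OF P Q]) linarith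
  have z: "0 \<in> points P" "0 \<in> points Q" by (auto intro: subspace_0)
  have m: "measure (hausdorff_on d (points T)) (cball 0 s) \<le> plane_const d * s ^ d" if "T \<in> grassmannian d" "0 < s" for T :: "'a linear_subspace" and s
    unfolding measure_def using hausdorff_plane_cball[OF d that(1) _ that(2), of 0] that plane_const_nonneg[of d]
    by (intro enn2real_leI) (auto simp: emeasure_hausdorff_on[OF d] Int_commute subspace_0)
  have \<omega>0: "0 \<le> \<omega>" using \<omega>[of 0 0] \<eta>0 R by simp
  have B0: "0 \<le> B" using \<phi>(2,3) order_trans by blast
  have "\<bar>(\<integral>y. \<phi> ((1 / 1) *\<^sub>R (y - 0)) \<partial>hausdorff_on d (points P))
      - (\<integral>u. \<phi> ((1 / 1) *\<^sub>R (u - orth_proj Q 0)) \<partial>hausdorff_on d (orth_proj Q ` points P))\<bar>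
    \<le> \<omega> * measure (hausdorff_on d (points P)) (cball 0 (2 * R * 1))
      + ((1 / (1 - \<eta>)) ^ d - 1) * (B * measure (hausdorff_on d (orth_proj Q ` points P)) (cball (orth_proj Q 0) (R * 1)))"
    by (rule nearly_flat_integral_compare[OF d nearly_flat_plane[OF PQ] \<eta>0 \<eta> closed_subspace[OF subspace_points] z(1) \<phi> \<omega> R])
      (use hausdorff_outer_subspace_finite[OF d P] in auto)
  also have "\<dots> \<le> \<omega> * (plane_const d * (2 * R) ^ d) + ((1 / (1 - \<eta>)) ^ d - 1) * (B * (plane_const d * R ^ d))"
  proof (intro add_mono mult_left_mono)
    show "measure (hausdorff_on d (points P)) (cball 0 (2 * R * 1)) \<le> plane_const d * (2 * R) ^ d" using m[OF P, of "2 * R"] R by simp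
    show "measure (hausdorff_on d (orth_proj Q ` points P)) (cball (orth_proj Q 0) (R * 1)) \<le> plane_const d * R ^ d"
      using m[OF Q R] by (simp add: im linear_0[OF linear_orth_proj])
    have "1 \<le> (1 / (1 - \<eta>)) ^ d" using \<eta>0 \<eta> by (intro one_le_power) auto
    then show "0 \<le> (1 / (1 - \<eta>)) ^ d - 1" by simp
  qed (use \<omega>0 B0 in auto)
  finally show ?thesis by (simp add: im linear_0[OF linear_orth_proj])
qed

section \<open>Blow-up of a measure with tangent cones\<close>

text \<open>
  The measure \<open>\<nu>\<close> of \<open>B\<^sub>r(x)\<close> is \<open>o(r\<^sup>d)\<close>. Applied to the restriction of a measure to the complement of a set, this says
  that the set has full density at \<open>x\<close>.
\<close>

definition vanishing_density :: "nat \<Rightarrow> 'a::metric_space measure \<Rightarrow> 'a \<Rightarrow> bool" where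
  "vanishing_density d \<nu> x \<longleftrightarrow> (\<forall>c>0. \<exists>\<rho>>0. \<forall>r. 0 < r \<and> r < \<rho> \<longrightarrow> emeasure \<nu> (cball x r) \<le> ennreal (c * r ^ d))"

lemma vanishing_densityE:
  assumes "vanishing_density d \<nu> x" "0 < c"
  obtains \<rho> where "0 < \<rho>" "\<And>r. 0 < r \<Longrightarrow> r < \<rho> \<Longrightarrow> emeasure \<nu> (cball x r) \<le> ennreal (c * r ^ d)"
proof -
  have "\<exists>\<rho>>0. \<forall>r. 0 < r \<and> r < \<rho> \<longrightarrow> emeasure \<nu> (cball x r) \<le> ennreal (c * r ^ d)"
    using assms(1)[unfolded vanishing_density_def, rule_format, OF assms(2)] by simp
  then show ?thesis using that by metis
qed

text \<open>
  The Lebesgue density theorem in the form needed here: a measure that does not charge \<open>B\<close> has density zero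
  at \<open>\<H>\<^sup>d\<close>-almost every point of \<open>B\<close>.
\<close>

lemma vanishing_density_AE:
  fixes \<nu> :: "'a::euclidean_space measure"
  assumes d: "1 \<le> d" and sets: "sets \<nu> = sets borel" and fin: "emeasure \<nu> (space \<nu>) < \<infinity>"
    and B: "B \<in> sets borel" "emeasure \<nu> B = 0"
  shows "hausdorff_outer d {x \<in> B. \<not> vanishing_density d \<nu> x} = 0"
proof (rule hausdorff_null_of_lower_density[OF d sets fin B])
  fix x assume x: "x \<in> {x \<in> B. \<not> vanishing_density d \<nu> x}"
  have "\<not> (\<forall>c>0. \<exists>\<rho>>0. \<forall>r. 0 < r \<and> r < \<rho> \<longrightarrow> emeasure \<nu> (cball x r) \<le> ennreal (c * r ^ d))"
  proof -
    have "\<not> vanishing_density d \<nu> x" using x by simp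
    then show ?thesis unfolding vanishing_density_def .
  qed
  then obtain c where c: "c > 0" "\<not> (\<exists>\<rho>>0. \<forall>r. 0 < r \<and> r < \<rho> \<longrightarrow> emeasure \<nu> (cball x r) \<le> ennreal (c * r ^ d))"
    by metis
  show "\<exists>c>0. \<forall>\<rho>>0. \<exists>r. 0 < r \<and> r < \<rho> \<and> ennreal (c * r ^ d) \<le> emeasure \<nu> (cball x r)"
  proof (rule exI[of _ c], intro conjI c(1) allI impI)
    fix \<rho> :: real assume "0 < \<rho>"
    then obtain r where r: "0 < r" "r < \<rho>" "\<not> emeasure \<nu> (cball x r) \<le> ennreal (c * r ^ d)"
      using c(2) by metis
    then show "\<exists>r. 0 < r \<and> r < \<rho> \<and> ennreal (c * r ^ d) \<le> emeasure \<nu> (cball x r)"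
      by (intro exI[of _ r]) simp
  qed
qed auto

lemma hausdorff_on_eq_density:
  assumes d: "1 \<le> d" and A: "A \<in> sets borel" "A \<subseteq> M"
  shows "hausdorff_on d A = density (hausdorff_on d M) (\<lambda>x. ennreal (indicat_real A x))"
proof (rule measure_eqI)
  fix B assume "B \<in> sets (hausdorff_on d A)"
  then have B: "B \<in> sets borel" by simp
  have "emeasure (density (hausdorff_on d M) (\<lambda>x. ennreal (indicat_real A x))) B = (\<integral>\<^sup>+x. indicator (A \<inter> B) x \<partial>hausdorff_on d M)"
  proof -
    have "ennreal (indicat_real A x) * indicator B x = indicator (A \<inter> B) x" for x by (simp split: split_indicator)
    moreover have "(\<lambda>x. ennreal (indicat_real A x)) \<in> borel_measurable (hausdorff_on d M)"
      using A by (auto simp: measurable_cong_sets[OF sets_hausdorff_on refl])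
    ultimately show ?thesis using B by (simp add: emeasure_density)
  qed
  also have "\<dots> = emeasure (hausdorff_on d M) (A \<inter> B)" using A B by (intro nn_integral_indicator) auto
  also have "\<dots> = hausdorff_outer d (A \<inter> B)"
    using A B by (subst emeasure_hausdorff_on[OF d]) (auto intro: arg_cong[where f = "hausdorff_outer d"])
  also have "\<dots> = emeasure (hausdorff_on d A) B" using B by (simp add: emeasure_hausdorff_on[OF d] Int_commute)
  finally show "emeasure (hausdorff_on d A) B = emeasure (density (hausdorff_on d M) (\<lambda>x. ennreal (indicat_real A x))) B" by simp
qed simp

lemma integral_hausdorff_on_subset:
  fixes f :: "'a::euclidean_space \<Rightarrow> real"
  assumes d: "1 \<le> d" and A: "A \<in> sets borel" "A \<subseteq> M" and f: "f \<in> borel_measurable borel"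
  shows "(\<integral>x. f x \<partial>hausdorff_on d A) = (\<integral>x. f x * indicat_real A x \<partial>hausdorff_on d M)"
  unfolding hausdorff_on_eq_density[OF d A]
  using A f by (subst integral_real_density) (auto simp: measurable_cong_sets[OF sets_hausdorff_on refl] mult.commute)

text \<open>
  What is left of the varifold problem after the limit: \<open>S\<close> is the support of the mass \<open>\<mu>\<close>, and the compact sets \<open>Ks m\<close>
  of pairs \<open>(x, P)\<close> with \<open>P\<close> tangent to \<open>S\<close> at \<open>x\<close> project onto almost all of \<open>S\<close>. Compactness of these sets makes all
  projections of sets of pairs to \<open>\<real>\<^sup>n\<close> that occur below \<open>\<sigma>\<close>-compact, hence Borel.
\<close>

locale tangential_measure =
  fixes d :: nat and \<Omega> S :: "'a::euclidean_space set" and \<mu> :: "'a measure" and c0 c1 :: real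
    and Ks :: "nat \<Rightarrow> ('a \<times> 'a linear_subspace) set"
  assumes d: "1 \<le> d" and open_\<Omega>: "open \<Omega>" and fin_\<mu>: "finite_measure \<mu>" and sets_\<mu>: "sets \<mu> = sets borel"
    and S\<Omega>: "S \<subseteq> \<Omega>" and c0: "0 < c0" and c1: "0 < c1"
    and low: "\<And>y r. y \<in> S \<Longrightarrow> 0 < r \<Longrightarrow> cball y (8 * r) \<subseteq> \<Omega> \<Longrightarrow> c0 * r ^ d \<le> measure \<mu> (cball y r)"
    and up: "\<And>y r. y \<in> S \<Longrightarrow> 0 < r \<Longrightarrow> cball y (8 * r) \<subseteq> \<Omega> \<Longrightarrow> measure \<mu> (cball y r) \<le> c1 * r ^ d"
    and Ks_compact: "\<And>m. compact (Ks m)" and Ks_sub: "\<And>m. Ks m \<subseteq> S \<times> grassmannian d"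
    and cone: "\<And>m x P \<epsilon>. (x, P) \<in> Ks m \<Longrightarrow> 0 < \<epsilon> \<Longrightarrow>
      \<exists>\<rho>>0. \<forall>y\<in>S. dist x y < \<rho> \<longrightarrow> norm ((y - x) - orth_proj P (y - x)) \<le> \<epsilon> * norm (y - x)"
    and full: "emeasure \<mu> (- (\<Union>m. fst ` Ks m)) = 0"
begin

definition M where "M = (\<Union>m. fst ` Ks m)"

abbreviation "H \<equiv> hausdorff_on d M"

definition "C0 = unit_ball_vol (real d) * 5 ^ d / c0"

lemma C0_pos: "0 < C0"
  unfolding C0_def using c0 unit_ball_vol_pos[of "real d"] by (intro divide_pos_pos mult_pos_pos zero_less_power) simp_all

lemma space_\<mu> [simp]: "space \<mu> = UNIV" using sets_eq_imp_space_eq[OF sets_\<mu>] by simp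

lemma emeasure_\<mu>: "emeasure \<mu> A = ennreal (measure \<mu> A)"
  using finite_measure.emeasure_eq_measure[OF fin_\<mu>] .

lemma MS: "M \<subseteq> S" using Ks_sub unfolding M_def by fastforce

lemma M_borel: "M \<in> sets borel"
proof -
  have "compact (fst ` Ks m)" for m by (intro compact_continuous_image Ks_compact continuous_intros)
  then show ?thesis unfolding M_def by (intro sets.countable_UN) (auto intro: borel_closed compact_imp_closed)
qed

lemma local_scale: "x \<in> S \<Longrightarrow> \<exists>\<rho>>0. \<forall>r<\<rho>. cball x (8 * r) \<subseteq> \<Omega>"
proof -
  assume "x \<in> S"
  then obtain e where e: "e > 0" "cball x e \<subseteq> \<Omega>" using S\<Omega> open_\<Omega> by (meson open_contains_cball subsetD)
  have "cball x (8 * r) \<subseteq> \<Omega>" if "r < e / 8" for r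
    using subset_cball[of "8 * r" e x] that e by auto
  then show ?thesis using e by (intro exI[of _ "e / 8"]) auto
qed

lemma lower_density: "x \<in> S \<Longrightarrow> 0 < \<rho> \<Longrightarrow> \<exists>r. 0 < r \<and> r < \<rho> \<and> ennreal (c0 * r ^ d) \<le> emeasure \<mu> (cball x r)"
proof -
  assume x: "x \<in> S" "0 < \<rho>"
  then obtain \<sigma> where "\<sigma> > 0" "\<And>r. r < \<sigma> \<Longrightarrow> cball x (8 * r) \<subseteq> \<Omega>" using local_scale by blast
  moreover define r where "r = min \<rho> \<sigma> / 2"
  ultimately have r: "0 < r" "r < \<rho>" "cball x (8 * r) \<subseteq> \<Omega>" using x by auto
  then have "ennreal (c0 * r ^ d) \<le> emeasure \<mu> (cball x r)"
    unfolding emeasure_\<mu> using x by (intro ennreal_leI low)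
  then show ?thesis using r by blast
qed

lemma hausdorff_null_of_\<mu>_null:
  assumes "B \<in> sets borel" "emeasure \<mu> B = 0" "N \<subseteq> B" "N \<subseteq> S"
  shows "hausdorff_outer d N = 0"
proof (rule hausdorff_null_of_lower_density[OF d sets_\<mu> _ assms(1,2,3)])
  show "emeasure \<mu> (space \<mu>) < \<infinity>" by (simp add: emeasure_\<mu>)
  fix x assume "x \<in> N"
  then show "\<exists>c>0. \<forall>\<rho>>0. \<exists>r. 0 < r \<and> r < \<rho> \<and> ennreal (c * r ^ d) \<le> emeasure \<mu> (cball x r)"
    using lower_density[of x] assms(4) c0 by blast
qed

text \<open>
  The lower density bound and outer regularity of \<open>\<mu>\<close>.
\<close>

lemma hausdorff_le_\<mu>:
  assumes B: "B \<in> sets borel"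
  shows "hausdorff_outer d (B \<inter> S) \<le> ennreal C0 * emeasure \<mu> B"
proof -
  have "emeasure \<mu> B = (INF U\<in>{U. B \<subseteq> U \<and> open U}. emeasure \<mu> U)"
    using outer_regular[OF sets_\<mu> _ B] by (simp add: emeasure_\<mu>)
  moreover have "hausdorff_outer d (B \<inter> S) \<le> ennreal C0 * (INF U\<in>{U. B \<subseteq> U \<and> open U}. emeasure \<mu> U)"
  proof (rule ennreal_le_mult_INF[OF C0_pos])
    fix U assume "U \<in> {U. B \<subseteq> U \<and> open U}"
    then show "hausdorff_outer d (B \<inter> S) \<le> ennreal C0 * emeasure \<mu> U"
      unfolding C0_def by (intro hausdorff_outer_le_of_lower_density[OF d sets_\<mu> c0] lower_density) auto
  qed
  ultimately show ?thesis by simp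
qed

lemma \<mu>_null_of_hausdorff_null:
  assumes N: "N \<in> sets borel" "N \<subseteq> S" "hausdorff_outer d N = 0"
  shows "emeasure \<mu> N = 0"
proof -
  define A where "A k = {x \<in> N. cball x (8 * (1 / Suc k)) \<subseteq> \<Omega>}" for k
  have "\<exists>N'\<in>null_sets \<mu>. A k \<subseteq> N'" for k
  proof (rule null_superset_of_upper_density[OF d sets_\<mu> c1])
    show "0 < 1 / real (Suc k)" by simp
    show "hausdorff_outer d (A k) = 0" by (rule hausdorff_outer_null_mono[OF N(3)]) (auto simp: A_def)
    fix x r assume x: "x \<in> A k" "0 < r" "r < 1 / real (Suc k)"
    have "cball x (8 * r) \<subseteq> cball x (8 * (1 / Suc k))" using x by (intro subset_cball) auto
    then have "measure \<mu> (cball x r) \<le> c1 * r ^ d" using x N(2) by (intro up) (auto simp: A_def)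
    then have "emeasure \<mu> (cball x r) \<le> ennreal (c1 * r ^ d)" unfolding emeasure_\<mu> by (rule ennreal_leI)
    moreover have "emeasure \<mu> (ball x r) \<le> emeasure \<mu> (cball x r)" by (intro emeasure_mono) (auto simp: sets_\<mu>)
    ultimately show "emeasure \<mu> (ball x r) \<le> ennreal (c1 * r ^ d)" by simp
  qed
  then obtain N' where N': "\<And>k. N' k \<in> null_sets \<mu>" "\<And>k. A k \<subseteq> N' k" by metis
  have "N \<subseteq> (\<Union>k. N' k)"
  proof
    fix x assume x: "x \<in> N"
    then obtain \<rho> where \<rho>: "\<rho> > 0" "\<And>r. r < \<rho> \<Longrightarrow> cball x (8 * r) \<subseteq> \<Omega>" using local_scale N(2) by blast
    obtain k where "1 / real (Suc k) < \<rho>" using \<rho>(1) nat_approx_posE by metis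
    then have "x \<in> A k" unfolding A_def using \<rho>(2) x by blast
    then show "x \<in> (\<Union>k. N' k)" using N'(2) by blast
  qed
  moreover have "(\<Union>k. N' k) \<in> null_sets \<mu>" using N'(1) by (intro null_sets_UN) auto
  ultimately have "N \<in> null_sets \<mu>" using N(1) null_sets_subset[of "\<Union>k. N' k" \<mu> N] by (simp add: sets_\<mu>)
  then show ?thesis by (rule null_setsD1)
qed

lemma H_le: "B \<in> sets borel \<Longrightarrow> measure H B \<le> C0 * measure \<mu> B"
proof -
  assume B: "B \<in> sets borel"
  have "emeasure H B = hausdorff_outer d (B \<inter> M)" using B by (rule emeasure_hausdorff_on[OF d])
  also have "\<dots> \<le> hausdorff_outer d (B \<inter> S)" using MS by (intro hausdorff_outer_mono) auto
  also have "\<dots> \<le> ennreal C0 * emeasure \<mu> B" by (rule hausdorff_le_\<mu>[OF B])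
  also have "\<dots> = ennreal (C0 * measure \<mu> B)" using C0_pos by (simp add: emeasure_\<mu> ennreal_mult)
  finally show ?thesis unfolding measure_def[of H] using C0_pos by (intro enn2real_leI) auto
qed

lemma finite_H: "finite_measure H"
proof (rule finite_measureI)
  have "emeasure H UNIV \<le> hausdorff_outer d (UNIV \<inter> S)"
    using MS by (simp add: emeasure_hausdorff_on[OF d] hausdorff_outer_mono)
  also have "\<dots> \<le> ennreal C0 * emeasure \<mu> UNIV" by (rule hausdorff_le_\<mu>) simp
  also have "\<dots> < \<infinity>" by (simp add: emeasure_\<mu> ennreal_mult_less_top)
  finally show "emeasure H (space H) \<noteq> \<infinity>" by simp
qed

text \<open>
  The two density bounds give absolute continuity in both directions: of \<open>\<mu>\<close> for the existence of \<open>\<theta>\<close>, and of \<open>\<H>\<^sup>d\<close>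
  on \<open>M\<close> for its positivity.
\<close>

lemma exists_density:
  "\<exists>\<theta>. \<theta> \<in> borel_measurable borel \<and> (\<forall>x. 0 \<le> \<theta> x) \<and> hausdorff_outer d {x \<in> M. \<not> 0 < \<theta> x} = 0
    \<and> density H (\<lambda>x. ennreal (\<theta> x)) = \<mu>"
proof -
  interpret H: finite_measure H by (rule finite_H)
  have ac: "absolutely_continuous H \<mu>"
    unfolding absolutely_continuous_def
  proof
    fix N assume "N \<in> null_sets H"
    then have N: "N \<in> sets borel" "hausdorff_outer d (N \<inter> M) = 0"
      by (auto simp: null_sets_def emeasure_hausdorff_on[OF d])
    have "emeasure \<mu> (N \<inter> M) = 0"
      using N M_borel MS by (intro \<mu>_null_of_hausdorff_null) auto
    moreover have "emeasure \<mu> (N - M) \<le> emeasure \<mu> (- M)"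
      using M_borel by (intro emeasure_mono) (auto simp: sets_\<mu>)
    moreover have "emeasure \<mu> N \<le> emeasure \<mu> (N \<inter> M) + emeasure \<mu> (N - M)"
      using N M_borel emeasure_subadditive[of "N \<inter> M" \<mu> "N - M"] by (simp add: sets_\<mu> Int_Diff_Un)
    ultimately have "emeasure \<mu> N = 0" using full by (simp add: M_def)
    then show "N \<in> null_sets \<mu>" using N by (auto simp: null_sets_def sets_\<mu>)
  qed
  obtain D where D: "D \<in> borel_measurable H" "AE x in H. RN_deriv H \<mu> x = ennreal (D x)" "AE x in \<mu>. 0 < D x" "\<And>x. 0 \<le> D x"
    using H.real_RN_deriv[OF fin_\<mu> ac] sets_\<mu> by auto
  have Db: "D \<in> borel_measurable borel" using D(1) by (simp add: measurable_cong_sets[OF sets_hausdorff_on refl])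
  have "density H (\<lambda>x. ennreal (D x)) = density H (RN_deriv H \<mu>)"
    using D(1,2) by (intro density_cong) auto
  also have "\<dots> = \<mu>" using ac by (intro H.density_RN_deriv) (auto simp: sets_\<mu>)
  finally have dens: "density H (\<lambda>x. ennreal (D x)) = \<mu>" .
  define B where "B = {x. \<not> 0 < D x}"
  have B: "B \<in> sets borel" unfolding B_def using Db by measurable
  have "B \<in> null_sets \<mu>" using B D(3) by (subst AE_iff_null_sets) (auto simp: sets_\<mu> B_def)
  then have "hausdorff_outer d {x \<in> M. \<not> 0 < D x} = 0"
    using B MS by (intro hausdorff_null_of_\<mu>_null[of B]) (auto simp: B_def)
  then show ?thesis using Db D(4) dens by blast
qed

end

locale tangential_density = tangential_measure +
  fixes \<theta> :: "'a \<Rightarrow> real"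
  assumes \<theta>m: "\<theta> \<in> borel_measurable borel" and \<theta>0: "\<And>x. 0 \<le> \<theta> x"
    and dens: "density H (\<lambda>x. ennreal (\<theta> x)) = \<mu>"
begin

lemma Hm: "f \<in> borel_measurable borel \<Longrightarrow> f \<in> borel_measurable H"
  by (simp add: measurable_cong_sets[OF sets_hausdorff_on refl])

lemma integral_\<mu>:
  fixes f :: "'a \<Rightarrow> real"
  assumes "f \<in> borel_measurable borel" shows "(\<integral>x. f x \<partial>\<mu>) = (\<integral>x. \<theta> x * f x \<partial>H)"
  unfolding dens[symmetric] using assms \<theta>m \<theta>0 by (intro integral_real_density Hm AE_I2)

text \<open>
  The data for an estimate of the blow-up at \<open>x\<close> with an error that vanishes with \<open>\<eta>\<close>: a flat compact piece \<open>A0\<close> over a plane \<open>Q\<close> near \<open>P\<close>,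
  and the part \<open>A\<close> of it on which \<open>\<theta>\<close> is nearly constant. \<open>A\<close> has full \<open>\<mu>\<close>-density at \<open>x\<close>, whereas
  density in \<open>Q\<close> is asked for the projection of \<open>A0\<close>, which is compact and hence Borel. The ball
  of radius \<open>b + 1\<close> makes the measure on \<open>Q\<close> finite without affecting it near the projection of \<open>x\<close>.
\<close>

definition piece_at :: "real \<Rightarrow> 'a \<Rightarrow> 'a linear_subspace \<Rightarrow> bool" where
  "piece_at \<eta> x P \<longleftrightarrow> (\<exists>A0 A Q b. compact A0 \<and> A0 \<subseteq> M \<and> A \<in> sets borel \<and> A \<subseteq> A0 \<and> x \<in> A \<and> nearly_flat \<eta> Q A0
     \<and> Q \<in> grassmannian d \<and> dist P Q \<le> \<eta> \<and> (\<forall>y\<in>A. \<bar>\<theta> y - \<theta> x\<bar> \<le> \<eta>)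
     \<and> vanishing_density d (density \<mu> (indicator (- A))) x
     \<and> norm (orth_proj Q x) \<le> b
     \<and> vanishing_density d (hausdorff_on d (points Q \<inter> cball 0 (b + 1) - orth_proj Q ` A0)) (orth_proj Q x))"

definition blowup_error :: "real \<Rightarrow> real \<Rightarrow> real \<Rightarrow> real \<Rightarrow> real \<Rightarrow> real" where
  "blowup_error \<eta> \<omega> B R t = \<eta> * B * (C0 * c1 * R ^ d)
     + t * (\<omega> * (C0 * c1 * (2 * R) ^ d) + ((1 / (1 - \<eta>)) ^ d - 1) * (B * (plane_const d * R ^ d))
     + (\<omega> * (plane_const d * (2 * R) ^ d) + ((1 / (1 - \<eta>)) ^ d - 1) * (B * (plane_const d * R ^ d))))"

text \<open>
  Successively replace \<open>\<mu>\<close> by its restriction to \<open>A\<close> (\<open>T1\<close>, full density), \<open>\<theta>\<close> by the constant \<open>\<theta>(x)\<close> (\<open>T2\<close>), \<open>A\<close> by \<open>A0\<close>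
  (\<open>T3\<close>, again full density, as \<open>\<H>\<^sup>d \<le> C0 \<mu>\<close> on \<open>S\<close>), \<open>A0\<close> by its projection (\<open>T4\<close>, flatness), the projection by all
  of \<open>Q\<close> (\<open>T5\<close>, full density in \<open>Q\<close>), and finally \<open>Q\<close> by \<open>P\<close> (\<open>E7\<close>).
\<close>

lemma blowup_estimate:
  assumes piece: "piece_at \<eta> x P" and P: "P \<in> grassmannian d" and \<eta>: "0 \<le> \<eta>" "\<eta> \<le> 1 / 2"
    and \<phi>: "continuous_on UNIV \<phi>" "\<And>z. 0 \<le> \<phi> z" "\<And>z. \<phi> z \<le> B" "\<And>z. R \<le> norm z \<Longrightarrow> \<phi> z = 0"
    and \<omega>: "\<And>z w. dist z w \<le> 2 * \<eta> * R \<Longrightarrow> \<bar>\<phi> z - \<phi> w\<bar> \<le> \<omega>" and R: "0 < R" and \<tau>: "0 < \<tau>"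
  shows "eventually (\<lambda>r. \<bar>(1 / r ^ d) * (\<integral>y. \<phi> ((1 / r) *\<^sub>R (y - x)) \<partial>\<mu>) - \<theta> x * (\<integral>y. \<phi> y \<partial>hausdorff_on d (points P))\<bar>
    \<le> \<tau> + blowup_error \<eta> \<omega> B R (\<theta> x)) (at_right 0)"
proof -
  obtain A0 A Q b where A0: "compact A0" "A0 \<subseteq> M" and A: "A \<in> sets borel" "A \<subseteq> A0" "x \<in> A" and flat: "nearly_flat \<eta> Q A0"
    and Q: "Q \<in> grassmannian d" and PQ: "dist P Q \<le> \<eta>" and \<theta>A: "\<And>y. y \<in> A \<Longrightarrow> \<bar>\<theta> y - \<theta> x\<bar> \<le> \<eta>"
    and v1: "vanishing_density d (density \<mu> (indicator (- A))) x" and b: "norm (orth_proj Q x) \<le> b"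
    and v2: "vanishing_density d (hausdorff_on d (points Q \<inter> cball 0 (b + 1) - orth_proj Q ` A0)) (orth_proj Q x)"
    using piece unfolding piece_at_def by blast
  have A0b: "A0 \<in> sets borel" using A0 by (intro borel_closed compact_imp_closed)
  have pA0: "compact (orth_proj Q ` A0)" using A0(1) by (intro compact_continuous_image continuous_intros)
  then have pA0b: "orth_proj Q ` A0 \<in> sets borel" by (intro borel_closed compact_imp_closed)
  have xS: "x \<in> S" using A A0 MS by blast
  have B0: "0 \<le> B" using \<phi>(2,3) order_trans by blast
  have bd: "\<bar>\<phi> z\<bar> \<le> B" for z using \<phi>(2,3) by simp
  have \<omega>0: "0 \<le> \<omega>" using \<omega>[of 0 0] \<eta> R by simp
  define L where "L = (1 / (1 - \<eta>)) ^ d - 1"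
  have L0: "0 \<le> L"
  proof -
    have "1 \<le> (1 / (1 - \<eta>)) ^ d" using \<eta> by (intro one_le_power) auto
    then show ?thesis by (simp add: L_def)
  qed
  \<comment> \<open>The three errors that are o(r^d) add up to (K - 1) \<sigma> r^d, and \<sigma> is chosen to make this at most \<tau> r^d.\<close>
  define K where "K = B * (1 + \<theta> x * C0 + \<theta> x) + 1"
  have K: "0 < K"
    unfolding K_def using B0 \<theta>0[of x] C0_pos by (intro add_nonneg_pos mult_nonneg_nonneg add_nonneg_nonneg) auto
  define \<sigma> where "\<sigma> = \<tau> / K"
  have \<sigma>: "0 < \<sigma>" "K * \<sigma> = \<tau>" using \<tau> K by (auto simp: \<sigma>_def)
  define c where "c = \<sigma> / R ^ d"
  have c: "0 < c" "c * (R * r) ^ d = \<sigma> * r ^ d" for r using \<sigma> R by (auto simp: c_def power_mult_distrib)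
  obtain \<rho>1 where \<rho>1: "\<rho>1 > 0" "\<And>r. 0 < r \<Longrightarrow> r < \<rho>1 \<Longrightarrow> emeasure (density \<mu> (indicator (- A))) (cball x r) \<le> ennreal (c * r ^ d)"
    by (rule vanishing_densityE[OF v1 c(1)]) (rule that)
  obtain \<rho>2 where \<rho>2: "\<rho>2 > 0" "\<And>r. 0 < r \<Longrightarrow> r < \<rho>2 \<Longrightarrow>
      emeasure (hausdorff_on d (points Q \<inter> cball 0 (b + 1) - orth_proj Q ` A0)) (cball (orth_proj Q x) r) \<le> ennreal (c * r ^ d)"
    by (rule vanishing_densityE[OF v2 c(1)]) (rule that)
  obtain \<rho>3 where \<rho>3: "\<rho>3 > 0" "\<And>r. r < \<rho>3 \<Longrightarrow> cball x (8 * r) \<subseteq> \<Omega>" using local_scale[OF xS] by blast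
  define \<rho> where "\<rho> = min (min \<rho>1 \<rho>2) (min (\<rho>3 / 2) 1) / R"
  have \<rho>: "0 < \<rho>" using \<rho>1 \<rho>2 \<rho>3 R by (simp add: \<rho>_def)
  have fin_H: "finite_measure H" by (rule finite_H)
  define JP JQ where "JP = (\<integral>y. \<phi> y \<partial>hausdorff_on d (points P))" and "JQ = (\<integral>y. \<phi> y \<partial>hausdorff_on d (points Q))"
  have \<phi>m: "\<phi> \<in> borel_measurable borel" using \<phi>(1) by (rule borel_measurable_continuous_onI)
  have E7: "\<bar>JP - JQ\<bar> \<le> \<omega> * (plane_const d * (2 * R) ^ d) + L * (B * (plane_const d * R ^ d))"
    unfolding JP_def JQ_def L_def by (rule plane_integral_close[OF d P Q PQ \<eta>(2) \<phi> \<omega> R])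
  have main: "\<bar>(1 / r ^ d) * (\<integral>y. \<phi> ((1 / r) *\<^sub>R (y - x)) \<partial>\<mu>) - \<theta> x * JP\<bar> \<le> \<tau> + blowup_error \<eta> \<omega> B R (\<theta> x)"
    if r: "0 < r" "r < \<rho>" for r
  proof -
    define a where "a = r ^ d"
    have a: "0 < a" using r by (simp add: a_def)
    have Rr0: "0 < R * r" using r R by simp
    have Rr1: "R * r < \<rho>1" "R * r < \<rho>2" "2 * R * r < \<rho>3" "R * r < 1"
    proof -
      have "R * r < min (min \<rho>1 \<rho>2) (min (\<rho>3 / 2) 1)"
        using r(2) R unfolding \<rho>_def by (simp only: pos_less_divide_eq mult.commute)
      then have *: "R * r < \<rho>1" "R * r < \<rho>2" "R * r < \<rho>3 / 2" "R * r < 1" by simp_all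
      then show "R * r < \<rho>1" "R * r < \<rho>2" "2 * R * r < \<rho>3" "R * r < 1" by simp_all
    qed
    note Rr = Rr0 Rr1
    define D where "D = cball x (R * r)"
    have Db: "D \<in> sets borel" by (simp add: D_def)
    define f where "f y = \<phi> ((1 / r) *\<^sub>R (y - x))" for y
    have fm: "f \<in> borel_measurable borel" unfolding f_def
      by (intro borel_measurable_continuous_onI continuous_on_compose2[OF \<phi>(1)]) (auto intro!: continuous_intros)
    have fb: "0 \<le> f y" "\<bar>f y\<bar> \<le> B" for y using \<phi>(2) bd by (auto simp: f_def)
    have f0: "f y = 0" if "y \<notin> D" for y
    proof -
      have "R * r < norm (y - x)" using that by (simp add: D_def dist_norm norm_minus_commute)
      then have "R \<le> norm ((1 / r) *\<^sub>R (y - x))" using r by (simp add: pos_le_divide_eq)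
      then show ?thesis unfolding f_def by (rule \<phi>(4))
    qed
    have \<mu>s: "emeasure \<mu> E < \<infinity>" for E by (simp add: emeasure_\<mu>)
    have Hs: "emeasure H E < \<infinity>" for E using finite_measure.emeasure_finite[OF fin_H, of E] by (simp add: less_top)
    have \<mu>DA: "measure \<mu> (D - A) \<le> \<sigma> * a"
    proof -
      have "emeasure \<mu> (D - A) = emeasure (density \<mu> (indicator (- A))) D"
      proof -
        have nA: "- A \<in> sets \<mu>" "D - A \<in> sets \<mu>" using A(1) Db by (auto simp: sets_\<mu> borel_comp)
        have "indicator (- A) y * indicator D y = (indicator (D - A) y :: ennreal)" for y by (simp split: split_indicator)
        then show ?thesis using nA Db by (simp add: emeasure_density borel_measurable_indicator sets_\<mu>)
      qed
      also have "\<dots> \<le> ennreal (c * (R * r) ^ d)" unfolding D_def by (rule \<rho>1(2)) (use Rr in auto)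
      finally show ?thesis unfolding c(2) a_def measure_def using \<sigma> r by (intro enn2real_leI) auto
    qed
    have HDA: "measure H (D - A) \<le> C0 * (\<sigma> * a)"
      using H_le[of "D - A"] \<mu>DA C0_pos A(1) Db by (meson mult_left_mono less_imp_le order_trans sets.Diff)
    have Hball: "measure H (cball x s) \<le> C0 * c1 * s ^ d" if "0 < s" "s < \<rho>3" for s
    proof -
      have "measure H (cball x s) \<le> C0 * measure \<mu> (cball x s)" by (rule H_le) simp
      also have "\<dots> \<le> C0 * (c1 * s ^ d)" using that \<rho>3 C0_pos xS by (intro mult_left_mono up) auto
      finally show ?thesis by (simp add: mult.assoc)
    qed
    have RR: "(R * r) ^ d = R ^ d * a" "(2 * R * r) ^ d = (2 * R) ^ d * a"
      by (simp_all add: a_def power_mult_distrib)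
    define X0 where "X0 = (\<integral>y. f y \<partial>\<mu>)"
    define X1 where "X1 = (\<integral>y. f y * indicat_real A y \<partial>\<mu>)"
    define X2 where "X2 = (\<integral>y. f y * indicat_real A y \<partial>H)"
    define X3 where "X3 = (\<integral>y. f y * indicat_real A0 y \<partial>H)"
    have im [measurable]: "indicat_real E \<in> borel_measurable borel" if "E \<in> sets borel" for E :: "'a set" using that by simp
    have T1: "\<bar>X0 - X1\<bar> \<le> B * (\<sigma> * a)"
    proof -
      have i0: "integrable \<mu> f" using fb f0 \<mu>s by (intro integrable_bounded_support[OF fm sets_\<mu> Db]) auto
      have m1: "(\<lambda>y. f y * indicat_real A y) \<in> borel_measurable borel" using fm A(1) by (intro borel_measurable_times im)
      have i1: "integrable \<mu> (\<lambda>y. f y * indicat_real A y)"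
        by (rule integrable_bounded_support[OF m1 sets_\<mu> Db \<mu>s, of B]) (use fb f0 B0 in \<open>auto simp: indicator_def\<close>)
      have m2: "(\<lambda>y. f y * indicat_real (- A) y) \<in> borel_measurable borel" using fm A(1) by (intro borel_measurable_times im borel_comp)
      have "X0 - X1 = (\<integral>y. f y - f y * indicat_real A y \<partial>\<mu>)" unfolding X0_def X1_def using i0 i1 by simp
      also have "\<dots> = (\<integral>y. f y * indicat_real (- A) y \<partial>\<mu>)" by (intro Bochner_Integration.integral_cong) (auto simp: indicator_def)
      also have "\<bar>\<dots>\<bar> \<le> B * measure \<mu> (D - A)"
        by (rule integral_le_bounded_support[OF m2 sets_\<mu> _ \<mu>s]) (use fb f0 B0 A(1) Db in \<open>auto simp: indicator_def\<close>)
      also have "\<dots> \<le> B * (\<sigma> * a)" using \<mu>DA B0 by (rule mult_left_mono)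
      finally show ?thesis .
    qed
    have T2: "\<bar>X1 - \<theta> x * X2\<bar> \<le> \<eta> * B * (C0 * c1 * R ^ d) * a"
    proof -
      have m1: "(\<lambda>y. f y * indicat_real A y) \<in> borel_measurable borel" using fm A(1) by (intro borel_measurable_times im)
      have i2: "integrable H (\<lambda>y. f y * indicat_real A y)"
        by (rule integrable_bounded_support[OF m1 sets_hausdorff_on Db Hs, of B]) (use fb f0 B0 in \<open>auto simp: indicator_def\<close>)
      have m3: "(\<lambda>y. (\<theta> y - \<theta> x) * (f y * indicat_real A y)) \<in> borel_measurable borel"
        by (rule borel_measurable_times[OF borel_measurable_diff[OF \<theta>m borel_measurable_const] m1])
      have b3: "\<bar>(\<theta> y - \<theta> x) * (f y * indicat_real A y)\<bar> \<le> \<eta> * B" for y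
      proof (cases "y \<in> A")
        case True
        then show ?thesis using mult_mono[OF \<theta>A[OF True] fb(2)[of y]] \<eta> by (simp add: abs_mult)
      qed (use \<eta> B0 in simp)
      have i3: "integrable H (\<lambda>y. (\<theta> y - \<theta> x) * (f y * indicat_real A y))"
        by (rule integrable_bounded_support[OF m3 sets_hausdorff_on Db Hs b3]) (use f0 in simp)
      have "X1 = (\<integral>y. \<theta> y * (f y * indicat_real A y) \<partial>H)" unfolding X1_def by (rule integral_\<mu>[OF m1])
      also have "\<dots> = (\<integral>y. (\<theta> y - \<theta> x) * (f y * indicat_real A y) + \<theta> x * (f y * indicat_real A y) \<partial>H)"
        by (simp add: algebra_simps)
      also have "\<dots> = (\<integral>y. (\<theta> y - \<theta> x) * (f y * indicat_real A y) \<partial>H) + \<theta> x * X2"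
        unfolding X2_def using i3 i2 by simp
      finally have "X1 - \<theta> x * X2 = (\<integral>y. (\<theta> y - \<theta> x) * (f y * indicat_real A y) \<partial>H)" by simp
      also have "\<bar>\<dots>\<bar> \<le> \<eta> * B * measure H D"
        by (rule integral_le_bounded_support[OF m3 sets_hausdorff_on Db Hs b3]) (use f0 in simp)
      also have "\<dots> \<le> \<eta> * B * (C0 * c1 * (R * r) ^ d)"
        unfolding D_def using Rr \<eta> B0 by (intro mult_left_mono Hball) auto
      finally show ?thesis by (simp add: RR mult.assoc)
    qed
    have T3: "\<bar>X3 - X2\<bar> \<le> B * (C0 * (\<sigma> * a))"
    proof -
      have m1: "(\<lambda>y. f y * indicat_real E y) \<in> borel_measurable borel" if "E \<in> sets borel" for E using fm that by (intro borel_measurable_times im)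
      have i1: "integrable H (\<lambda>y. f y * indicat_real E y)" if "E \<in> sets borel" for E
        by (rule integrable_bounded_support[OF m1[OF that] sets_hausdorff_on Db Hs, of B]) (use fb f0 B0 in \<open>auto simp: indicator_def\<close>)
      have AA: "A0 - A \<in> sets borel" using A0b A(1) by simp
      have "X3 - X2 = (\<integral>y. f y * indicat_real A0 y - f y * indicat_real A y \<partial>H)"
        unfolding X3_def X2_def using i1[OF A0b] i1[OF A(1)] by simp
      also have "\<dots> = (\<integral>y. f y * indicat_real (A0 - A) y \<partial>H)"
        using A(2) by (intro Bochner_Integration.integral_cong) (auto simp: indicator_def)
      also have "\<bar>\<dots>\<bar> \<le> B * measure H (D - A)"
        by (rule integral_le_bounded_support[OF m1[OF AA] sets_hausdorff_on _ Hs]) (use fb f0 B0 A(1) Db in \<open>auto simp: indicator_def\<close>)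
      also have "\<dots> \<le> B * (C0 * (\<sigma> * a))" using HDA B0 by (rule mult_left_mono)
      finally show ?thesis .
    qed
    define I3 where "I3 = (\<integral>u. \<phi> ((1 / r) *\<^sub>R (u - orth_proj Q x)) \<partial>hausdorff_on d (orth_proj Q ` A0))"
    have pAQ: "orth_proj Q ` A0 \<subseteq> points Q" by (auto simp: orth_proj_in)
    have T4: "\<bar>X3 - I3\<bar> \<le> (\<omega> * (C0 * c1 * (2 * R) ^ d) + L * (B * (plane_const d * R ^ d))) * a"
    proof -
      have X3: "X3 = (\<integral>y. f y \<partial>hausdorff_on d A0)"
        unfolding X3_def by (rule integral_hausdorff_on_subset[OF d A0b A0(2) fm, symmetric])
      have finA: "hausdorff_outer d (A0 \<inter> C) < \<infinity>" for C
      proof -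
        have "hausdorff_outer d (A0 \<inter> C) \<le> hausdorff_outer d (UNIV \<inter> M)" using A0(2) by (intro hausdorff_outer_mono) auto
        also have "\<dots> = emeasure H UNIV" by (simp add: emeasure_hausdorff_on[OF d])
        also have "\<dots> < \<infinity>" by (rule Hs)
        finally show ?thesis .
      qed
      have "\<bar>X3 - I3\<bar> \<le> \<omega> * measure (hausdorff_on d A0) (cball x (2 * R * r))
          + L * (B * measure (hausdorff_on d (orth_proj Q ` A0)) (cball (orth_proj Q x) (R * r)))"
        unfolding X3 I3_def f_def L_def
        by (rule nearly_flat_integral_compare[OF d flat \<eta> compact_imp_closed[OF A0(1)] _ \<phi> \<omega> R r(1)]) (use A finA in auto)
      also have "\<dots> \<le> \<omega> * (C0 * c1 * (2 * R * r) ^ d) + L * (B * (plane_const d * (R * r) ^ d))"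
      proof (intro add_mono mult_left_mono)
        have "measure (hausdorff_on d A0) (cball x (2 * R * r)) \<le> measure H (cball x (2 * R * r))"
          unfolding measure_def
        proof (rule enn2real_mono)
          show "emeasure (hausdorff_on d A0) (cball x (2 * R * r)) \<le> emeasure H (cball x (2 * R * r))"
            using A0(2) by (auto simp: emeasure_hausdorff_on[OF d] intro!: hausdorff_outer_mono)
        qed (use Hs in simp)
        also have "\<dots> \<le> C0 * c1 * (2 * R * r) ^ d" using Rr by (intro Hball) auto
        finally show "measure (hausdorff_on d A0) (cball x (2 * R * r)) \<le> C0 * c1 * (2 * R * r) ^ d" .
        have "emeasure (hausdorff_on d (orth_proj Q ` A0)) (cball (orth_proj Q x) (R * r)) \<le> hausdorff_outer d (points Q \<inter> cball (orth_proj Q x) (R * r))"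
          using pAQ by (auto simp: emeasure_hausdorff_on[OF d] intro!: hausdorff_outer_mono)
        also have "\<dots> \<le> ennreal (plane_const d * (R * r) ^ d)" by (rule hausdorff_plane_cball[OF d Q orth_proj_in Rr(1)])
        finally show "measure (hausdorff_on d (orth_proj Q ` A0)) (cball (orth_proj Q x) (R * r)) \<le> plane_const d * (R * r) ^ d"
          unfolding measure_def using Rr plane_const_nonneg[of d] by (intro enn2real_leI) auto
      qed (use \<omega>0 L0 B0 in auto)
      finally show ?thesis unfolding RR by (simp add: algebra_simps)
    qed
    have T5: "\<bar>a * JQ - I3\<bar> \<le> B * (\<sigma> * a)"
    proof -
      define \<psi> where "\<psi> u = \<phi> ((1 / r) *\<^sub>R (u - orth_proj Q x))" for u
      have \<psi>m: "\<psi> \<in> borel_measurable borel" unfolding \<psi>_def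
        by (intro borel_measurable_continuous_onI continuous_on_compose2[OF \<phi>(1)]) (auto intro!: continuous_intros)
      have \<psi>b: "\<bar>\<psi> u\<bar> \<le> B" for u using bd by (auto simp: \<psi>_def)
      define D' where "D' = cball (orth_proj Q x) (R * r)"
      have D'b: "D' \<in> sets borel" by (simp add: D'_def)
      have \<psi>0: "\<psi> u = 0" if "u \<notin> D'" for u
      proof -
        have "R * r < norm (u - orth_proj Q x)" using that by (simp add: D'_def dist_norm norm_minus_commute)
        then have "R \<le> norm ((1 / r) *\<^sub>R (u - orth_proj Q x))" using r by (simp add: pos_le_divide_eq)
        then show ?thesis unfolding \<psi>_def by (rule \<phi>(4))
      qed
      let ?HQ = "hausdorff_on d (points Q)"
      have HQf: "emeasure ?HQ (D' \<inter> E) < \<infinity>" if "E \<in> sets borel" for E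
      proof -
        have "emeasure ?HQ (D' \<inter> E) \<le> hausdorff_outer d (points Q \<inter> D')"
          using that D'b by (auto simp: emeasure_hausdorff_on[OF d] intro!: hausdorff_outer_mono)
        also have "\<dots> < \<infinity>" unfolding D'_def by (rule hausdorff_outer_subspace_finite[OF d Q]) simp
        finally show ?thesis .
      qed
      have I3: "I3 = (\<integral>u. \<psi> u * indicat_real (orth_proj Q ` A0) u \<partial>?HQ)"
        unfolding I3_def \<psi>_def[symmetric] by (rule integral_hausdorff_on_subset[OF d pA0b pAQ \<psi>m])
      have JQ: "a * JQ = (\<integral>u. \<psi> u \<partial>?HQ)"
        unfolding a_def JQ_def \<psi>_def by (rule integral_plane_scale[OF d orth_proj_in r(1) \<phi>m, symmetric])
      have i0: "integrable ?HQ \<psi>"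
        by (rule integrable_bounded_support[OF \<psi>m sets_hausdorff_on D'b _ \<psi>b \<psi>0]) (use HQf[of UNIV] in simp_all)
      have m1: "(\<lambda>u. \<psi> u * indicat_real E u) \<in> borel_measurable borel" if "E \<in> sets borel" for E
        using \<psi>m that by (intro borel_measurable_times im)
      have i1: "integrable ?HQ (\<lambda>u. \<psi> u * indicat_real (orth_proj Q ` A0) u)"
        by (rule integrable_bounded_support[OF m1[OF pA0b] sets_hausdorff_on D'b, where B = B])
          (use HQf[of UNIV] \<psi>b \<psi>0 B0 in \<open>auto simp: indicator_def\<close>)
      have Db': "D' - orth_proj Q ` A0 \<in> sets borel" using D'b pA0b by simp
      have "a * JQ - I3 = (\<integral>u. \<psi> u - \<psi> u * indicat_real (orth_proj Q ` A0) u \<partial>?HQ)" unfolding I3 JQ using i0 i1 by simp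
      also have "\<dots> = (\<integral>u. \<psi> u * indicat_real (- (orth_proj Q ` A0)) u \<partial>?HQ)"
        by (intro Bochner_Integration.integral_cong) (auto simp: indicator_def)
      also have "\<bar>\<dots>\<bar> \<le> B * measure ?HQ (D' - orth_proj Q ` A0)"
      proof (rule integral_le_bounded_support[OF m1[OF borel_comp[OF pA0b]] sets_hausdorff_on Db'])
        show "emeasure ?HQ (D' - orth_proj Q ` A0) < \<infinity>" using HQf[OF borel_comp[OF pA0b]] by (simp add: Diff_eq)
      qed (use \<psi>b \<psi>0 B0 in \<open>auto simp: indicator_def\<close>)
      also have "\<dots> \<le> B * (\<sigma> * a)"
      proof (rule mult_left_mono[OF _ B0])
        have sub: "D' \<subseteq> cball 0 (b + 1)"
        proof
          fix u assume "u \<in> D'"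
          then have "norm u \<le> norm (orth_proj Q x) + R * r"
            using norm_triangle_ineq2[of u "orth_proj Q x"] by (simp add: D'_def dist_norm norm_minus_commute)
          then show "u \<in> cball 0 (b + 1)" using b Rr by simp
        qed
        have "emeasure ?HQ (D' - orth_proj Q ` A0) \<le> emeasure (hausdorff_on d (points Q \<inter> cball 0 (b + 1) - orth_proj Q ` A0)) D'"
          using Db' D'b sub by (auto simp: emeasure_hausdorff_on[OF d] intro!: hausdorff_outer_mono)
        also have "\<dots> \<le> ennreal (c * (R * r) ^ d)" unfolding D'_def by (rule \<rho>2(2)) (use Rr in auto)
        finally show "measure ?HQ (D' - orth_proj Q ` A0) \<le> \<sigma> * a"
          unfolding c(2) a_def measure_def using \<sigma> r by (intro enn2real_leI) auto
      qed
      finally show ?thesis .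
    qed
    define e4 where "e4 = \<omega> * (C0 * c1 * (2 * R) ^ d) + L * (B * (plane_const d * R ^ d))"
    define e7 where "e7 = \<omega> * (plane_const d * (2 * R) ^ d) + L * (B * (plane_const d * R ^ d))"
    define e2 where "e2 = \<eta> * B * (C0 * c1 * R ^ d)"
    have "\<bar>X2 - a * JP\<bar> \<le> B * (C0 * (\<sigma> * a)) + e4 * a + B * (\<sigma> * a) + a * e7"
    proof -
      have "\<bar>a * JP - a * JQ\<bar> = a * \<bar>JP - JQ\<bar>"
        using a by (simp only: right_diff_distrib[symmetric] abs_mult abs_of_pos)
      also have "\<dots> \<le> a * e7" using E7 a by (intro mult_left_mono) (auto simp: e7_def)
      finally have "\<bar>a * JP - a * JQ\<bar> \<le> a * e7" .
      then show ?thesis using T3 T4 T5 unfolding e4_def[symmetric] by linarith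
    qed
    then have "\<theta> x * \<bar>X2 - a * JP\<bar> \<le> \<theta> x * (B * (C0 * (\<sigma> * a)) + e4 * a + B * (\<sigma> * a) + a * e7)"
      using \<theta>0 by (rule mult_left_mono)
    moreover have "\<theta> x * \<bar>X2 - a * JP\<bar> = \<bar>\<theta> x * X2 - \<theta> x * (a * JP)\<bar>"
      using \<theta>0[of x] by (simp only: right_diff_distrib[symmetric] abs_mult abs_of_nonneg)
    ultimately have "\<bar>X0 - \<theta> x * (a * JP)\<bar> \<le> B * (\<sigma> * a) + e2 * a + \<theta> x * (B * (C0 * (\<sigma> * a)) + e4 * a + B * (\<sigma> * a) + a * e7)"
      using T1 T2 unfolding e2_def[symmetric] by linarith
    also have "\<dots> = a * ((K - 1) * \<sigma> + (e2 + \<theta> x * (e4 + e7)))" by (simp add: K_def algebra_simps)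
    also have "\<dots> \<le> a * (\<tau> + (e2 + \<theta> x * (e4 + e7)))"
      using a \<sigma> by (intro mult_left_mono add_right_mono) (auto simp: left_diff_distrib)
    also have "e2 + \<theta> x * (e4 + e7) = blowup_error \<eta> \<omega> B R (\<theta> x)"
      unfolding blowup_error_def e2_def e4_def e7_def L_def by simp
    finally have fin: "\<bar>X0 - \<theta> x * (a * JP)\<bar> \<le> a * (\<tau> + blowup_error \<eta> \<omega> B R (\<theta> x))" .
    have "(1 / r ^ d) * X0 - \<theta> x * JP = (X0 - \<theta> x * (a * JP)) / a"
      unfolding a_def[symmetric] using a by (simp add: diff_divide_distrib)
    then have "\<bar>(1 / r ^ d) * X0 - \<theta> x * JP\<bar> = \<bar>X0 - \<theta> x * (a * JP)\<bar> / a" using a by simp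
    also have "\<dots> \<le> \<tau> + blowup_error \<eta> \<omega> B R (\<theta> x)" using fin a by (simp add: pos_divide_le_eq mult.commute)
    finally show ?thesis by (simp add: X0_def f_def)
  qed
  show ?thesis
    unfolding eventually_at_right[OF zero_less_one] JP_def[symmetric]
    by (intro exI[of _ \<rho>] conjI \<rho> allI impI main)
qed

text \<open>
  Two exceptional sets: the points of \<open>A\<close> at which \<open>A\<close> fails to have full density, and the points that project to
  such points of the image of \<open>A0\<close> in \<open>Q\<close>. The second is null because the projection has a Lipschitz inverse on \<open>A0\<close>.
\<close>

lemma piece_null:
  assumes A0: "compact A0" "A0 \<subseteq> M" and flat: "nearly_flat \<eta> Q A0" and \<eta>: "\<eta> < 1" and Q: "Q \<in> grassmannian d"
    and A: "A \<in> sets borel" "A \<subseteq> A0" and osc: "\<And>y z. y \<in> A \<Longrightarrow> z \<in> A \<Longrightarrow> \<bar>\<theta> y - \<theta> z\<bar> \<le> \<eta>"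
  shows "\<exists>N. hausdorff_outer d N = 0 \<and> (\<forall>x\<in>A - N. \<forall>P. dist P Q \<le> \<eta> \<longrightarrow> piece_at \<eta> x P)"
proof -
  obtain b where b: "\<And>x. x \<in> A0 \<Longrightarrow> norm x \<le> b" using compact_imp_bounded[OF A0(1)] by (auto simp: bounded_iff)
  define \<nu> where "\<nu> = density \<mu> (indicator (- A))"
  define \<zeta> where "\<zeta> = hausdorff_on d (points Q \<inter> cball 0 (b + 1) - orth_proj Q ` A0)"
  have nA: "- A \<in> sets \<mu>" using A(1) by (simp add: sets_\<mu> borel_comp)
  have em: "emeasure \<nu> E = emeasure \<mu> (E - A)" if "E \<in> sets borel" for E
  proof -
    have "indicator (- A) y * indicator E y = (indicator (E - A) y :: ennreal)" for y by (simp split: split_indicator)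
    then show ?thesis unfolding \<nu>_def using nA that A(1) by (simp add: emeasure_density borel_measurable_indicator sets_\<mu>)
  qed
  define N1 where "N1 = {x \<in> A. \<not> vanishing_density d \<nu> x}"
  have N1: "hausdorff_outer d N1 = 0" unfolding N1_def
  proof (rule vanishing_density_AE[OF d _ _ A(1)])
    show "emeasure \<nu> A = 0" using em[OF A(1)] by simp
    show "emeasure \<nu> (space \<nu>) < \<infinity>" using em[of UNIV] by (simp add: \<nu>_def emeasure_\<mu>)
  qed (simp add: \<nu>_def sets_\<mu>)
  have pA0: "orth_proj Q ` A0 \<in> sets borel"
    using A0(1) by (intro borel_closed compact_imp_closed compact_continuous_image continuous_intros)
  define N2 where "N2 = {x \<in> A0. \<not> vanishing_density d \<zeta> (orth_proj Q x)}"
  have N2: "hausdorff_outer d N2 = 0"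
  proof -
    have "hausdorff_outer d {u \<in> orth_proj Q ` A0. \<not> vanishing_density d \<zeta> u} = 0"
    proof (rule vanishing_density_AE[OF d _ _ pA0])
      have "orth_proj Q ` A0 \<inter> (points Q \<inter> cball 0 (b + 1) - orth_proj Q ` A0) = {}" by blast
      then show "emeasure \<zeta> (orth_proj Q ` A0) = 0"
        unfolding \<zeta>_def using pA0 d by (simp add: emeasure_hausdorff_on hausdorff_outer_empty)
      have "emeasure \<zeta> (space \<zeta>) = hausdorff_outer d (UNIV \<inter> (points Q \<inter> cball 0 (b + 1) - orth_proj Q ` A0))"
        unfolding \<zeta>_def space_hausdorff_on by (rule emeasure_hausdorff_on[OF d]) simp
      also have "\<dots> \<le> hausdorff_outer d (points Q \<inter> cball 0 (b + 1))" by (intro hausdorff_outer_mono) auto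
      also have "\<dots> < \<infinity>" by (rule hausdorff_outer_subspace_finite[OF d Q]) simp
      finally show "emeasure \<zeta> (space \<zeta>) < \<infinity>" .
    qed (simp add: \<zeta>_def)
    then have "hausdorff_outer d (orth_proj Q ` N2) = 0"
      by (rule hausdorff_outer_null_mono) (auto simp: N2_def)
    moreover have "hausdorff_outer d N2 \<le> ennreal ((1 / (1 - \<eta>)) ^ d) * hausdorff_outer d (orth_proj Q ` N2)"
      by (rule hausdorff_outer_nearly_flat_le[OF d flat \<eta>]) (auto simp: N2_def)
    ultimately show ?thesis by simp
  qed
  have "hausdorff_outer d (N1 \<union> N2) = 0"
    using hausdorff_outer_Un[OF d, of N1 N2] N1 N2 by simp
  moreover have "piece_at \<eta> x P" if x: "x \<in> A - (N1 \<union> N2)" and PQ: "dist P Q \<le> \<eta>" for x P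
    unfolding piece_at_def
  proof (rule exI[of _ A0], rule exI[of _ A], rule exI[of _ Q], rule exI[of _ b], intro conjI A0 A flat Q PQ ballI)
    show "x \<in> A" using x by blast
    show "\<bar>\<theta> y - \<theta> x\<bar> \<le> \<eta>" if "y \<in> A" for y using osc[OF that] x by blast
    show "vanishing_density d (density \<mu> (indicator (- A))) x" using x by (auto simp: N1_def \<nu>_def)
    show "norm (orth_proj Q x) \<le> b" using norm_orth_proj_le[of Q x] b[of x] x A(2) by auto
    show "vanishing_density d (hausdorff_on d (points Q \<inter> cball 0 (b + 1) - orth_proj Q ` A0)) (orth_proj Q x)"
      using x A(2) by (auto simp: N2_def \<zeta>_def)
  qed
  ultimately show ?thesis by blast
qed

text \<open>
  Tangency at \<open>x\<close> comes with a scale \<open>1 / (k + 1)\<close> that depends on \<open>x\<close>. Restricting to points with a common scale,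
  with \<open>P\<close> near a common plane \<open>Q\<close> from a countable dense set, and inside a ball smaller than that scale, makes the
  cone condition hold between any two points of the piece. The condition is closed in \<open>(x, P)\<close>, so the pieces are compact.
\<close>

lemma flat_pieces:
  assumes \<eta>: "0 < \<eta>" "\<eta> \<le> 1 / 2"
  shows "\<exists>F. countable F \<and> (\<forall>(A, Q)\<in>F. compact A \<and> A \<subseteq> M \<and> nearly_flat \<eta> Q A \<and> Q \<in> grassmannian d)
    \<and> (\<forall>m x P. (x, P) \<in> Ks m \<longrightarrow> (\<exists>(A, Q)\<in>F. x \<in> A \<and> dist P Q \<le> \<eta>))"
proof -
  obtain DQ :: "'a linear_subspace set" where DQ: "countable DQ" "\<And>Y. open Y \<Longrightarrow> Y \<noteq> {} \<Longrightarrow> \<exists>q\<in>DQ. q \<in> Y"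
    using countable_dense_setE by blast
  obtain DX :: "'a set" where DX: "countable DX" "\<And>Y. open Y \<Longrightarrow> Y \<noteq> {} \<Longrightarrow> \<exists>q\<in>DX. q \<in> Y"
    using countable_dense_setE by blast
  define e where "e = \<eta> / 2"
  have e: "0 < e" "e < 1" using \<eta> by (auto simp: e_def)
  define E where "E m Q k a = Ks m \<inter> {z. dist (snd z) Q \<le> e} \<inter> {z. dist a (fst z) \<le> 1 / (4 * real (Suc k))}
     \<inter> (\<Inter>y\<in>S. {z. 1 / real (Suc k) \<le> dist (fst z) y} \<union> {z. norm ((y - fst z) - orth_proj (snd z) (y - fst z)) \<le> e * norm (y - fst z)})"
    for m Q k a
  have Ec: "compact (E m Q k a)" for m Q k a
    unfolding E_def
    by (intro compact_Int_closed Ks_compact closed_INT ballI closed_Un closed_Collect_le continuous_intros)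
  define A0 where "A0 m Q k a = fst ` E m Q k a" for m Q k a
  have A0c: "compact (A0 m Q k a)" for m Q k a unfolding A0_def by (intro compact_continuous_image Ec continuous_intros)
  have A0M: "A0 m Q k a \<subseteq> M" for m Q k a unfolding A0_def M_def E_def by blast
  have A0S: "A0 m Q k a \<subseteq> S" for m Q k a using A0M MS by blast
  have flat: "nearly_flat \<eta> Q (A0 m Q k a)" for m Q k a
    unfolding nearly_flat_def
  proof (intro ballI)
    fix y z assume y: "y \<in> A0 m Q k a" and z: "z \<in> A0 m Q k a"
    obtain P where P: "(y, P) \<in> E m Q k a" using y by (auto simp: A0_def)
    have zS: "z \<in> S" using z A0S by blast
    have "dist a z \<le> 1 / (4 * real (Suc k))" "dist a y \<le> 1 / (4 * real (Suc k))" using y z by (auto simp: A0_def E_def)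
    then have "dist y z \<le> 1 / (4 * real (Suc k)) + 1 / (4 * real (Suc k))"
      using dist_triangle[of y z a] by (simp add: dist_commute)
    also have "\<dots> < 1 / real (Suc k)" by (simp add: divide_simps)
    finally have "norm ((z - y) - orth_proj P (z - y)) \<le> e * norm (z - y)"
      using P zS by (auto simp: E_def)
    moreover have "norm (orth_proj P (z - y) - orth_proj Q (z - y)) \<le> e * norm (z - y)"
    proof -
      have "dist P Q \<le> e" using P by (auto simp: E_def)
      then show ?thesis using norm_orth_proj_dist[of P "z - y" Q] by (meson mult_right_mono norm_ge_zero order_trans)
    qed
    moreover have "norm ((z - y) - orth_proj Q (z - y)) \<le> norm ((z - y) - orth_proj P (z - y)) + norm (orth_proj P (z - y) - orth_proj Q (z - y))"
      using norm_triangle_ineq[of "(z - y) - orth_proj P (z - y)" "orth_proj P (z - y) - orth_proj Q (z - y)"] by simp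
    ultimately have "norm ((z - y) - orth_proj Q (z - y)) \<le> e * norm (z - y) + e * norm (z - y)" by linarith
    then show "norm ((z - y) - orth_proj Q (z - y)) \<le> \<eta> * norm (z - y)" by (simp add: e_def)
  qed
  define F where "F = (\<Union>m. \<Union>Q\<in>DQ \<inter> grassmannian d. \<Union>k. \<Union>a\<in>DX. {(A0 m Q k a, Q)})"
  have "countable F"
    unfolding F_def using DQ(1) DX(1) by (intro countable_UN countable_Int1) auto
  moreover have "\<forall>(A, Q)\<in>F. compact A \<and> A \<subseteq> M \<and> nearly_flat \<eta> Q A \<and> Q \<in> grassmannian d"
    unfolding F_def using A0c A0M flat by auto
  moreover have "\<exists>(A, Q)\<in>F. x \<in> A \<and> dist P Q \<le> \<eta>" if xP: "(x, P) \<in> Ks m" for m x P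
  proof -
    have P: "P \<in> grassmannian d" using xP Ks_sub by blast
    obtain Q where Q: "Q \<in> DQ" "Q \<in> ball P e" using DQ(2)[of "ball P e"] e by auto
    then have PQ: "dist P Q < e" by simp
    have QG: "Q \<in> grassmannian d" using grassmannian_ball[OF P, of Q] PQ e by simp
    obtain \<rho> where \<rho>: "\<rho> > 0" "\<And>y. y \<in> S \<Longrightarrow> dist x y < \<rho> \<Longrightarrow> norm ((y - x) - orth_proj P (y - x)) \<le> e * norm (y - x)"
      using cone[OF xP e(1)] by metis
    obtain k where k: "1 / real (Suc k) < \<rho>" using \<rho>(1) nat_approx_posE by metis
    obtain a where a: "a \<in> DX" "a \<in> ball x (1 / (4 * real (Suc k)))" using DX(2)[of "ball x (1 / (4 * real (Suc k)))"] by auto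
    have "(x, P) \<in> E m Q k a"
    proof -
      have "1 / real (Suc k) \<le> dist x y \<or> norm ((y - x) - orth_proj P (y - x)) \<le> e * norm (y - x)" if "y \<in> S" for y
        using \<rho>(2)[OF that] k by linarith
      moreover have "dist a x \<le> 1 / (4 * real (Suc k))" using a(2) by (simp add: dist_commute)
      ultimately show ?thesis using xP PQ unfolding E_def by simp
    qed
    then have "x \<in> A0 m Q k a" unfolding A0_def by force
    moreover have "(A0 m Q k a, Q) \<in> F" unfolding F_def using Q(1) QG a(1) by blast
    moreover have "dist P Q \<le> \<eta>" using PQ \<eta>(1) unfolding e_def by linarith
    ultimately show ?thesis by (intro bexI[of _ "(A0 m Q k a, Q)"]) simp_all
  qed
  ultimately show ?thesis by (intro exI[of _ F]) simp
qed

lemma pieces_ae: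
  assumes \<eta>: "0 < \<eta>" "\<eta> \<le> 1 / 2"
  shows "\<exists>N. hausdorff_outer d N = 0 \<and> (\<forall>m x P. (x, P) \<in> Ks m \<longrightarrow> x \<notin> N \<longrightarrow> piece_at \<eta> x P)"
proof -
  obtain F where F: "countable F"
    "\<And>A Q. (A, Q) \<in> F \<Longrightarrow> compact A \<and> A \<subseteq> M \<and> nearly_flat \<eta> Q A \<and> Q \<in> grassmannian d"
    "\<And>m x P. (x, P) \<in> Ks m \<Longrightarrow> \<exists>(A, Q)\<in>F. x \<in> A \<and> dist P Q \<le> \<eta>"
    using flat_pieces[OF \<eta>] by fast
  define e where "e = \<eta> / 2"
  have e: "0 < e" using \<eta> by (simp add: e_def)
  define A where "A p q = fst p \<inter> {x. \<bar>\<theta> x - q\<bar> \<le> e}" for p :: "'a set \<times> 'a linear_subspace" and q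
  have "\<exists>N. hausdorff_outer d N = 0 \<and> (\<forall>x\<in>A p q - N. \<forall>P. dist P (snd p) \<le> \<eta> \<longrightarrow> piece_at \<eta> x P)"
    if p: "p \<in> F" for p q
  proof -
    have p': "compact (fst p)" "fst p \<subseteq> M" "nearly_flat \<eta> (snd p) (fst p)" "snd p \<in> grassmannian d"
      using F(2)[of "fst p" "snd p"] p by auto
    show ?thesis
    proof (rule piece_null[OF p'(1-3) _ p'(4)])
      have "{x. \<bar>\<theta> x - q\<bar> \<le> e} \<in> sets borel" using \<theta>m by measurable
      moreover have "fst p \<in> sets borel" using p'(1) by (intro borel_closed compact_imp_closed)
      ultimately show "A p q \<in> sets borel" unfolding A_def by simp
      show "A p q \<subseteq> fst p" by (auto simp: A_def)
      show "\<bar>\<theta> y - \<theta> z\<bar> \<le> \<eta>" if "y \<in> A p q" "z \<in> A p q" for y z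
      proof -
        have "\<bar>\<theta> y - q\<bar> \<le> e" "\<bar>\<theta> z - q\<bar> \<le> e" using that by (auto simp: A_def)
        moreover have "\<eta> = e + e" by (simp add: e_def)
        ultimately show ?thesis by linarith
      qed
    qed (use \<eta> in simp)
  qed
  then have "\<forall>p q. \<exists>N. p \<in> F \<longrightarrow> hausdorff_outer d N = 0 \<and> (\<forall>x\<in>A p q - N. \<forall>P. dist P (snd p) \<le> \<eta> \<longrightarrow> piece_at \<eta> x P)"
    by blast
  then obtain N where N: "\<And>p q. p \<in> F \<Longrightarrow> hausdorff_outer d (N p q) = 0"
    "\<And>p q x P. p \<in> F \<Longrightarrow> x \<in> A p q \<Longrightarrow> x \<notin> N p q \<Longrightarrow> dist P (snd p) \<le> \<eta> \<Longrightarrow> piece_at \<eta> x P"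
    unfolding choice_iff by (metis DiffI)
  define NN where "NN = (\<Union>p\<in>F. \<Union>q\<in>\<rat>. N p q)"
  have "hausdorff_outer d NN = 0"
    unfolding NN_def using F(1) by (intro hausdorff_outer_null_UN d N countable_rat) auto
  moreover have "piece_at \<eta> x P" if xP: "(x, P) \<in> Ks m" and x: "x \<notin> NN" for m x P
  proof -
    obtain p where p: "p \<in> F" "x \<in> fst p" "dist P (snd p) \<le> \<eta>" using F(3)[OF xP] by force
    obtain q where q: "q \<in> \<rat>" "\<theta> x - e < q" "q < \<theta> x + e" using Rats_dense_in_real[of "\<theta> x - e" "\<theta> x + e"] e by auto
    have "x \<in> A p q" unfolding A_def using q p(2) by auto
    moreover have "x \<notin> N p q" using x p q unfolding NN_def by blast
    ultimately show ?thesis using p by (intro N(2)[OF p(1)]) auto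
  qed
  ultimately show ?thesis by blast
qed

lemma uniformly_continuous_compact_support:
  fixes \<phi> :: "'a \<Rightarrow> real"
  assumes \<phi>: "continuous_on UNIV \<phi>" and R: "\<And>z. R \<le> norm z \<Longrightarrow> \<phi> z = 0" and w: "0 < \<omega>"
  shows "\<exists>\<delta>>0. \<forall>z w. dist z w < \<delta> \<longrightarrow> \<bar>\<phi> z - \<phi> w\<bar> \<le> \<omega>"
proof -
  have "uniformly_continuous_on (cball 0 (R + 1)) \<phi>"
    using \<phi> by (intro compact_uniformly_continuous) (auto intro: continuous_on_subset)
  then have "\<forall>e>0. \<exists>\<delta>>0. \<forall>z\<in>cball 0 (R + 1). \<forall>w\<in>cball 0 (R + 1). dist w z < \<delta> \<longrightarrow> dist (\<phi> w) (\<phi> z) < e"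
    unfolding uniformly_continuous_on_def .
  then obtain \<delta> where \<delta>: "\<delta> > 0" "\<forall>z\<in>cball 0 (R + 1). \<forall>w\<in>cball 0 (R + 1). dist w z < \<delta> \<longrightarrow> dist (\<phi> w) (\<phi> z) < \<omega>"
    using w by metis
  have "\<bar>\<phi> z - \<phi> w\<bar> \<le> \<omega>" if zw: "dist z w < min \<delta> 1" for z w
  proof (cases "z \<in> cball 0 (R + 1) \<and> w \<in> cball 0 (R + 1)")
    case True
    then have "dist (\<phi> z) (\<phi> w) < \<omega>" using \<delta>(2) zw by (simp add: dist_commute)
    then show ?thesis by (simp add: dist_real_def)
  next
    case False
    have "norm z \<le> norm w + dist z w" "norm w \<le> norm z + dist z w"
      using norm_triangle_ineq2[of z w] norm_triangle_ineq2[of w z] by (auto simp: dist_norm norm_minus_commute)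
    then have "R \<le> norm z" "R \<le> norm w" using False zw by auto
    then show ?thesis using R w by simp
  qed
  then show ?thesis using \<delta>(1) by (intro exI[of _ "min \<delta> 1"]) auto
qed

text \<open>
  The order of choices: first \<open>\<omega>\<close>, then \<open>\<delta>\<close> by uniform continuity of \<open>\<phi>\<close>, then an aperture \<open>h n\<close> so small that \<open>2 h R < \<delta>\<close> and
  that the remaining errors \<open>g\<close>, which tend to 0 with the aperture, are negligible.
\<close>

lemma blowup_limit_nonneg:
  assumes piece: "\<And>n. piece_at (1 / (real n + 2)) x P" and P: "P \<in> grassmannian d"
    and \<phi>: "continuous_on UNIV \<phi>" "\<And>z. 0 \<le> \<phi> z" and K: "compact K" "\<And>z. z \<notin> K \<Longrightarrow> \<phi> z = 0"
  shows "((\<lambda>r. (1 / r ^ d) * (\<integral>y. \<phi> ((1 / r) *\<^sub>R (y - x)) \<partial>\<mu>)) \<longlongrightarrow> \<theta> x * (\<integral>y. \<phi> y \<partial>hausdorff_on d (points P))) (at_right 0)"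
proof -
  obtain R0 where R0: "R0 > 0" "\<And>z. z \<in> K \<Longrightarrow> norm z \<le> R0" using compact_imp_bounded[OF K(1)] by (auto simp: bounded_pos)
  define R where "R = R0 + 1"
  have R: "0 < R" using R0 by (simp add: R_def)
  have \<phi>0: "\<phi> z = 0" if "R \<le> norm z" for z
  proof (rule K(2))
    show "z \<notin> K" using R0(2)[of z] that by (auto simp: R_def)
  qed
  have "bounded (\<phi> ` K)" using \<phi>(1) K(1) by (intro compact_imp_bounded compact_continuous_image) (auto intro: continuous_on_subset)
  then obtain B0 where B0: "B0 > 0" "\<And>z. z \<in> K \<Longrightarrow> norm (\<phi> z) \<le> B0" by (auto simp: bounded_pos)
  have \<phi>B: "\<phi> z \<le> B0" for z
  proof (cases "z \<in> K")
    case True then show ?thesis using B0(2)[of z] by simp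
  qed (use K(2) B0 in simp)
  define J where "J = (\<integral>y. \<phi> y \<partial>hausdorff_on d (points P))"
  show ?thesis
    unfolding J_def[symmetric]
  proof (rule tendstoI)
    fix e :: real assume e: "0 < e"
    define c where "c = \<theta> x * (C0 * c1 * (2 * R) ^ d + plane_const d * (2 * R) ^ d)"
    have c: "0 \<le> c" unfolding c_def
      using \<theta>0[of x] C0_pos c1 R plane_const_nonneg[of d] by (intro mult_nonneg_nonneg add_nonneg_nonneg zero_le_power) auto
    define \<omega> where "\<omega> = e / 4 / (c + 1)"
    have \<omega>: "0 < \<omega>" "\<omega> * c \<le> e / 4"
    proof -
      show w: "0 < \<omega>" using e c by (simp add: \<omega>_def)
      have "\<omega> * c \<le> \<omega> * (c + 1)" using w by (intro mult_left_mono) auto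
      also have "\<dots> = e / 4"
      proof -
        have "c + 1 \<noteq> 0" using c by linarith
        then have "e / 4 * (c + 1) / (c + 1) = e / 4" by (rule nonzero_mult_div_cancel_right)
        then show ?thesis by (simp only: \<omega>_def times_divide_eq_left)
      qed
      finally show "\<omega> * c \<le> e / 4" .
    qed
    obtain \<delta> where \<delta>: "\<delta> > 0" "\<And>z w. dist z w < \<delta> \<Longrightarrow> \<bar>\<phi> z - \<phi> w\<bar> \<le> \<omega>"
      using uniformly_continuous_compact_support[OF \<phi>(1) \<phi>0 \<omega>(1)] by metis
    define h where "h n = 1 / (real n + 2)" for n :: nat
    have h0: "h \<longlonglongrightarrow> 0" unfolding h_def using LIMSEQ_ignore_initial_segment[OF lim_1_over_n[where 'a = real], of 2] by (simp add: add.commute)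
    have h: "0 \<le> h n" "h n \<le> 1 / 2" for n by (auto simp: h_def divide_simps)
    define g where "g \<eta> = \<eta> * B0 * (C0 * c1 * R ^ d) + \<theta> x * (2 * (((1 / (1 - \<eta>)) ^ d - 1) * (B0 * (plane_const d * R ^ d))))" for \<eta>
    have "(\<lambda>n. g (h n)) \<longlonglongrightarrow> 0 * B0 * (C0 * c1 * R ^ d) + \<theta> x * (2 * (((1 / (1 - 0)) ^ d - 1) * (B0 * (plane_const d * R ^ d))))"
      unfolding g_def by (intro tendsto_intros h0) simp
    then have "(\<lambda>n. g (h n)) \<longlonglongrightarrow> 0" by simp
    then have ev1: "eventually (\<lambda>n. g (h n) < e / 4) sequentially" using e by (intro order_tendstoD(2)) auto
    have "(\<lambda>n. 2 * h n * R) \<longlonglongrightarrow> 2 * 0 * R" by (intro tendsto_intros h0)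
    then have ev2: "eventually (\<lambda>n. 2 * h n * R < \<delta>) sequentially" using \<delta>(1) by (intro order_tendstoD(2)) auto
    obtain n where n: "g (h n) < e / 4" "2 * h n * R < \<delta>"
      using eventually_happens'[OF _ eventually_conj[OF ev1 ev2]] by auto
    have "piece_at (h n) x P" using piece by (simp add: h_def)
    then have "eventually (\<lambda>r. \<bar>(1 / r ^ d) * (\<integral>y. \<phi> ((1 / r) *\<^sub>R (y - x)) \<partial>\<mu>) - \<theta> x * J\<bar>
        \<le> e / 4 + blowup_error (h n) \<omega> B0 R (\<theta> x)) (at_right 0)"
      unfolding J_def
    proof (rule blowup_estimate[OF _ P h \<phi> \<phi>B \<phi>0 _ R])
      show "\<bar>\<phi> z - \<phi> w\<bar> \<le> \<omega>" if "dist z w \<le> 2 * h n * R" for z w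
        using that n(2) by (intro \<delta>(2)) simp
    qed (use e in auto)
    moreover have "blowup_error (h n) \<omega> B0 R (\<theta> x) = g (h n) + \<omega> * c"
      unfolding blowup_error_def g_def c_def by (simp add: algebra_simps)
    ultimately show "eventually (\<lambda>r. dist ((1 / r ^ d) * (\<integral>y. \<phi> ((1 / r) *\<^sub>R (y - x)) \<partial>\<mu>)) (\<theta> x * J) < e) (at_right 0)"
      using n(1) \<omega>(2) e by (auto elim!: eventually_mono simp: dist_real_def)
  qed
qed

lemma blowup_approx_tangent:
  assumes piece: "\<And>n. piece_at (1 / (real n + 2)) x P" and P: "P \<in> grassmannian d"
  shows "is_approx_tangent d M \<theta> x P"
  unfolding is_approx_tangent_def dens
proof (intro conjI P ballI)
  fix \<phi> :: "'a \<Rightarrow> real" assume "\<phi> \<in> Cc UNIV"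
  then obtain K where \<phi>: "continuous_on UNIV \<phi>" and K: "compact K" "\<And>z. z \<notin> K \<Longrightarrow> \<phi> z = 0" by (auto simp: Cc_def)
  define p q where "p z = max 0 (\<phi> z)" and "q z = max 0 (- \<phi> z)" for z
  have pc: "continuous_on UNIV p" "continuous_on UNIV q" unfolding p_def q_def using \<phi> by (auto intro!: continuous_intros)
  have p0: "z \<notin> K \<Longrightarrow> p z = 0" "z \<notin> K \<Longrightarrow> q z = 0" for z using K(2) by (auto simp: p_def q_def)
  have pn: "0 \<le> p z" "0 \<le> q z" for z by (auto simp: p_def q_def)
  have pq: "\<phi> z = p z - q z" for z by (auto simp: p_def q_def)
  have Kb: "K \<in> sets borel" using K(1) by (intro borel_closed compact_imp_closed)
  have bdd: "\<exists>B. \<forall>z. \<bar>f z\<bar> \<le> B" if f: "continuous_on UNIV f" "\<And>z. z \<notin> K \<Longrightarrow> f z = 0" for f :: "'a \<Rightarrow> real"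
  proof -
    have "bounded (f ` K)" using f(1) K(1) by (intro compact_imp_bounded compact_continuous_image) (auto intro: continuous_on_subset)
    then obtain B0 where B0: "B0 > 0" "\<And>z. z \<in> K \<Longrightarrow> norm (f z) \<le> B0" by (auto simp: bounded_pos)
    have "\<bar>f z\<bar> \<le> B0" for z using B0(2)[of z] f(2)[of z] B0(1) by (cases "z \<in> K") auto
    then show ?thesis by blast
  qed
  have int1: "integrable \<mu> (\<lambda>y. f ((1 / r) *\<^sub>R (y - x)))" if f: "continuous_on UNIV f" "\<And>z. z \<notin> K \<Longrightarrow> f z = 0" for f :: "'a \<Rightarrow> real" and r
  proof -
    obtain B where B: "\<And>z. \<bar>f z\<bar> \<le> B" using bdd[OF f] by blast
    show ?thesis
      by (rule integrable_bounded_support[where C = UNIV and B = B])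
        (use B sets_\<mu> in \<open>auto simp: emeasure_\<mu> intro!: borel_measurable_continuous_onI continuous_on_compose2[OF f(1)] continuous_intros\<close>)
  qed
  have int2: "integrable (hausdorff_on d (points P)) f" if f: "continuous_on UNIV f" "\<And>z. z \<notin> K \<Longrightarrow> f z = 0" for f :: "'a \<Rightarrow> real"
  proof -
    obtain B where B: "\<And>z. \<bar>f z\<bar> \<le> B" using bdd[OF f] by blast
    show ?thesis
    proof (rule integrable_bounded_support[where C = K and B = B])
      show "emeasure (hausdorff_on d (points P)) K < \<infinity>"
        using hausdorff_outer_subspace_finite[OF d P compact_imp_bounded[OF K(1)]] Kb by (simp add: emeasure_hausdorff_on[OF d] Int_commute)
    qed (use B Kb f in \<open>auto intro: borel_measurable_continuous_onI\<close>)
  qed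
  have "((\<lambda>r. (1 / r ^ d) * (\<integral>y. p ((1 / r) *\<^sub>R (y - x)) \<partial>\<mu>) - (1 / r ^ d) * (\<integral>y. q ((1 / r) *\<^sub>R (y - x)) \<partial>\<mu>))
      \<longlongrightarrow> \<theta> x * (\<integral>y. p y \<partial>hausdorff_on d (points P)) - \<theta> x * (\<integral>y. q y \<partial>hausdorff_on d (points P))) (at_right 0)"
    by (intro tendsto_diff blowup_limit_nonneg[OF piece P _ _ K(1)] pc pn p0)
  moreover have "(1 / r ^ d) * (\<integral>y. \<phi> ((1 / r) *\<^sub>R (y - x)) \<partial>\<mu>)
      = (1 / r ^ d) * (\<integral>y. p ((1 / r) *\<^sub>R (y - x)) \<partial>\<mu>) - (1 / r ^ d) * (\<integral>y. q ((1 / r) *\<^sub>R (y - x)) \<partial>\<mu>)" for r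
    unfolding pq using int1[OF pc(1) p0(1)] int1[OF pc(2) p0(2)] by (simp add: right_diff_distrib)
  moreover have "\<theta> x * (\<integral>y. \<phi> y \<partial>hausdorff_on d (points P))
      = \<theta> x * (\<integral>y. p y \<partial>hausdorff_on d (points P)) - \<theta> x * (\<integral>y. q y \<partial>hausdorff_on d (points P))"
    unfolding pq using int2[OF pc(1) p0(1)] int2[OF pc(2) p0(2)] by (simp add: right_diff_distrib)
  ultimately show "((\<lambda>r. (1 / r ^ d) * (\<integral>y. \<phi> ((1 / r) *\<^sub>R (y - x)) \<partial>\<mu>)) \<longlongrightarrow> \<theta> x * (\<integral>y. \<phi> y \<partial>hausdorff_on d (points P))) (at_right 0)"
    by simp
qed

lemma approx_tangent_ae:
  "\<exists>N. hausdorff_outer d N = 0 \<and> (\<forall>m x P. (x, P) \<in> Ks m \<longrightarrow> x \<notin> N \<longrightarrow> is_approx_tangent d M \<theta> x P)"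
proof -
  have "\<forall>n::nat. \<exists>N. hausdorff_outer d N = 0 \<and> (\<forall>m x P. (x, P) \<in> Ks m \<longrightarrow> x \<notin> N \<longrightarrow> piece_at (1 / (real n + 2)) x P)"
    by (intro allI pieces_ae) (auto simp: divide_simps)
  then obtain N where N: "\<And>n::nat. hausdorff_outer d (N n) = 0"
    "\<And>n m x P. (x, P) \<in> Ks m \<Longrightarrow> x \<notin> N n \<Longrightarrow> piece_at (1 / (real n + 2)) x P"
    unfolding choice_iff by metis
  have "hausdorff_outer d (\<Union>n. N n) = 0" using N(1) by (intro hausdorff_outer_null_UN d) auto
  moreover have "is_approx_tangent d M \<theta> x P" if "(x, P) \<in> Ks m" "x \<notin> (\<Union>n. N n)" for m x P
    using that Ks_sub N(2) by (intro blowup_approx_tangent) auto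
  ultimately show ?thesis by blast
qed

end

section \<open>Rectifiability and the tangent map\<close>

text \<open>
  McShane's extension, applied to each coordinate of the inverse of the projection: the formula \<open>g\<close> is the largest
  2-Lipschitz function that agrees with the coordinate on the projection of \<open>A\<close>. An orthonormal basis of \<open>Q\<close>
  identifies \<open>\<real>\<^sup>d\<close> with \<open>Q\<close>.
\<close>

lemma nearly_flat_Lipschitz_param:
  fixes A :: "'a::euclidean_space set"
  assumes flat: "nearly_flat (1 / 2) Q A" and Q: "Q \<in> grassmannian d"
  shows "\<exists>(f :: (nat \<Rightarrow> real) \<Rightarrow> 'a) L. (\<forall>u\<in>{..<d} \<rightarrow>\<^sub>E UNIV. \<forall>v\<in>{..<d} \<rightarrow>\<^sub>E UNIV. dist (f u) (f v) \<le> L * L2_set (\<lambda>k. u k - v k) {..<d})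
     \<and> A \<subseteq> f ` ({..<d} \<rightarrow>\<^sub>E UNIV)"
proof (cases "A = {}")
  case True
  have "dist 0 (0 :: 'a) \<le> 0 * L2_set (\<lambda>k. u k - v k) {..<d}" for u v by simp
  then show ?thesis using True by (intro exI[of _ "\<lambda>_. 0 :: 'a"] exI[of _ "0 :: real"]) simp
next
  case False
  obtain b where b: "\<And>i. i < d \<Longrightarrow> norm (b i) = 1" "\<And>i j. i < d \<Longrightarrow> j < d \<Longrightarrow> i \<noteq> j \<Longrightarrow> b i \<bullet> b j = 0"
    "\<And>x. x \<in> points Q \<Longrightarrow> x = (\<Sum>i<d. (x \<bullet> b i) *\<^sub>R b i)"
    using subspace_coordinates[OF Q] by metis
  define emb where "emb u = (\<Sum>k<d. u k *\<^sub>R b k)" for u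
  have emb_dist: "dist (emb u) (emb v) = L2_set (\<lambda>k. u k - v k) {..<d}" for u v
  proof -
    have "emb u - emb v = (\<Sum>k<d. (u k - v k) *\<^sub>R b k)" by (simp add: emb_def sum_subtractf scaleR_diff_left)
    then have "(norm (emb u - emb v))\<^sup>2 = (norm (\<Sum>k<d. (u k - v k) *\<^sub>R b k))\<^sup>2" by simp
    also have "\<dots> = (\<Sum>k<d. (norm ((u k - v k) *\<^sub>R b k))\<^sup>2)"
      by (rule norm_sum_Pythagorean) (auto simp: pairwise_def orthogonal_def b(2))
    also have "\<dots> = (\<Sum>k<d. (u k - v k)\<^sup>2)" by (intro sum.cong) (auto simp: b(1) power_mult_distrib)
    finally have "norm (emb u - emb v) = sqrt (\<Sum>k<d. (u k - v k)\<^sup>2)" by (metis norm_ge_zero real_sqrt_unique)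
    then show ?thesis by (simp add: dist_norm L2_set_def)
  qed
  define g where "g u e = (INF y\<in>A. y \<bullet> e + 2 * dist (emb u) (orth_proj Q y))" for u and e :: 'a
  have exp: "dist z y \<le> 2 * dist (orth_proj Q z) (orth_proj Q y)" if "y \<in> A" "z \<in> A" for y z
    using nearly_flat_expand[OF flat that] by simp
  have inner_le: "y \<bullet> e \<le> z \<bullet> e + 2 * dist (orth_proj Q y) (orth_proj Q z)" if "y \<in> A" "z \<in> A" "e \<in> Basis" for y z e
  proof -
    have "(y - z) \<bullet> e \<le> norm (y - z)" using that(3) by (metis Basis_le_norm abs_le_D1)
    also have "\<dots> \<le> 2 * dist (orth_proj Q y) (orth_proj Q z)" using exp[OF that(2,1)] by (simp add: dist_norm)
    finally show ?thesis by (simp add: inner_diff_left)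
  qed
  have bdd: "bdd_below ((\<lambda>y. y \<bullet> e + 2 * dist (emb u) (orth_proj Q y)) ` A)" if e: "e \<in> Basis" for u e
  proof -
    obtain y0 where y0: "y0 \<in> A" using False by blast
    have "y0 \<bullet> e - 2 * dist (emb u) (orth_proj Q y0) \<le> y \<bullet> e + 2 * dist (emb u) (orth_proj Q y)" if "y \<in> A" for y
      using inner_le[OF y0 that e] dist_triangle[of "orth_proj Q y0" "orth_proj Q y" "emb u"] by (simp add: dist_commute)
    then show ?thesis unfolding bdd_below_def by blast
  qed
  have g_le: "g u e \<le> g v e + 2 * dist (emb u) (emb v)" if e: "e \<in> Basis" for u v e
  proof -
    have "g u e - 2 * dist (emb u) (emb v) \<le> y \<bullet> e + 2 * dist (emb v) (orth_proj Q y)" if y: "y \<in> A" for y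
    proof -
      have "g u e \<le> y \<bullet> e + 2 * dist (emb u) (orth_proj Q y)" unfolding g_def by (rule cINF_lower[OF bdd[OF e] y])
      then show ?thesis using dist_triangle[of "emb u" "orth_proj Q y" "emb v"] by simp
    qed
    then have "g u e - 2 * dist (emb u) (emb v) \<le> g v e" unfolding g_def[of v] by (intro cINF_greatest False)
    then show ?thesis by simp
  qed
  have g_eq: "g u e = y \<bullet> e" if "y \<in> A" "emb u = orth_proj Q y" "e \<in> Basis" for u y e
  proof (rule antisym)
    show "g u e \<le> y \<bullet> e" unfolding g_def using cINF_lower[OF bdd[OF that(3)] that(1), of u] that(2) by simp
    show "y \<bullet> e \<le> g u e" unfolding g_def using inner_le[OF that(1) _ that(3)] that(2) by (intro cINF_greatest False) simp
  qed
  define f where "f u = (\<Sum>e\<in>Basis. g u e *\<^sub>R e)" for u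
  have "dist (f u) (f v) \<le> (2 * real DIM('a)) * L2_set (\<lambda>k. u k - v k) {..<d}" for u v
  proof -
    have "f u - f v = (\<Sum>e\<in>Basis. (g u e - g v e) *\<^sub>R e)" by (simp add: f_def sum_subtractf scaleR_diff_left)
    then have "dist (f u) (f v) = norm (\<Sum>e\<in>Basis. (g u e - g v e) *\<^sub>R e)" by (simp add: dist_norm)
    also have "\<dots> \<le> (\<Sum>e\<in>(Basis :: 'a set). 2 * dist (emb u) (emb v))"
    proof (rule sum_norm_le)
      fix e :: 'a assume e: "e \<in> Basis"
      have "\<bar>g u e - g v e\<bar> \<le> 2 * dist (emb u) (emb v)"
        using g_le[OF e, of u v] g_le[OF e, of v u] by (simp add: dist_commute)
      then show "norm ((g u e - g v e) *\<^sub>R e) \<le> 2 * dist (emb u) (emb v)" using e by simp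
    qed
    finally show ?thesis by (simp add: emb_dist)
  qed
  moreover have "A \<subseteq> f ` ({..<d} \<rightarrow>\<^sub>E UNIV)"
  proof
    fix y assume y: "y \<in> A"
    define u where "u = restrict (\<lambda>k. orth_proj Q y \<bullet> b k) {..<d}"
    have "emb u = orth_proj Q y" using b(3)[OF orth_proj_in, of y] by (simp add: emb_def u_def)
    then have "f u = (\<Sum>e\<in>Basis. (y \<bullet> e) *\<^sub>R e)" unfolding f_def using g_eq[OF y] by (intro sum.cong) auto
    then have "f u = y" by (simp add: euclidean_representation)
    moreover have "u \<in> {..<d} \<rightarrow>\<^sub>E UNIV" by (auto simp: u_def)
    ultimately show "y \<in> f ` ({..<d} \<rightarrow>\<^sub>E UNIV)" by blast
  qed
  ultimately show ?thesis by blast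
qed

lemma countably_rectifiable_UN_flat:
  fixes F :: "('a::euclidean_space set \<times> 'a linear_subspace) set"
  assumes d: "1 \<le> d" and F: "countable F" "\<And>A Q. (A, Q) \<in> F \<Longrightarrow> nearly_flat (1 / 2) Q A \<and> Q \<in> grassmannian d"
    and M: "\<And>x. x \<in> M \<Longrightarrow> \<exists>(A, Q)\<in>F. x \<in> A"
  shows "countably_rectifiable d M"
proof (cases "F = {}")
  case True
  then have "M = {}" using M by blast
  then show ?thesis
    unfolding countably_rectifiable_def
    by (intro exI[of _ "{}"] exI[of _ "\<lambda>_ _. 0"]) (auto simp: hausdorff_outer_empty[OF d] intro: exI[of _ 0])
next
  case False
  define p where "p = from_nat_into F"
  have p: "p i \<in> F" for i unfolding p_def by (rule from_nat_into[OF False])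
  have "\<exists>f :: (nat \<Rightarrow> real) \<Rightarrow> 'a. (\<exists>L. \<forall>u\<in>{..<d} \<rightarrow>\<^sub>E UNIV. \<forall>v\<in>{..<d} \<rightarrow>\<^sub>E UNIV. dist (f u) (f v) \<le> L * L2_set (\<lambda>k. u k - v k) {..<d})
     \<and> fst (p i) \<subseteq> f ` ({..<d} \<rightarrow>\<^sub>E UNIV)" for i
  proof -
    have "nearly_flat (1 / 2) (snd (p i)) (fst (p i))" "snd (p i) \<in> grassmannian d"
      using F(2)[of "fst (p i)" "snd (p i)"] p[of i] by simp_all
    from nearly_flat_Lipschitz_param[OF this] show ?thesis by metis
  qed
  then obtain f :: "nat \<Rightarrow> (nat \<Rightarrow> real) \<Rightarrow> 'a" where f:
    "\<And>i. \<exists>L. \<forall>u\<in>{..<d} \<rightarrow>\<^sub>E UNIV. \<forall>v\<in>{..<d} \<rightarrow>\<^sub>E UNIV. dist (f i u) (f i v) \<le> L * L2_set (\<lambda>k. u k - v k) {..<d}"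
    "\<And>i. fst (p i) \<subseteq> f i ` ({..<d} \<rightarrow>\<^sub>E UNIV)" by metis
  have "M \<subseteq> (\<Union>i. f i ` ({..<d} \<rightarrow>\<^sub>E UNIV))"
  proof
    fix x assume "x \<in> M"
    from M[OF this] obtain q where q: "q \<in> F" "x \<in> fst q" by auto
    obtain i where "p i = q" using from_nat_into_surj[OF F(1) q(1)] by (auto simp: p_def)
    then have "x \<in> f i ` ({..<d} \<rightarrow>\<^sub>E UNIV)" using q(2) f(2)[of i] by (auto simp only: subset_iff)
    then show "x \<in> (\<Union>i. f i ` ({..<d} \<rightarrow>\<^sub>E UNIV))" by (rule UN_I[OF UNIV_I])
  qed
  then show ?thesis
    unfolding countably_rectifiable_def using f(1)
    by (intro exI[of _ "{}"] exI[of _ f]) (auto simp: hausdorff_outer_empty[OF d])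
qed

lemma countably_rectifiable_subset: "countably_rectifiable d M \<Longrightarrow> N \<subseteq> M \<Longrightarrow> countably_rectifiable d N"
  unfolding countably_rectifiable_def by (meson order_trans)

context tangential_density begin

lemma M_rectifiable: "countably_rectifiable d M"
proof -
  have half: "0 < (1 / 2 :: real)" "(1 / 2 :: real) \<le> 1 / 2" by simp_all
  obtain F where F: "countable F"
    "\<And>A Q. (A, Q) \<in> F \<Longrightarrow> compact A \<and> A \<subseteq> M \<and> nearly_flat (1 / 2) Q A \<and> Q \<in> grassmannian d"
    "\<And>m x P. (x, P) \<in> Ks m \<Longrightarrow> \<exists>(A, Q)\<in>F. x \<in> A \<and> dist P Q \<le> 1 / 2"
    using flat_pieces[OF half] by fast
  show ?thesis
  proof (rule countably_rectifiable_UN_flat[OF d F(1)])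
    show "\<exists>(A, Q)\<in>F. x \<in> A" if x: "x \<in> M" for x
    proof -
      have "x \<in> (\<Union>m. fst ` Ks m)" using x by (simp only: M_def)
      then obtain m P where "(x, P) \<in> Ks m" by auto
      from F(3)[OF this] show ?thesis by auto
    qed
  qed (use F(2) in blast)
qed

text \<open>
  The lower density bound forces the blow-up limit \<open>\<theta>(x) \<H>\<^sup>d\<close> on \<open>P\<close> to be non-zero, hence by scaling to charge every
  neighbourhood of every point of \<open>P\<close>. A bump about a point of \<open>P\<close> outside \<open>P'\<close> would be seen by one limit only.
\<close>

lemma approx_tangent_unique:
  assumes x: "x \<in> S" and P: "is_approx_tangent d M \<theta> x P" and P': "is_approx_tangent d M \<theta> x P'"
  shows "points P \<subseteq> points P'"
proof (rule ccontr)
  assume "\<not> points P \<subseteq> points P'"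
  then obtain p where p: "p \<in> points P" "p \<notin> points P'" by blast
  define J J' where "J \<phi> = (\<integral>y. \<phi> y \<partial>hausdorff_on d (points P))" and "J' \<phi> = (\<integral>y. \<phi> y \<partial>hausdorff_on d (points P'))" for \<phi> :: "'a \<Rightarrow> real"
  have PG: "P \<in> grassmannian d" using P by (simp add: is_approx_tangent_def)
  have lim: "((\<lambda>r. (1 / r ^ d) * (\<integral>y. \<phi> ((1 / r) *\<^sub>R (y - x)) \<partial>\<mu>)) \<longlongrightarrow> \<theta> x * J \<phi>) (at_right 0)"
    "((\<lambda>r. (1 / r ^ d) * (\<integral>y. \<phi> ((1 / r) *\<^sub>R (y - x)) \<partial>\<mu>)) \<longlongrightarrow> \<theta> x * J' \<phi>) (at_right 0)" if "\<phi> \<in> Cc UNIV" for \<phi>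
    using P P' that unfolding is_approx_tangent_def dens J_def J'_def by blast+
  have eq: "\<theta> x * J \<phi> = \<theta> x * J' \<phi>" if "\<phi> \<in> Cc UNIV" for \<phi>
    using tendsto_unique[OF _ lim[OF that]] by simp
  define \<phi>0 where "\<phi>0 z = max 0 (min 1 (2 - norm z))" for z :: 'a
  have c0': "continuous_on UNIV \<phi>0" unfolding \<phi>0_def by (intro continuous_intros)
  have \<phi>0: "\<phi>0 \<in> Cc UNIV"
    unfolding Cc_def using c0' by (auto intro!: exI[of _ "cball 0 2"] simp: \<phi>0_def)
  have pos: "c0 \<le> \<theta> x * J \<phi>0"
  proof (rule tendsto_lowerbound[OF lim(1)[OF \<phi>0]])
    obtain \<rho> where \<rho>: "\<rho> > 0" "\<And>r. r < \<rho> \<Longrightarrow> cball x (8 * r) \<subseteq> \<Omega>" using local_scale[OF x] by blast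
    show "eventually (\<lambda>r. c0 \<le> (1 / r ^ d) * (\<integral>y. \<phi>0 ((1 / r) *\<^sub>R (y - x)) \<partial>\<mu>)) (at_right 0)"
      unfolding eventually_at_right[OF zero_less_one]
    proof (intro exI[of _ \<rho>] conjI \<rho>(1) allI impI)
      fix r assume r: "0 < r" "r < \<rho>"
      have m: "(\<lambda>y. \<phi>0 ((1 / r) *\<^sub>R (y - x))) \<in> borel_measurable borel"
        by (intro borel_measurable_continuous_onI continuous_on_compose2[OF c0']) (auto intro!: continuous_intros)
      have i: "integrable \<mu> (\<lambda>y. \<phi>0 ((1 / r) *\<^sub>R (y - x)))"
        by (rule integrable_bounded_support[OF m sets_\<mu>, where C = UNIV and B = 1]) (auto simp: \<phi>0_def emeasure_\<mu>)
      have "c0 * r ^ d \<le> measure \<mu> (cball x r)" using x r \<rho>(2) by (intro low) auto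
      also have "\<dots> = (\<integral>y. indicat_real (cball x r) y \<partial>\<mu>)" by simp
      also have "\<dots> \<le> (\<integral>y. \<phi>0 ((1 / r) *\<^sub>R (y - x)) \<partial>\<mu>)"
      proof (rule integral_mono[OF _ i])
        show "integrable \<mu> (indicat_real (cball x r))" by (intro integrable_real_indicator) (auto simp: sets_\<mu> emeasure_\<mu>)
        fix y
        show "indicat_real (cball x r) y \<le> \<phi>0 ((1 / r) *\<^sub>R (y - x))"
        proof (cases "y \<in> cball x r")
          case True
          then have "norm ((1 / r) *\<^sub>R (y - x)) \<le> 1" using r by (simp add: dist_norm norm_minus_commute)
          then show ?thesis by (simp add: \<phi>0_def indicator_def)
        qed (simp add: \<phi>0_def)
      qed
      finally show "c0 \<le> (1 / r ^ d) * (\<integral>y. \<phi>0 ((1 / r) *\<^sub>R (y - x)) \<partial>\<mu>)" using r by (simp add: pos_le_divide_eq)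
    qed
  qed simp
  then have t: "0 < \<theta> x * J \<phi>0" using c0 by linarith
  then have \<theta>: "0 < \<theta> x" and J0: "0 < J \<phi>0" using \<theta>0[of x] by (auto simp: zero_less_mult_iff)
  define s where "s = infdist p (points P')"
  have s: "0 < s"
    unfolding s_def using p(2) closed_subspace[OF subspace_points, of P'] orth_proj_in[of P' p]
    by (intro infdist_pos_not_in_closed) auto
  define \<phi>1 where "\<phi>1 z = max 0 (1 - dist z p / s)" for z
  have c1': "continuous_on UNIV \<phi>1" unfolding \<phi>1_def using s by (intro continuous_intros) auto
  have \<phi>10: "\<phi>1 z = 0" if "s \<le> dist z p" for z using that s by (simp add: \<phi>1_def)
  have \<phi>1: "\<phi>1 \<in> Cc UNIV"
  proof -
    have "\<forall>z. z \<notin> cball p s \<longrightarrow> \<phi>1 z = 0" by (intro allI impI \<phi>10) (simp add: dist_commute)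
    then show ?thesis unfolding Cc_def using c1' by (auto intro!: exI[of _ "cball p s"])
  qed
  have "J' \<phi>1 = 0"
  proof -
    have "J' \<phi>1 = (\<integral>y. 0 \<partial>hausdorff_on d (points P'))"
      unfolding J'_def
    proof (rule integral_cong_AE)
      have "AE y in hausdorff_on d (points P'). y \<in> points P'"
        by (intro hausdorff_on_AE_mem d borel_closed closed_subspace subspace_points)
      then show "AE y in hausdorff_on d (points P'). \<phi>1 y = 0"
      proof eventually_elim
        case (elim y)
        show ?case using infdist_le[OF elim, of p] by (intro \<phi>10) (simp add: s_def dist_commute)
      qed
    qed (use c1' in \<open>auto simp: measurable_cong_sets[OF sets_hausdorff_on refl] borel_measurable_continuous_onI\<close>)
    then show ?thesis by simp
  qed
  then have "J \<phi>1 = 0" using eq[OF \<phi>1] \<theta> by simp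
  define r where "r = s / 4"
  have r: "0 < r" using s by (simp add: r_def)
  have fin: "emeasure (hausdorff_on d (points P)) (cball p s) < \<infinity>"
    using hausdorff_outer_subspace_finite[OF d PG, of "cball p s"] by (simp add: emeasure_hausdorff_on[OF d] Int_commute)
  have m0: "(\<lambda>u. \<phi>0 ((1 / r) *\<^sub>R (u - p))) \<in> borel_measurable borel"
    by (intro borel_measurable_continuous_onI continuous_on_compose2[OF c0']) (auto intro!: continuous_intros)
  have m1: "\<phi>1 \<in> borel_measurable borel" using c1' by (rule borel_measurable_continuous_onI)
  have z0: "\<phi>0 ((1 / r) *\<^sub>R (u - p)) = 0" if "s / 2 \<le> dist u p" for u
  proof -
    have "2 \<le> norm ((1 / r) *\<^sub>R (u - p))" using that s by (simp add: r_def dist_norm pos_le_divide_eq)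
    then show ?thesis by (simp add: \<phi>0_def)
  qed
  have i0: "integrable (hausdorff_on d (points P)) (\<lambda>u. \<phi>0 ((1 / r) *\<^sub>R (u - p)))"
    by (rule integrable_bounded_support[OF m0 sets_hausdorff_on _ fin, of 1])
      (use z0 s in \<open>auto simp: \<phi>0_def dist_commute\<close>)
  have i1: "integrable (hausdorff_on d (points P)) \<phi>1"
    by (rule integrable_bounded_support[OF m1 sets_hausdorff_on _ fin, of 1])
      (use \<phi>10 s in \<open>auto simp: \<phi>1_def dist_commute\<close>)
  have "r ^ d * J \<phi>0 = (\<integral>u. \<phi>0 ((1 / r) *\<^sub>R (u - p)) \<partial>hausdorff_on d (points P))"
    unfolding J_def by (rule integral_plane_scale[OF d p(1) r borel_measurable_continuous_onI[OF c0'], symmetric])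
  also have "\<dots> \<le> (\<integral>u. 2 * \<phi>1 u \<partial>hausdorff_on d (points P))"
  proof (rule integral_mono[OF i0])
    fix u
    show "\<phi>0 ((1 / r) *\<^sub>R (u - p)) \<le> 2 * \<phi>1 u"
    proof (cases "s / 2 \<le> dist u p")
      case True then show ?thesis using z0[OF True] by (simp add: \<phi>1_def)
    next
      case False
      then have "1 / 2 \<le> \<phi>1 u" using s by (simp add: \<phi>1_def pos_divide_le_eq field_simps)
      then show ?thesis by (simp add: \<phi>0_def)
    qed
  qed (use i1 in simp)
  also have "\<dots> = 2 * J \<phi>1" using i1 by (simp add: J_def)
  finally show False using \<open>J \<phi>1 = 0\<close> mult_pos_pos[OF zero_less_power[OF r, of d] J0] by simp
qed

lemma approx_tangent_unique_eq:
  assumes "x \<in> S" "is_approx_tangent d M \<theta> x P" "is_approx_tangent d M \<theta> x P'"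
  shows "P = P'"
proof -
  have "points P = points P'"
    using approx_tangent_unique[OF assms] approx_tangent_unique[OF assms(1,3,2)] by blast
  then show ?thesis by (simp add: points_inject)
qed

text \<open>
  The set \<open>D\<close> of points with more than one plane is \<open>\<sigma>\<close>-compact, hence Borel, and it is null because approximate tangent planes are
  unique. Off \<open>D\<close> the union of the \<open>Ks m\<close> is the graph of a map \<open>T\<close>, which is Borel because the preimage of a
  closed set is again a projection of compact sets. Discarding a null set changes neither \<open>\<H>\<^sup>d\<close> on \<open>M\<close> nor the tangent planes.
\<close>

lemma rectifiable_structure:
  "\<exists>M' T. M' \<subseteq> M \<and> M' \<in> sets borel \<and> hausdorff_outer d {x \<in> M'. \<not> is_approx_tangent d M' \<theta> x (T x)} = 0
     \<and> T \<in> borel_measurable borel \<and> hausdorff_on d M' = H \<and> emeasure \<mu> (- M') = 0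
     \<and> (\<forall>m x P. (x, P) \<in> Ks m \<longrightarrow> x \<in> M' \<longrightarrow> T x = P)"
proof -
  obtain N where N: "hausdorff_outer d N = 0" "\<And>m x P. (x, P) \<in> Ks m \<Longrightarrow> x \<notin> N \<Longrightarrow> is_approx_tangent d M \<theta> x P"
    using approx_tangent_ae by blast
  define Z where "Z m n k = {(x, P, P'). (x, P) \<in> Ks m \<and> (x, P') \<in> Ks n \<and> 1 / real (Suc k) \<le> dist P P'}" for m n k
  have Zc: "compact (Z m n k)" for m n k
  proof -
    have "compact (Ks m \<times> Ks n)" by (intro compact_Times Ks_compact)
    then have "compact ((Ks m \<times> Ks n) \<inter> ({q. fst (fst q) = fst (snd q)} \<inter> {q. 1 / real (Suc k) \<le> dist (snd (fst q)) (snd (snd q))}))"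
      by (intro compact_Int_closed closed_Int closed_Collect_eq closed_Collect_le continuous_intros)
    then have "compact ((\<lambda>q. (fst (fst q), snd (fst q), snd (snd q))) `
        ((Ks m \<times> Ks n) \<inter> ({q. fst (fst q) = fst (snd q)} \<inter> {q. 1 / real (Suc k) \<le> dist (snd (fst q)) (snd (snd q))})))"
      by (intro compact_continuous_image continuous_intros)
    also have "\<dots> = Z m n k" unfolding Z_def by (force simp: image_iff)
    finally show ?thesis .
  qed
  define D where "D = (\<Union>m n k. fst ` Z m n k)"
  have Db: "D \<in> sets borel"
    unfolding D_def by (intro sets.countable_UN'' borel_closed compact_imp_closed compact_continuous_image Zc continuous_intros) auto
  have DM: "D \<subseteq> M" unfolding D_def Z_def M_def by force
  have "D \<subseteq> N"
  proof
    fix x assume "x \<in> D"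
    then obtain m n k P P' where P: "(x, P) \<in> Ks m" "(x, P') \<in> Ks n" "1 / real (Suc k) \<le> dist P P'"
      unfolding D_def Z_def by auto
    then have "P \<noteq> P'" by auto
    show "x \<in> N"
    proof (rule ccontr)
      assume "x \<notin> N"
      then have "is_approx_tangent d M \<theta> x P" "is_approx_tangent d M \<theta> x P'" using N(2) P by blast+
      moreover have "x \<in> S" using \<open>x \<in> D\<close> DM MS by blast
      ultimately show False using approx_tangent_unique_eq \<open>P \<noteq> P'\<close> by blast
    qed
  qed
  then have D0: "hausdorff_outer d D = 0" using N(1) by (rule hausdorff_outer_null_mono[rotated])
  define M' where "M' = M - D"
  have M'b: "M' \<in> sets borel" using M_borel Db by (simp add: M'_def)
  have uniq: "P = P'" if "(x, P) \<in> Ks m" "(x, P') \<in> Ks n" "x \<in> M'" for x P P' m n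
  proof (rule ccontr)
    assume "P \<noteq> P'"
    then obtain k where "1 / real (Suc k) < dist P P'" using nat_approx_posE[of "dist P P'"] by auto
    then have "(x, P, P') \<in> Z m n k" using that by (simp add: Z_def)
    then have "x \<in> D" unfolding D_def by force
    then show False using that by (simp add: M'_def)
  qed
  have HM': "hausdorff_on d M' = H"
  proof (rule measure_eqI)
    fix B assume "B \<in> sets (hausdorff_on d M')"
    then have B: "B \<in> sets borel" by simp
    have "hausdorff_outer d (B \<inter> M) \<le> hausdorff_outer d ((B \<inter> M') \<union> D)" by (intro hausdorff_outer_mono) (auto simp: M'_def)
    also have "\<dots> \<le> hausdorff_outer d (B \<inter> M') + hausdorff_outer d D" by (rule hausdorff_outer_Un[OF d])
    finally have "hausdorff_outer d (B \<inter> M) \<le> hausdorff_outer d (B \<inter> M')" using D0 by simp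
    moreover have "hausdorff_outer d (B \<inter> M') \<le> hausdorff_outer d (B \<inter> M)" by (intro hausdorff_outer_mono) (auto simp: M'_def)
    ultimately show "emeasure (hausdorff_on d M') B = emeasure H B" using B by (simp add: emeasure_hausdorff_on[OF d])
  qed simp
  define T where "T x = (if x \<in> M' then (THE P. \<exists>m. (x, P) \<in> Ks m) else Abs_linear_subspace {0})" for x
  have T: "T x = P" if "(x, P) \<in> Ks m" "x \<in> M'" for x P m
  proof -
    have "(THE P. \<exists>m. (x, P) \<in> Ks m) = P" using that uniq by (intro the_equality) blast+
    then show ?thesis using that(2) by (simp add: T_def)
  qed
  have Tm: "T \<in> borel_measurable borel"
  proof (rule borel_measurableI)
    fix U :: "'a linear_subspace set" assume U: "open U"
    define C where "C = - U"
    have C: "closed C" using U by (simp add: C_def closed_def)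
    have "compact (fst ` (Ks m \<inter> (UNIV \<times> C)))" for m
      using C by (intro compact_continuous_image compact_Int_closed Ks_compact closed_Times continuous_intros) auto
    then have "(\<Union>m. fst ` (Ks m \<inter> (UNIV \<times> C))) \<in> sets borel" by (intro sets.countable_UN) (auto intro: borel_closed compact_imp_closed)
    then have "M' \<inter> (\<Union>m. fst ` (Ks m \<inter> (UNIV \<times> C))) \<in> sets borel" using M'b by simp
    moreover have "M' \<inter> T -` C = M' \<inter> (\<Union>m. fst ` (Ks m \<inter> (UNIV \<times> C)))"
    proof (intro equalityI subsetI)
      fix x assume x: "x \<in> M' \<inter> T -` C"
      then obtain m P where "(x, P) \<in> Ks m" unfolding M'_def M_def by auto
      then show "x \<in> M' \<inter> (\<Union>m. fst ` (Ks m \<inter> (UNIV \<times> C)))" using x T[of x P m] by force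
    next
      fix x assume x: "x \<in> M' \<inter> (\<Union>m. fst ` (Ks m \<inter> (UNIV \<times> C)))"
      then obtain m P where "(x, P) \<in> Ks m" "P \<in> C" by auto
      then show "x \<in> M' \<inter> T -` C" using x T[of x P m] by auto
    qed
    ultimately have b1: "M' \<inter> T -` C \<in> sets borel" by (simp only:)
    have b2: "(if Abs_linear_subspace {0} \<in> C then - M' else {}) \<in> sets borel" using M'b by (simp add: borel_comp)
    have "T x = Abs_linear_subspace {0}" if "x \<notin> M'" for x using that by (simp add: T_def)
    note T0 = this
    have "(M' \<inter> T -` C) \<union> (if Abs_linear_subspace {0} \<in> C then - M' else {}) = T -` C"
    proof (rule set_eqI)
      fix x show "x \<in> (M' \<inter> T -` C) \<union> (if Abs_linear_subspace {0} \<in> C then - M' else {}) \<longleftrightarrow> x \<in> T -` C"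
        using T0[of x] by (cases "x \<in> M'") simp_all
    qed
    then have "T -` C \<in> sets borel" using sets.Un[OF b1 b2] by (simp only:)
    moreover have "T -` U \<inter> space borel = - (T -` C)" by (auto simp: C_def)
    ultimately show "T -` U \<inter> space borel \<in> sets borel" by (simp only: borel_comp)
  qed
  have "hausdorff_outer d {x \<in> M'. \<not> is_approx_tangent d M' \<theta> x (T x)} = 0"
  proof (rule hausdorff_outer_null_mono[OF N(1)], rule subsetI)
    fix x assume x: "x \<in> {x \<in> M'. \<not> is_approx_tangent d M' \<theta> x (T x)}"
    then obtain m P where P: "(x, P) \<in> Ks m" unfolding M'_def M_def by auto
    have "T x = P" using T[OF P] x by blast
    moreover have "is_approx_tangent d M' \<theta> x P = is_approx_tangent d M \<theta> x P"
      by (simp add: is_approx_tangent_def HM')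
    ultimately show "x \<in> N" using N(2)[OF P] x by auto
  qed
  moreover have "emeasure \<mu> (- M') = 0"
  proof -
    have "emeasure \<mu> D = 0" using Db D0 DM MS by (intro \<mu>_null_of_hausdorff_null) auto
    moreover have "emeasure \<mu> (- M') \<le> emeasure \<mu> (- M) + emeasure \<mu> D"
    proof -
      have "emeasure \<mu> (- M') \<le> emeasure \<mu> (- M \<union> D)" using M_borel Db by (intro emeasure_mono) (auto simp: M'_def sets_\<mu> borel_comp)
      also have "\<dots> \<le> emeasure \<mu> (- M) + emeasure \<mu> D" using M_borel Db by (intro emeasure_subadditive) (auto simp: sets_\<mu> borel_comp)
      finally show ?thesis .
    qed
    ultimately show ?thesis using full by (simp add: M_def)
  qed
  moreover have "M' \<subseteq> M" by (auto simp: M'_def)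
  ultimately show ?thesis using M'b Tm HM' T by blast
qed

end

section \<open>Rectifiability of the limit varifold\<close>

text \<open>
  A varifold is a measure on the Borel sets of \<open>\<Omega> \<times> G\<^sub>d\<^sub>,\<^sub>n\<close>, and its mass one on those of \<open>\<Omega>\<close>. Extending them by zero allows all
  measurability arguments to take place on the whole space.
\<close>

definition borel_extension :: "'b::topological_space measure \<Rightarrow> 'b measure" where
  "borel_extension V = distr V borel (\<lambda>z. z)"

lemma sets_borel_extension [simp]: "sets (borel_extension V) = sets borel"
  and space_borel_extension [simp]: "space (borel_extension V) = UNIV"
  by (simp_all add: borel_extension_def)

lemma open_grassmann_bundle: "open \<Omega> \<Longrightarrow> open (\<Omega> \<times> grassmannian d)"
  by (intro open_Times open_grassmannian)

lemma varifold_sets: "varifold d \<Omega> V \<Longrightarrow> sets V = sets (restrict_space borel (\<Omega> \<times> grassmannian d))"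
  by (simp add: varifold_def radon_measure_on_def)

lemma varifold_space: "varifold d \<Omega> V \<Longrightarrow> space V = \<Omega> \<times> grassmannian d"
  using sets_eq_imp_space_eq[OF varifold_sets, of d \<Omega> V] by (simp add: space_restrict_space)

lemma varifold_measurable:
  assumes "varifold d \<Omega> V" "f \<in> borel \<rightarrow>\<^sub>M N" shows "f \<in> V \<rightarrow>\<^sub>M N"
  unfolding measurable_cong_sets[OF varifold_sets[OF assms(1)] refl]
  by (rule measurable_restrict_space1[OF assms(2)])

lemma emeasure_borel_extension:
  assumes "varifold d \<Omega> V" "B \<in> sets borel"
  shows "emeasure (borel_extension V) B = emeasure V (B \<inter> (\<Omega> \<times> grassmannian d))"
  unfolding borel_extension_def using varifold_measurable[OF assms(1), of "\<lambda>z. z" borel] assms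
  by (subst emeasure_distr) (auto simp: varifold_space[OF assms(1)])

lemma nn_integral_borel_extension:
  assumes "varifold d \<Omega> V" "f \<in> borel_measurable borel"
  shows "(\<integral>\<^sup>+z. f z \<partial>borel_extension V) = (\<integral>\<^sup>+z. f z \<partial>V)"
  unfolding borel_extension_def using varifold_measurable[OF assms(1), of "\<lambda>z. z" borel] assms
  by (subst nn_integral_distr) auto

lemma integral_borel_extension:
  fixes f :: "_ \<Rightarrow> real"
  assumes "varifold d \<Omega> V" "f \<in> borel_measurable borel"
  shows "(\<integral>z. f z \<partial>borel_extension V) = (\<integral>z. f z \<partial>V)"
  unfolding borel_extension_def using varifold_measurable[OF assms(1), of "\<lambda>z. z" borel] assms
  by (subst integral_distr) auto

lemma fst_borel_measurable: "fst \<in> borel_measurable (borel :: ('a::euclidean_space \<times> 'a linear_subspace) measure)"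
  by (intro borel_measurable_continuous_onI continuous_intros)

lemma mass_borel_extension:
  fixes \<Omega> :: "'a::euclidean_space set"
  assumes V: "varifold d \<Omega> V"
  shows "distr (borel_extension V) borel fst = borel_extension (mass \<Omega> V)"
proof -
  have 1: "(\<lambda>z. z) \<in> V \<rightarrow>\<^sub>M borel" by (rule varifold_measurable[OF V]) simp
  have 2: "fst \<in> borel_measurable (borel :: ('a \<times> 'a linear_subspace) measure)" by (rule fst_borel_measurable)
  have 3: "fst \<in> V \<rightarrow>\<^sub>M restrict_space borel \<Omega>"
    by (intro measurable_restrict_space2 varifold_measurable[OF V 2]) (auto simp: varifold_space[OF V])
  have 4: "(\<lambda>x. x) \<in> restrict_space borel \<Omega> \<rightarrow>\<^sub>M borel" by (rule measurable_restrict_space1) simp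
  show ?thesis
    unfolding borel_extension_def mass_def distr_distr[OF 2 1] distr_distr[OF 4 3] by (simp add: o_def)
qed

lemma emeasure_mass_extension:
  fixes \<Omega> :: "'a::euclidean_space set"
  assumes B: "B \<in> sets borel"
  shows "emeasure (borel_extension (mass \<Omega> V)) B = emeasure (mass \<Omega> V) (B \<inter> \<Omega>)"
proof -
  have "(\<lambda>x. x) \<in> mass \<Omega> V \<rightarrow>\<^sub>M borel"
    by (simp add: measurable_cong_sets[OF sets_mass refl] measurable_restrict_space1)
  then show ?thesis unfolding borel_extension_def using B by (simp add: emeasure_distr)
qed

lemma nn_integral_mass_extension:
  fixes \<Omega> :: "'a::euclidean_space set"
  assumes f: "f \<in> borel_measurable borel"
  shows "(\<integral>\<^sup>+x. f x \<partial>borel_extension (mass \<Omega> V)) = (\<integral>\<^sup>+x. f x \<partial>mass \<Omega> V)"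
proof -
  have "(\<lambda>x. x) \<in> mass \<Omega> V \<rightarrow>\<^sub>M borel"
    by (simp add: measurable_cong_sets[OF sets_mass refl] measurable_restrict_space1)
  then show ?thesis unfolding borel_extension_def using f by (simp add: nn_integral_distr)
qed

lemma AE_mass_extension:
  fixes \<Omega> :: "'a::euclidean_space set"
  assumes \<Omega>: "open \<Omega>" and AE: "AE x in mass \<Omega> V. P x"
  shows "AE x in borel_extension (mass \<Omega> V). P x"
proof -
  obtain N where N: "{x \<in> space (mass \<Omega> V). \<not> P x} \<subseteq> N" "emeasure (mass \<Omega> V) N = 0" "N \<in> sets (mass \<Omega> V)"
    using AE by (rule AE_E)
  have Nb: "N \<in> sets borel" "N \<subseteq> \<Omega>" using N(3) \<Omega> by (auto simp: sets_restrict_space_iff)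
  show ?thesis
  proof (rule AE_I[of _ _ "N \<union> - \<Omega>"])
    show "{x \<in> space (borel_extension (mass \<Omega> V)). \<not> P x} \<subseteq> N \<union> - \<Omega>" using N(1) by auto
    show NB: "N \<union> - \<Omega> \<in> sets (borel_extension (mass \<Omega> V))" using Nb \<Omega> by (auto intro: borel_comp)
    have "(N \<union> - \<Omega>) \<inter> \<Omega> = N" using Nb by blast
    then show "emeasure (borel_extension (mass \<Omega> V)) (N \<union> - \<Omega>) = 0"
      using NB N(2) by (simp add: emeasure_mass_extension)
  qed
qed

lemma le_dist_to_set:
  assumes "ball x R \<subseteq> \<Omega>" shows "ereal R \<le> dist_to_set x (- \<Omega>)"
  unfolding dist_to_set_def
proof (rule INF_greatest)
  fix y assume "y \<in> - \<Omega>"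
  then have "y \<notin> ball x R" using assms by blast
  then show "ereal R \<le> ereal (dist x y)" by simp
qed

lemma Cc_measurable:
  fixes \<phi> :: "'b::metric_space \<Rightarrow> real"
  assumes "open A" "\<phi> \<in> Cc A" shows "\<phi> \<in> borel_measurable borel"
proof -
  obtain K where \<phi>: "continuous_on A \<phi>" "K \<subseteq> A" "\<And>x. x \<notin> K \<Longrightarrow> \<phi> x = 0" using assms(2) by (auto simp: Cc_def)
  have "(\<lambda>x. indicator A x *\<^sub>R \<phi> x) \<in> borel_measurable borel"
    using assms(1) \<phi>(1) by (intro borel_measurable_continuous_on_indicator) auto
  moreover have "(\<lambda>x. indicator A x *\<^sub>R \<phi> x) = \<phi>" using \<phi>(2,3) by (auto simp: indicator_def fun_eq_iff)
  ultimately show ?thesis by (simp only:)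
qed

context varifold_sequence begin

text \<open>
  A point \<open>y\<close> at distance \<open>s\<close> from \<open>x\<close> belongs to \<open>B\<^sub>r(x)\<close> for all \<open>r > s\<close>. For \<open>\<alpha> \<le> s < 1/2\<close> the radii in \<open>(s, 2s)\<close>
  alone contribute \<open>s d(y - x, P)\<^sup>2 / (2s)\<^bsup>d+3\<^esup>\<close>. Tonelli's theorem exchanges the integrations in \<open>y\<close> and \<open>r\<close>.
\<close>

lemma excess_lower_bound:
  assumes V: "varifold d \<Omega> V" and fin: "emeasure (mass \<Omega> V) \<Omega> < \<infinity>" and \<alpha>: "0 < \<alpha>" "\<alpha> \<le> 1 / real (Suc m)"
  shows "ennreal (1 / 2 ^ (d + 3)) * (\<integral>\<^sup>+y. ennreal (excess_kernel m (x, P) y) \<partial>borel_extension (mass \<Omega> V)) \<le> height_excess d \<Omega> \<alpha> x P V"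
proof -
  define N where "N = borel_extension (mass \<Omega> V)"
  have sN: "sets N = sets borel" "space N = UNIV" by (simp_all add: N_def)
  have "emeasure N UNIV = emeasure (mass \<Omega> V) \<Omega>" by (simp add: N_def emeasure_mass_extension)
  then interpret N: finite_measure N using fin by (intro finite_measureI) (simp add: sN)
  interpret pair_sigma_finite lborel N ..
  define v where "v y = (norm ((y - x) - orth_proj P (y - x)))\<^sup>2" for y
  have vc: "continuous_on UNIV v" unfolding v_def by (intro continuous_intros)
  define E where "E = {p :: real \<times> 'a. \<alpha> \<le> fst p \<and> fst p \<le> 1 \<and> dist x (snd p) < fst p \<and> snd p \<in> \<Omega>}"
  have Eb: "E \<in> sets borel"
  proof -
    have "E = {p. \<alpha> \<le> fst p} \<inter> {p. fst p \<le> 1} \<inter> {p. dist x (snd p) < fst p} \<inter> (UNIV \<times> \<Omega>)" by (auto simp: E_def)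
    moreover have "closed {p :: real \<times> 'a. \<alpha> \<le> fst p}" "closed {p :: real \<times> 'a. fst p \<le> 1}"
      by (intro closed_Collect_le continuous_intros)+
    moreover have "open {p :: real \<times> 'a. dist x (snd p) < fst p}" by (intro open_Collect_less continuous_intros)
    moreover have "open ((UNIV :: real set) \<times> \<Omega>)" by (intro open_Times open_UNIV open_\<Omega>)
    ultimately show ?thesis by (simp add: borel_closed borel_open sets.Int)
  qed
  define k where "k p = indicator E p * ennreal (v (snd p) / fst p ^ (d + 3))" for p
  have km: "k \<in> borel_measurable borel"
  proof -
    have "(\<lambda>p :: real \<times> 'a. v (snd p)) \<in> borel_measurable borel"
      by (intro borel_measurable_continuous_onI continuous_on_compose2[OF vc]) (auto intro!: continuous_intros)
    moreover have "(\<lambda>p :: real \<times> 'a. fst p ^ (d + 3)) \<in> borel_measurable borel"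
      by (intro borel_measurable_continuous_onI continuous_intros)
    ultimately have "(\<lambda>p. ennreal (v (snd p) / fst p ^ (d + 3))) \<in> borel_measurable borel"
      by (intro measurable_compose[OF borel_measurable_divide measurable_ennreal])
    then show ?thesis unfolding k_def using Eb by (intro borel_measurable_times_ennreal borel_measurable_indicator)
  qed
  have sp: "sets (lborel \<Otimes>\<^sub>M N) = sets (borel :: (real \<times> 'a) measure)"
  proof -
    have "sets (lborel \<Otimes>\<^sub>M N) = sets ((borel :: real measure) \<Otimes>\<^sub>M (borel :: 'a measure))"
      by (rule sets_pair_measure_cong) (simp_all add: sN)
    then show ?thesis by (simp only: borel_prod)
  qed
  have km': "k \<in> borel_measurable (lborel \<Otimes>\<^sub>M N)" using km by (simp add: measurable_cong_sets[OF sp refl])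
  have lower: "ennreal (1 / 2 ^ (d + 3)) * ennreal (excess_kernel m (x, P) y) \<le> (\<integral>\<^sup>+r. k (r, y) \<partial>lborel)" for y
  proof (cases "excess_kernel m (x, P) y = 0")
    case True then show ?thesis by simp
  next
    case False
    define s where "s = dist x y"
    have w: "cutoff \<Omega> m y \<noteq> 0" "kernel_weight m s \<noteq> 0" using False by (auto simp: excess_kernel_def s_def)
    have y\<Omega>: "y \<in> \<Omega>" using w(1) cutoff_support[OF open_\<Omega>, of m] by blast
    have s1: "1 / real (Suc m) < s" using w(2) kernel_weight_small[of s m] by (metis not_le)
    have s2: "s < 1 / 2" using w(2) kernel_weight_far[of s m] by (metis not_le)
    have s0: "0 < s" using s1 by (smt (verit) divide_pos_pos of_nat_0_less_iff zero_less_Suc)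
    have v0: "0 \<le> v y" by (simp add: v_def)
    have "excess_kernel m (x, P) y \<le> 1 * 1 * (1 / s ^ (d + 2)) * v y"
      unfolding excess_kernel_def fst_conv snd_conv v_def[symmetric] s_def[symmetric]
      using kernel_weight_le[OF s0, of m] kernel_weight_nonneg[of m s] v0 s0
      by (intro mult_mono cutoff_bounds mult_nonneg_nonneg) auto
    then have "1 / 2 ^ (d + 3) * excess_kernel m (x, P) y \<le> 1 / 2 ^ (d + 3) * (1 / s ^ (d + 2) * v y)"
      by (intro mult_left_mono) auto
    also have "\<dots> = v y / (2 * s) ^ (d + 3) * s"
    proof -
      have "(2 * s) ^ (d + 3) = 2 ^ (d + 3) * (s ^ (d + 2) * s)" unfolding power_mult_distrib by (simp add: power_add power3_eq_cube power2_eq_square)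
      then show ?thesis using s0 by simp
    qed
    finally have "ennreal (1 / 2 ^ (d + 3) * excess_kernel m (x, P) y) \<le> ennreal (v y / (2 * s) ^ (d + 3) * s)" by (rule ennreal_leI)
    also have "\<dots> = ennreal (v y / (2 * s) ^ (d + 3)) * emeasure lborel {s<..<2 * s}"
      using s0 v0 by (subst ennreal_mult) auto
    also have "\<dots> = (\<integral>\<^sup>+r. ennreal (v y / (2 * s) ^ (d + 3)) * indicator {s<..<2 * s} r \<partial>lborel)"
      by (rule nn_integral_cmult_indicator[symmetric]) simp
    also have "\<dots> \<le> (\<integral>\<^sup>+r. k (r, y) \<partial>lborel)"
    proof (rule nn_integral_mono)
      fix r :: real
      show "ennreal (v y / (2 * s) ^ (d + 3)) * indicator {s<..<2 * s} r \<le> k (r, y)"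
      proof (cases "r \<in> {s<..<2 * s}")
        case True
        have "(r, y) \<in> E" using True s1 s2 \<alpha> y\<Omega> by (auto simp: E_def s_def)
        moreover have "v y / (2 * s) ^ (d + 3) \<le> v y / r ^ (d + 3)"
          using True s0 v0 by (intro divide_left_mono power_mono mult_pos_pos zero_less_power) auto
        ultimately show ?thesis using True by (simp add: k_def ennreal_leI)
      qed simp
    qed
    finally have "ennreal (1 / 2 ^ (d + 3) * excess_kernel m (x, P) y) \<le> (\<integral>\<^sup>+r. k (r, y) \<partial>lborel)" .
    moreover have "ennreal (1 / 2 ^ (d + 3) * excess_kernel m (x, P) y) = ennreal (1 / 2 ^ (d + 3)) * ennreal (excess_kernel m (x, P) y)"
      by (rule ennreal_mult) (simp_all add: excess_kernel_nonneg)
    ultimately show ?thesis by (simp only:)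
  qed
  have "ennreal (1 / 2 ^ (d + 3)) * (\<integral>\<^sup>+y. ennreal (excess_kernel m (x, P) y) \<partial>N)
      = (\<integral>\<^sup>+y. ennreal (1 / 2 ^ (d + 3)) * ennreal (excess_kernel m (x, P) y) \<partial>N)"
    using excess_kernel_measurable[of m "(x, P)"] by (intro nn_integral_cmult[symmetric]) (simp add: measurable_cong_sets[OF sN(1) refl])
  also have "\<dots> \<le> (\<integral>\<^sup>+y. (\<integral>\<^sup>+r. k (r, y) \<partial>lborel) \<partial>N)" by (intro nn_integral_mono lower)
  also have "\<dots> = (\<integral>\<^sup>+r. (\<integral>\<^sup>+y. k (r, y) \<partial>N) \<partial>lborel)"
    by (rule Fubini[OF km'])
  also have "\<dots> = height_excess d \<Omega> \<alpha> x P V"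
    unfolding height_excess_def
  proof (rule nn_integral_cong)
    fix r :: real
    define X where "X = (\<integral>\<^sup>+y\<in>ball x r \<inter> \<Omega>. ennreal ((infdist (y - x) (points P) / r)\<^sup>2) \<partial>mass \<Omega> V)"
    have fm: "(\<lambda>y. ennreal ((infdist (y - x) (points P) / r)\<^sup>2) * indicator (ball x r \<inter> \<Omega>) y) \<in> borel_measurable borel"
    proof -
      have "(\<lambda>y. infdist (y - x) (points P) / r) \<in> borel_measurable borel"
        by (intro borel_measurable_divide borel_measurable_const borel_measurable_continuous_onI continuous_intros)
      then have "(\<lambda>y. ennreal ((infdist (y - x) (points P) / r)\<^sup>2)) \<in> borel_measurable borel" by measurable
      then show ?thesis using open_\<Omega> by (intro borel_measurable_times_ennreal borel_measurable_indicator) auto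
    qed
    have X: "X = (\<integral>\<^sup>+y. ennreal ((infdist (y - x) (points P) / r)\<^sup>2) * indicator (ball x r \<inter> \<Omega>) y \<partial>N)"
      unfolding X_def N_def by (rule nn_integral_mass_extension[OF fm, symmetric])
    show "(\<integral>\<^sup>+y. k (r, y) \<partial>N) = ennreal (1 / r ^ d) * X * ennreal (1 / r) * indicator {\<alpha>..1} r"
    proof (cases "r \<in> {\<alpha>..1}")
      case False
      then have "k (r, y) = 0" for y by (auto simp: k_def E_def)
      then show ?thesis using False by simp
    next
      case True
      then have r: "0 < r" using \<alpha> by auto
      have "k (r, y) = ennreal (1 / r ^ (d + 1)) * (ennreal ((infdist (y - x) (points P) / r)\<^sup>2) * indicator (ball x r \<inter> \<Omega>) y)" for y
      proof -
        have "v y / r ^ (d + 3) = 1 / r ^ (d + 1) * (infdist (y - x) (points P) / r)\<^sup>2"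
          unfolding infdist_points v_def power_divide by (simp add: power_add power3_eq_cube power2_eq_square)
        moreover have "ennreal (1 / r ^ (d + 1) * (infdist (y - x) (points P) / r)\<^sup>2)
            = ennreal (1 / r ^ (d + 1)) * ennreal ((infdist (y - x) (points P) / r)\<^sup>2)"
          using r by (intro ennreal_mult) simp_all
        ultimately have "ennreal (v y / r ^ (d + 3)) = ennreal (1 / r ^ (d + 1)) * ennreal ((infdist (y - x) (points P) / r)\<^sup>2)"
          by (simp only:)
        moreover have "(r, y) \<in> E \<longleftrightarrow> y \<in> ball x r \<inter> \<Omega>" using True by (auto simp: E_def)
        ultimately show ?thesis by (simp add: k_def mult.commute indicator_def)
      qed
      then have "(\<integral>\<^sup>+y. k (r, y) \<partial>N) = ennreal (1 / r ^ (d + 1)) * X"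
        unfolding X using fm by (simp add: nn_integral_cmult measurable_cong_sets[OF sN(1) refl])
      also have "ennreal (1 / r ^ (d + 1)) = ennreal (1 / r ^ d) * ennreal (1 / r)"
        using r by (simp add: ennreal_mult[symmetric])
      finally show ?thesis using True by (simp add: ac_simps)
    qed
  qed
  finally show ?thesis by (simp add: N_def)
qed

lemma \<mu>_off_supp: "emeasure \<mu> (\<Omega> - supp) = 0" "\<Omega> - supp \<in> sets borel"
proof -
  interpret finite_measure \<mu> by (rule finite_\<mu>)
  define U where "U = {x \<in> \<Omega>. \<exists>r>0. measure \<mu> (cball x r) = 0}"
  have U: "\<Omega> - supp = U" unfolding U_def supp_def using measure_nonneg[of \<mu>] by (auto simp: less_le)
  have cover: "\<exists>r>0. ball x r \<in> null_sets \<mu> \<and> ball x r \<inter> \<Omega> \<subseteq> U" if x: "x \<in> U" for x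
  proof -
    obtain r where r: "r > 0" "measure \<mu> (cball x r) = 0" using x by (auto simp: U_def)
    have "measure \<mu> (cball y (r / 2)) = 0" if y: "y \<in> ball x (r / 2)" for y
    proof -
      have "cball y (r / 2) \<subseteq> cball x r"
      proof
        fix z assume "z \<in> cball y (r / 2)"
        then show "z \<in> cball x r" using y dist_triangle[of x z y] by simp
      qed
      then have "measure \<mu> (cball y (r / 2)) \<le> measure \<mu> (cball x r)" by (intro finite_measure_mono) auto
      then show ?thesis using r measure_nonneg[of \<mu> "cball y (r / 2)"] by simp
    qed
    then have "ball x (r / 2) \<inter> \<Omega> \<subseteq> U" unfolding U_def using r(1) by (auto intro!: exI[of _ "r / 2"])
    moreover have "measure \<mu> (ball x (r / 2)) \<le> measure \<mu> (cball x r)" using r by (intro finite_measure_mono) auto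
    then have "emeasure \<mu> (ball x (r / 2)) = 0" using r(2) measure_nonneg[of \<mu> "ball x (r / 2)"] by (simp add: emeasure_eq_measure)
    then have "ball x (r / 2) \<in> null_sets \<mu>" by (simp add: null_sets_def)
    ultimately show ?thesis using r(1) by (intro exI[of _ "r / 2"]) simp
  qed
  then have "\<forall>x. \<exists>r. x \<in> U \<longrightarrow> 0 < r \<and> ball x r \<in> null_sets \<mu> \<and> ball x r \<inter> \<Omega> \<subseteq> U" by blast
  then obtain R where R: "\<And>x. x \<in> U \<Longrightarrow> 0 < R x" "\<And>x. x \<in> U \<Longrightarrow> ball x (R x) \<in> null_sets \<mu>" "\<And>x. x \<in> U \<Longrightarrow> ball x (R x) \<inter> \<Omega> \<subseteq> U"
    unfolding choice_iff by metis
  obtain C where C: "C \<subseteq> (\<lambda>x. ball x (R x)) ` U" "countable C" "\<Union>C = \<Union>((\<lambda>x. ball x (R x)) ` U)"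
    using Lindelof[of "(\<lambda>x. ball x (R x)) ` U"] by auto
  have "U = \<Union>C \<inter> \<Omega>"
  proof (intro equalityI subsetI)
    fix x assume x: "x \<in> U"
    then have "x \<in> ball x (R x)" using R(1) by simp
    then have "x \<in> \<Union>C" using x C(3) by blast
    then show "x \<in> \<Union>C \<inter> \<Omega>" using x by (auto simp: U_def)
  next
    fix x assume "x \<in> \<Union>C \<inter> \<Omega>"
    then obtain y where "y \<in> U" "x \<in> ball y (R y) \<inter> \<Omega>" using C(3) by auto
    then show "x \<in> U" using R(3) by blast
  qed
  moreover have "\<Union>C \<in> null_sets \<mu>" using C(1,2) R(2) null_sets_UN'[of C "\<lambda>c. c" \<mu>] by auto
  ultimately have "U \<in> null_sets \<mu>" using open_\<Omega> null_set_Int2[of "\<Union>C" \<mu> \<Omega>] by simp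
  then show "emeasure \<mu> (\<Omega> - supp) = 0" "\<Omega> - supp \<in> sets borel" unfolding U by auto
qed

end

text \<open>
  The property \<open>Pr\<close> may fail to define a Borel set. Removing a Borel null set that contains the exceptions leaves a Borel
  set, to which inner regularity applies.
\<close>

lemma varifold_compact_exhaustion:
  assumes V: "varifold d \<Omega> V" and \<Omega>: "open \<Omega>" and fin: "finite_measure (borel_extension V)"
    and AE: "AE z in borel_extension V. Pr z"
  shows "\<exists>Ks :: nat \<Rightarrow> _ set. (\<forall>m. compact (Ks m) \<and> Ks m \<subseteq> \<Omega> \<times> grassmannian d \<and> (\<forall>z\<in>Ks m. Pr z)) \<and> emeasure (borel_extension V) (- (\<Union>m. Ks m)) = 0"
proof -
  define W where "W = borel_extension V"
  interpret finite_measure W using fin by (simp add: W_def)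
  have sW [simp]: "sets W = sets borel" "space W = UNIV" by (simp_all add: W_def)
  let ?B = "\<Omega> \<times> grassmannian d"
  have Bb: "?B \<in> sets borel" using open_grassmann_bundle[OF \<Omega>] by (rule borel_open)
  obtain N where N: "{z \<in> space W. \<not> Pr z} \<subseteq> N" "emeasure W N = 0" "N \<in> sets W"
    using AE unfolding W_def by (rule AE_E)
  define G where "G = ?B - N"
  have Gb: "G \<in> sets borel" unfolding G_def using Bb N(3) by (intro sets.Diff) simp_all
  have em: "emeasure W A = emeasure V (A \<inter> ?B)" if "A \<in> sets borel" for A
    unfolding W_def by (rule emeasure_borel_extension[OF V that])
  have emG: "emeasure W A = emeasure V A" if "A \<in> sets borel" "A \<subseteq> ?B" for A
    using em[OF that(1)] that(2) by (simp add: Int_absorb2)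
  have GV: "G \<in> sets V" unfolding varifold_sets[OF V]
  proof (subst sets_restrict_space_iff)
    show "?B \<inter> space borel \<in> sets borel" using Bb by simp
    show "G \<subseteq> ?B \<and> G \<in> sets borel" using Gb by (auto simp: G_def)
  qed
  have G: "emeasure V G = (SUP K\<in>{K. compact K \<and> K \<subseteq> G}. emeasure V K)"
    using V GV by (simp add: varifold_def radon_measure_on_def)
  have Gfin: "emeasure V G \<noteq> \<infinity>" using emG[OF Gb] emeasure_finite[of G] by (simp add: G_def)
  have "\<exists>K\<in>{K. compact K \<and> K \<subseteq> G}. emeasure V G < emeasure V K + ennreal (1 / real (Suc m))" for m
    by (rule SUP_approx_ennreal[OF _ _ G Gfin]) auto
  then obtain Ks where Ks: "\<And>m. compact (Ks m)" "\<And>m. Ks m \<subseteq> G" "\<And>m. emeasure V G < emeasure V (Ks m) + ennreal (1 / real (Suc m))"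
    by (metis (no_types, lifting) mem_Collect_eq)
  have Kb: "Ks m \<in> sets borel" for m using Ks(1) by (intro borel_closed compact_imp_closed)
  have Ub: "- (\<Union>m. Ks m) \<in> sets borel" using Kb by (intro borel_comp sets.countable_UN) auto
  have UG: "emeasure W UNIV \<le> emeasure W G"
  proof -
    have "emeasure W (- ?B) = 0" using em[OF borel_comp[OF Bb]] by simp
    moreover have "emeasure W UNIV \<le> emeasure W (G \<union> (- ?B \<union> N))" using Gb Bb N(3) by (intro emeasure_mono) (auto simp: G_def intro: borel_comp)
    moreover have "emeasure W (G \<union> (- ?B \<union> N)) \<le> emeasure W G + emeasure W (- ?B \<union> N)"
      using Gb Bb N(3) by (intro emeasure_subadditive) (auto intro: borel_comp)
    moreover have "emeasure W (- ?B \<union> N) \<le> emeasure W (- ?B) + emeasure W N"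
      using Bb N(3) by (intro emeasure_subadditive) (auto intro: borel_comp)
    ultimately show ?thesis using N(2) by simp
  qed
  have "measure W (- (\<Union>m. Ks m)) \<le> 1 / real (Suc m)" for m
  proof -
    have KB: "Ks m \<subseteq> ?B" using Ks(2) by (auto simp: G_def)
    have "emeasure W UNIV \<le> emeasure W (Ks m) + ennreal (1 / real (Suc m))"
      using UG Ks(3)[of m] emG[OF Gb] emG[OF Kb KB] by (simp add: G_def)
    then have "ennreal (measure W UNIV) \<le> ennreal (measure W (Ks m) + 1 / real (Suc m))"
      by (simp add: emeasure_eq_measure ennreal_plus)
    then have "measure W UNIV \<le> measure W (Ks m) + 1 / real (Suc m)" by (subst (asm) ennreal_le_iff) auto
    moreover have "measure W (- Ks m) = measure W UNIV - measure W (Ks m)"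
      using finite_measure_compl[of "Ks m"] Kb by (simp add: Compl_eq_Diff_UNIV)
    moreover have "measure W (- (\<Union>m. Ks m)) \<le> measure W (- Ks m)" using Kb by (intro finite_measure_mono) (auto intro: borel_comp)
    ultimately show ?thesis by linarith
  qed
  moreover have "(\<lambda>m. 1 / real (Suc m)) \<longlonglongrightarrow> 0" using LIMSEQ_Suc[OF lim_1_over_n] by simp
  ultimately have "measure W (- (\<Union>m. Ks m)) \<le> 0" by (intro LIMSEQ_le_const) auto
  then have "emeasure W (- (\<Union>m. Ks m)) = 0" using measure_nonneg[of W] by (simp add: emeasure_eq_measure antisym)
  moreover have "\<forall>z\<in>Ks m. Pr z" for m using Ks(2)[of m] N(1) by (auto simp: G_def)
  moreover have "Ks m \<subseteq> ?B" for m using Ks(2)[of m] by (auto simp: G_def)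
  ultimately show ?thesis using Ks(1) unfolding W_def by blast
qed

text \<open>
  Almost every pair \<open>(x, P)\<close> lies in some \<open>Ks m\<close> with \<open>x\<close> in \<open>M'\<close>, so that \<open>P = T(x)\<close>. Integrals over \<open>V\<close> therefore
  reduce to integrals over the mass \<open>\<mu> = \<theta> \<H>\<^sup>d\<close>.
\<close>

lemma tangential_varifold_rectifiable:
  fixes \<Omega> :: "'a::euclidean_space set"
  assumes V: "varifold d \<Omega> V" and tm: "tangential_measure d \<Omega> S (distr (borel_extension V) borel fst) c0 c1 Ks"
    and Ks: "emeasure (borel_extension V) (- (\<Union>m. Ks m)) = 0"
  shows "rectifiable_varifold d \<Omega> V"
proof -
  define \<mu> where "\<mu> = distr (borel_extension V) borel fst"
  interpret tm: tangential_measure d \<Omega> S \<mu> c0 c1 Ks using tm by (simp add: \<mu>_def)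
  obtain \<theta> where \<theta>: "\<theta> \<in> borel_measurable borel" "\<And>x. 0 \<le> \<theta> x" "hausdorff_outer d {x \<in> tm.M. \<not> 0 < \<theta> x} = 0"
    "density (hausdorff_on d tm.M) (\<lambda>x. ennreal (\<theta> x)) = \<mu>"
    using tm.exists_density by blast
  interpret td: tangential_density d \<Omega> S \<mu> c0 c1 Ks \<theta> by unfold_locales (use \<theta> in auto)
  obtain M' T where "M' \<subseteq> tm.M \<and> M' \<in> sets borel \<and> hausdorff_outer d {x \<in> M'. \<not> is_approx_tangent d M' \<theta> x (T x)} = 0
    \<and> T \<in> borel_measurable borel \<and> hausdorff_on d M' = hausdorff_on d tm.M \<and> emeasure \<mu> (- M') = 0
    \<and> (\<forall>m x P. (x, P) \<in> Ks m \<longrightarrow> x \<in> M' \<longrightarrow> T x = P)"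
    using td.rectifiable_structure by (elim exE) (rule that)
  then have M': "M' \<subseteq> tm.M" "M' \<in> sets borel" "hausdorff_outer d {x \<in> M'. \<not> is_approx_tangent d M' \<theta> x (T x)} = 0"
    "T \<in> borel_measurable borel" "hausdorff_on d M' = hausdorff_on d tm.M" "emeasure \<mu> (- M') = 0"
    and MT: "\<forall>m x P. (x, P) \<in> Ks m \<longrightarrow> x \<in> M' \<longrightarrow> T x = P"
    by blast+
  let ?W = "borel_extension V"
  have fm: "fst \<in> ?W \<rightarrow>\<^sub>M borel" by (simp add: measurable_cong_sets[OF sets_borel_extension refl] fst_borel_measurable)
  have AE: "AE z in ?W. \<exists>m. z \<in> Ks m \<and> fst z \<in> M'"
  proof -
    have K: "(\<Union>m. Ks m) \<in> sets borel" using tm.Ks_compact by (intro sets.countable_UN) (auto intro: borel_closed compact_imp_closed)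
    have "- (\<Union>m. Ks m) \<in> null_sets ?W"
      by (rule null_setsI[OF Ks]) (simp only: sets_borel_extension borel_comp[OF K])
    then have "AE z in ?W. z \<notin> - (\<Union>m. Ks m)" by (rule AE_not_in)
    moreover have "AE z in ?W. fst z \<notin> - M'"
    proof -
      have "- M' \<in> null_sets \<mu>" using M'(2,6) by (auto simp: null_sets_def \<mu>_def intro: borel_comp)
      then have "AE x in \<mu>. x \<notin> - M'" by (rule AE_not_in)
      then show ?thesis unfolding \<mu>_def by (rule AE_distrD[OF fm])
    qed
    ultimately show ?thesis by eventually_elim auto
  qed
  have int: "(\<integral>z. \<phi> z \<partial>V) = (\<integral>x. \<phi> (x, T x) * \<theta> x \<partial>hausdorff_on d M')" if \<phi>: "\<phi> \<in> Cc (\<Omega> \<times> grassmannian d)" for \<phi>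
  proof -
    have \<phi>m: "\<phi> \<in> borel_measurable borel" by (rule Cc_measurable[OF open_grassmann_bundle[OF tm.open_\<Omega>] \<phi>])
    have gm: "(\<lambda>x. \<phi> (x, T x)) \<in> borel_measurable borel"
      by (rule measurable_compose[OF borel_measurable_Pair \<phi>m]) (use M'(4) in simp_all)
    have "(\<integral>z. \<phi> z \<partial>V) = (\<integral>z. \<phi> z \<partial>?W)" by (rule integral_borel_extension[OF V \<phi>m, symmetric])
    also have "\<dots> = (\<integral>z. \<phi> (fst z, T (fst z)) \<partial>?W)"
    proof (rule integral_cong_AE)
      show "AE z in ?W. \<phi> z = \<phi> (fst z, T (fst z))"
        using AE
      proof eventually_elim
        case (elim z)
        then obtain m where "(fst z, snd z) \<in> Ks m" "fst z \<in> M'" by auto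
        then have "T (fst z) = snd z" using MT by blast
        then show ?case by simp
      qed
      show "(\<lambda>z. \<phi> (fst z, T (fst z))) \<in> borel_measurable ?W"
        by (rule measurable_compose[OF fm gm])
    qed (use \<phi>m in \<open>simp add: measurable_cong_sets[OF sets_borel_extension refl]\<close>)
    also have "\<dots> = (\<integral>x. \<phi> (x, T x) \<partial>\<mu>)" unfolding \<mu>_def using fm gm by (simp add: integral_distr)
    also have "\<dots> = (\<integral>x. \<theta> x * \<phi> (x, T x) \<partial>hausdorff_on d tm.M)" by (rule td.integral_\<mu>[OF gm])
    also have "\<dots> = (\<integral>x. \<phi> (x, T x) * \<theta> x \<partial>hausdorff_on d M')" by (simp add: M'(5) mult.commute)
    finally show ?thesis .
  qed
  show ?thesis
    unfolding rectifiable_varifold_def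
  proof (intro conjI V exI[of _ M'] exI[of _ \<theta>] exI[of _ T] ballI)
    show "M' \<subseteq> \<Omega>" using M'(1) tm.MS tm.S\<Omega> by blast
    show "hausdorff_measurable d M'" by (rule borel_hausdorff_measurable[OF tm.d M'(2)])
    show "countably_rectifiable d M'" by (rule countably_rectifiable_subset[OF td.M_rectifiable M'(1)])
    show "hausdorff_outer d {x \<in> M'. \<not> 0 < \<theta> x} = 0"
      by (rule hausdorff_outer_null_mono[OF \<theta>(3)]) (use M'(1) in blast)
  qed (use \<theta> M' int in auto)
qed

lemma varifold_limit_rectifiable:
  fixes \<Omega> :: "'a::euclidean_space set"
  assumes d: "1 \<le> d" and \<Omega>: "open \<Omega>" and Vs: "\<And>i. varifold d \<Omega> (Vs i)" and V: "varifold d \<Omega> V"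
    and conv: "weak_star_converges (\<Omega> \<times> grassmannian d) Vs V"
    and bd: "(SUP i. emeasure (mass \<Omega> (Vs i)) \<Omega>) < \<infinity>"
    and \<alpha>: "\<And>i. 0 < \<alpha> i" "\<alpha> \<longlonglongrightarrow> 0" and \<beta>: "\<beta> \<longlonglongrightarrow> 0" "\<And>i. 0 < \<beta> i"
    and C: "0 < C1" "0 < C2"
    and dens: "\<And>i. AE x in mass \<Omega> (Vs i). \<forall>r. \<beta> i < r \<and> ereal r < dist_to_set x (- \<Omega>) \<longrightarrow>
        ennreal (C1 * unit_ball_vol (real d) * r ^ d) \<le> emeasure (mass \<Omega> (Vs i)) (ball x r) \<and>
        emeasure (mass \<Omega> (Vs i)) (ball x r) \<le> ennreal (C2 * unit_ball_vol (real d) * r ^ d)"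
    and excess: "(SUP i. \<integral>\<^sup>+(x, P). height_excess d \<Omega> (\<alpha> i) x P (Vs i) \<partial>Vs i) < \<infinity>"
  shows "rectifiable_varifold d \<Omega> V"
proof -
  let ?Gr = "grassmannian d :: 'a linear_subspace set"
  obtain \<Lambda> where \<Lambda>: "0 \<le> \<Lambda>" "(SUP i. emeasure (mass \<Omega> (Vs i)) \<Omega>) = ennreal \<Lambda>"
    using bd by (cases "SUP i. emeasure (mass \<Omega> (Vs i)) \<Omega>") auto
  have mass_le: "emeasure (mass \<Omega> (Vs i)) \<Omega> \<le> ennreal \<Lambda>" for i
    unfolding \<Lambda>(2)[symmetric] by (rule SUP_upper) simp
  obtain E where E: "0 \<le> E" "(SUP i. \<integral>\<^sup>+(x, P). height_excess d \<Omega> (\<alpha> i) x P (Vs i) \<partial>Vs i) = ennreal E"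
    using excess by (cases "SUP i. \<integral>\<^sup>+(x, P). height_excess d \<Omega> (\<alpha> i) x P (Vs i) \<partial>Vs i") auto
  have excess_le: "(\<integral>\<^sup>+(x, P). height_excess d \<Omega> (\<alpha> i) x P (Vs i) \<partial>Vs i) \<le> ennreal E" for i
    unfolding E(2)[symmetric] by (rule SUP_upper) simp
  define Ws where "Ws i = borel_extension (Vs i)" for i
  define W where "W = borel_extension V"
  have \<Omega>b: "\<Omega> \<in> sets (restrict_space borel \<Omega>)" using \<Omega> by (simp add: sets_restrict_space_iff)
  interpret vs: varifold_sequence d \<Omega> Ws W \<Lambda>
  proof
    show "1 \<le> d" "open \<Omega>" by fact+
    show "sets (Ws i) = sets borel" "sets W = sets borel" for i by (simp_all add: Ws_def W_def)
    show "emeasure (Ws i) UNIV \<le> ennreal \<Lambda>" for i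
      using mass_le[of i] emeasure_mass[OF Vs \<Omega>b, of i] by (simp add: Ws_def emeasure_borel_extension[OF Vs])
    show "emeasure W (- (\<Omega> \<times> UNIV)) = 0"
    proof -
      have "- (\<Omega> \<times> (UNIV :: 'a linear_subspace set)) \<in> sets borel" by (intro borel_comp borel_open open_Times \<Omega> open_UNIV)
      moreover have "- (\<Omega> \<times> (UNIV :: 'a linear_subspace set)) \<inter> (\<Omega> \<times> ?Gr) = {}" by blast
      ultimately show ?thesis unfolding W_def using emeasure_borel_extension[OF V] by (metis emeasure_empty)
    qed
    show "emeasure W (K \<times> UNIV) < \<infinity>" if K: "compact K" "K \<subseteq> \<Omega>" for K
    proof -
      have "K \<times> (UNIV :: 'a linear_subspace set) \<in> sets borel" by (intro borel_closed closed_Times compact_imp_closed K closed_UNIV)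
      then have "emeasure W (K \<times> UNIV) = emeasure V ((K \<times> UNIV) \<inter> (\<Omega> \<times> ?Gr))" unfolding W_def by (rule emeasure_borel_extension[OF V])
      also have "(K \<times> UNIV) \<inter> (\<Omega> \<times> ?Gr) = K \<times> ?Gr" using K(2) by blast
      also have "emeasure V (K \<times> ?Gr) < \<infinity>"
      proof -
        have "compact (K \<times> ?Gr)" "K \<times> ?Gr \<subseteq> \<Omega> \<times> ?Gr" using K by (auto intro: compact_Times compact_grassmannian)
        then show ?thesis using V unfolding varifold_def radon_measure_on_def by blast
      qed
      finally show ?thesis .
    qed
    fix f :: "'a \<times> 'a linear_subspace \<Rightarrow> real" and K
    assume f: "continuous_on UNIV f" "compact K" "K \<subseteq> \<Omega>" "\<And>z. fst z \<notin> K \<Longrightarrow> f z = 0"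
    define \<phi> where "\<phi> z = (if snd z \<in> ?Gr then f z else 0)" for z
    have \<phi>: "\<phi> \<in> Cc (\<Omega> \<times> ?Gr)"
      unfolding Cc_def
    proof (intro CollectI conjI exI[of _ "K \<times> ?Gr"])
      have "continuous_on (\<Omega> \<times> ?Gr) f" using f(1) by (rule continuous_on_subset) simp
      then show "continuous_on (\<Omega> \<times> ?Gr) \<phi>" by (rule continuous_on_eq) (auto simp: \<phi>_def)
      show "compact (K \<times> ?Gr)" by (intro compact_Times f compact_grassmannian)
      show "K \<times> ?Gr \<subseteq> \<Omega> \<times> ?Gr" using f(3) by blast
      show "\<forall>z. z \<notin> K \<times> ?Gr \<longrightarrow> \<phi> z = 0" using f(4) by (auto simp: \<phi>_def mem_Times_iff)
    qed
    have fm: "f \<in> borel_measurable borel" using f(1) by (rule borel_measurable_continuous_onI)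
    have eq: "(\<integral>z. f z \<partial>borel_extension U) = (\<integral>z. \<phi> z \<partial>U)" if U: "varifold d \<Omega> U" for U
    proof -
      have "(\<integral>z. f z \<partial>borel_extension U) = (\<integral>z. f z \<partial>U)" by (rule integral_borel_extension[OF U fm])
      also have "\<dots> = (\<integral>z. \<phi> z \<partial>U)"
        by (intro Bochner_Integration.integral_cong) (auto simp: varifold_space[OF U] \<phi>_def)
      finally show ?thesis .
    qed
    show "(\<lambda>i. \<integral>z. f z \<partial>Ws i) \<longlonglongrightarrow> (\<integral>z. f z \<partial>W)"
      unfolding Ws_def W_def eq[OF Vs] eq[OF V] using conv \<phi> by (simp add: weak_star_converges_def)
  qed
  have \<mu>s: "vs.\<mu>s i = borel_extension (mass \<Omega> (Vs i))" for i
    unfolding vs.\<mu>s_def unfolding Ws_def by (rule mass_borel_extension[OF Vs])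
  define c0 c1 where "c0 = C1 * unit_ball_vol (real d)" and "c1 = C2 * unit_ball_vol (real d)"
  have c0: "0 < c0" and c1: "0 < c1" using C unit_ball_vol_pos[of "real d"] by (simp_all add: c0_def c1_def)
  have dens': "AE x in vs.\<mu>s i. \<forall>r R. \<beta> i < r \<and> r < R \<and> ball x R \<subseteq> \<Omega> \<longrightarrow>
       c0 * r ^ d \<le> measure (vs.\<mu>s i) (ball x r) \<and> measure (vs.\<mu>s i) (ball x r) \<le> c1 * r ^ d" for i
  proof -
    interpret f: finite_measure "vs.\<mu>s i" by (rule vs.finite_\<mu>s)
    have "AE x in vs.\<mu>s i. \<forall>r. \<beta> i < r \<and> ereal r < dist_to_set x (- \<Omega>) \<longrightarrow>
        ennreal (C1 * unit_ball_vol (real d) * r ^ d) \<le> emeasure (mass \<Omega> (Vs i)) (ball x r) \<and>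
        emeasure (mass \<Omega> (Vs i)) (ball x r) \<le> ennreal (C2 * unit_ball_vol (real d) * r ^ d)"
      unfolding \<mu>s by (rule AE_mass_extension[OF \<Omega> dens])
    then show ?thesis
    proof eventually_elim
      case (elim x)
      show ?case
      proof (intro allI impI)
        fix r R assume r: "\<beta> i < r \<and> r < R \<and> ball x R \<subseteq> \<Omega>"
        then have r0: "0 < r" using \<beta>(2)[of i] by linarith
        have "ereal r < ereal R" using r by simp
        also have "\<dots> \<le> dist_to_set x (- \<Omega>)" using r by (intro le_dist_to_set) auto
        finally have 1: "ennreal (c0 * r ^ d) \<le> emeasure (mass \<Omega> (Vs i)) (ball x r)"
          "emeasure (mass \<Omega> (Vs i)) (ball x r) \<le> ennreal (c1 * r ^ d)"
          using elim r by (simp_all add: c0_def c1_def)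
        have "ball x r \<inter> \<Omega> = ball x r" using r subset_ball[of r R x] by auto
        then have 2: "emeasure (mass \<Omega> (Vs i)) (ball x r) = ennreal (measure (vs.\<mu>s i) (ball x r))"
          using emeasure_mass_extension[of "ball x r" \<Omega> "Vs i"] f.emeasure_eq_measure[of "ball x r"] by (simp add: \<mu>s)
        show "c0 * r ^ d \<le> measure (vs.\<mu>s i) (ball x r) \<and> measure (vs.\<mu>s i) (ball x r) \<le> c1 * r ^ d"
          using 1 c1 r0 unfolding 2 by (simp add: ennreal_le_iff)
      qed
    qed
  qed
  have ex: "eventually (\<lambda>i. (\<integral>\<^sup>+z. (\<integral>\<^sup>+y. ennreal (vs.excess_kernel m z y) \<partial>vs.\<mu>s i) \<partial>Ws i) \<le> ennreal (2 ^ (d + 3) * E)) sequentially" for m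
  proof -
    have "eventually (\<lambda>i. \<alpha> i < 1 / real (Suc m)) sequentially" using \<alpha>(2) by (intro order_tendstoD(2)) auto
    then show ?thesis
    proof eventually_elim
      case (elim i)
      define c where "c = ennreal (1 / 2 ^ (d + 3))"
      define F where "F z = (\<integral>\<^sup>+y. ennreal (vs.excess_kernel m z y) \<partial>vs.\<mu>s i)" for z
      obtain B where B: "\<And>z y. vs.excess_kernel m z y \<le> B" using vs.excess_kernel_support[of m] by blast
      have Fm: "F \<in> borel_measurable borel"
        using vs.double_nn_integral_eq(2)[OF vs.continuous_on_excess_kernel[of m] _ _ vs.finite_\<mu>s vs.sets_\<mu>s[of i] vs.finite_W vs.sets_W, of B]
          B vs.excess_kernel_nonneg by (simp add: F_def[abs_def])
      have fin: "emeasure (mass \<Omega> (Vs i)) \<Omega> < \<infinity>" using mass_le[of i] by (auto simp: less_top[symmetric] top_unique)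
      have "c * (\<integral>\<^sup>+z. F z \<partial>Ws i) = c * (\<integral>\<^sup>+z. F z \<partial>Vs i)"
        unfolding Ws_def by (simp add: nn_integral_borel_extension[OF Vs Fm])
      also have "\<dots> = (\<integral>\<^sup>+z. c * F z \<partial>Vs i)"
        \<comment> \<open>The constant is moved across the integral of F, which is measurable; the excess enters only through monotonicity.\<close>
        using varifold_measurable[OF Vs Fm] by (intro nn_integral_cmult[symmetric])
      also have "\<dots> \<le> (\<integral>\<^sup>+(x, P). height_excess d \<Omega> (\<alpha> i) x P (Vs i) \<partial>Vs i)"
      proof (intro nn_integral_mono)
        fix z
        have "c * F (fst z, snd z) \<le> height_excess d \<Omega> (\<alpha> i) (fst z) (snd z) (Vs i)"
          unfolding F_def c_def \<mu>s
          using elim by (intro vs.excess_lower_bound Vs fin \<alpha>(1)) simp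
        then show "c * F z \<le> (case z of (x, P) \<Rightarrow> height_excess d \<Omega> (\<alpha> i) x P (Vs i))" by (simp add: split_beta)
      qed
      also have "\<dots> \<le> ennreal E" by (rule excess_le)
      finally have "ennreal (2 ^ (d + 3)) * (c * (\<integral>\<^sup>+z. F z \<partial>Ws i)) \<le> ennreal (2 ^ (d + 3)) * ennreal E"
        by (rule mult_left_mono) simp
      moreover have "ennreal (2 ^ (d + 3)) * c = 1"
        unfolding c_def by (subst ennreal_mult[symmetric]) auto
      ultimately show ?case unfolding F_def[symmetric]
        using E(1) by (simp add: mult.assoc[symmetric] ennreal_mult)
    qed
  qed
  define k0 where "k0 = c0 / 4 ^ d"
  define k1 where "k1 = c1 * 3 ^ d"
  have k0: "0 < k0" and k1: "0 < k1" using c0 c1 by (simp_all add: k0_def k1_def)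
  have low: "k0 * r ^ d \<le> measure vs.\<mu> (cball y r)" and up: "measure vs.\<mu> (cball y r) \<le> k1 * r ^ d"
    if "y \<in> vs.supp" "0 < r" "cball y (8 * r) \<subseteq> \<Omega>" for y r
    using vs.density_bounds[OF \<beta>(1) dens' that] by (simp_all add: k0_def k1_def power_divide power_mult_distrib mult.assoc)
  have "AE z in W. fst z \<in> vs.supp"
  proof -
    have "AE x in vs.\<mu>. x \<notin> \<Omega> - vs.supp" using vs.\<mu>_off_supp by (intro AE_not_in) (simp add: null_sets_def)
    then have "AE z in W. fst z \<notin> \<Omega> - vs.supp" unfolding vs.\<mu>_def by (rule AE_distrD[OF vs.fst_measurable_W])
    then show ?thesis using vs.AE_W_\<Omega> by eventually_elim auto
  qed
  moreover have "AE z in W. (\<integral>\<^sup>+y. ennreal (vs.height_kernel z y) \<partial>vs.\<mu>) < \<infinity>"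
    by (rule vs.AE_height_kernel_finite[OF _ ex]) (use E in simp)
  ultimately have "AE z in W. fst z \<in> vs.supp \<and> vs.tangent_cone (fst z) (snd z)"
    using vs.AE_W_\<Omega>
  proof eventually_elim
    case (elim z)
    then show ?case
      using vs.tangent_cone_of_height_kernel[OF k0 low, of "fst z" "snd z"] by simp
  qed
  from varifold_compact_exhaustion[OF V \<Omega>, folded W_def, OF vs.finite_W this]
  obtain Ks :: "nat \<Rightarrow> ('a \<times> 'a linear_subspace) set" where c: "(\<forall>m. compact (Ks m) \<and> Ks m \<subseteq> \<Omega> \<times> ?Gr \<and> (\<forall>z\<in>Ks m. fst z \<in> vs.supp \<and> vs.tangent_cone (fst z) (snd z)))
    \<and> emeasure W (- (\<Union>m. Ks m)) = 0"
    by (elim exE) (rule that)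
  have Ks0: "emeasure W (- (\<Union>m. Ks m)) = 0" using c by (rule conjunct2)
  have Ks: "compact (Ks m)" "Ks m \<subseteq> \<Omega> \<times> ?Gr" "z \<in> Ks m \<Longrightarrow> fst z \<in> vs.supp \<and> vs.tangent_cone (fst z) (snd z)" for m z
    using c by blast+
  have "tangential_measure d \<Omega> vs.supp vs.\<mu> k0 k1 Ks"
  proof (rule tangential_measure.intro)
    show "1 \<le> d" "open \<Omega>" by fact+
    show "finite_measure vs.\<mu>" "sets vs.\<mu> = sets borel" using vs.finite_\<mu> by simp_all
    show "vs.supp \<subseteq> \<Omega>" by (auto simp: vs.supp_def)
    show "0 < k0" "0 < k1" by fact+
    show "compact (Ks m)" for m by (rule Ks)
    show "Ks m \<subseteq> vs.supp \<times> ?Gr" for m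
    proof
      fix z assume "z \<in> Ks m"
      then show "z \<in> vs.supp \<times> ?Gr" using Ks(2)[of m] Ks(3)[of z m] by (auto simp: mem_Times_iff)
    qed
    show "\<exists>\<rho>>0. \<forall>y\<in>vs.supp. dist x y < \<rho> \<longrightarrow> norm ((y - x) - orth_proj P (y - x)) \<le> \<epsilon> * norm (y - x)"
      if "(x, P) \<in> Ks m" "0 < \<epsilon>" for m x P \<epsilon>
      using Ks(3)[OF that(1)] that(2) by (simp add: vs.tangent_cone_def dist_norm norm_minus_commute)
    show "emeasure vs.\<mu> (- (\<Union>m. fst ` Ks m)) = 0"
    proof -
      have b: "- (\<Union>m. fst ` Ks m) \<in> sets borel"
        using Ks(1) by (intro borel_comp sets.countable_UN) (auto intro!: borel_closed compact_imp_closed compact_continuous_image continuous_intros)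
      have Kb: "- (\<Union>m. Ks m) \<in> sets borel"
        using Ks(1) by (intro borel_comp sets.countable_UN) (auto intro!: borel_closed compact_imp_closed)
      have "emeasure vs.\<mu> (- (\<Union>m. fst ` Ks m)) = emeasure W (fst -` (- (\<Union>m. fst ` Ks m)))"
        unfolding vs.\<mu>_def using b vs.fst_measurable_W by (simp add: emeasure_distr)
      also have "\<dots> \<le> emeasure W (- (\<Union>m. Ks m))"
        using Kb by (intro emeasure_mono) (auto simp: vs.sets_W)
      also have "\<dots> = 0" by (rule Ks0)
      finally show ?thesis by simp
    qed
  qed (use low up in auto)
  then have "tangential_measure d \<Omega> vs.supp (distr (borel_extension V) borel fst) k0 k1 Ks"
    unfolding vs.\<mu>_def unfolding W_def .
  from tangential_varifold_rectifiable[OF V this Ks0[unfolded W_def]] show ?thesis .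
qed

theorem theorem4:
  fixes d :: nat
    and \<Omega> :: "(real ^ 'n) set"
    and Vs :: "nat \<Rightarrow> ((real ^ 'n) \<times> (real ^ 'n) linear_subspace) measure"
    and V :: "((real ^ 'n) \<times> (real ^ 'n) linear_subspace) measure"
    and \<alpha> \<beta> :: "nat \<Rightarrow> real"
  assumes "1 \<le> d" and "d < CARD('n)"
    and "open \<Omega>"
    and "\<And>i. varifold d \<Omega> (Vs i)"
    and "varifold d \<Omega> V"
    and "weak_star_converges (\<Omega> \<times> grassmannian d) Vs V"
    and "(SUP i. emeasure (mass \<Omega> (Vs i)) \<Omega>) < \<infinity>"
    and "decseq \<alpha>" and "\<And>i. 0 < \<alpha> i" and "\<alpha> \<longlonglongrightarrow> 0"
    and "decseq \<beta>" and "\<And>i. 0 < \<beta> i" and "\<beta> \<longlonglongrightarrow> 0"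
    and "\<exists>C1 C2. 0 < C1 \<and> C1 < C2 \<and>
      (\<forall>i. AE x in mass \<Omega> (Vs i). \<forall>r. \<beta> i < r \<and> ereal r < dist_to_set x (- \<Omega>) \<longrightarrow>
        ennreal (C1 * unit_ball_vol (real d) * r ^ d) \<le> emeasure (mass \<Omega> (Vs i)) (ball x r) \<and>
        emeasure (mass \<Omega> (Vs i)) (ball x r) \<le> ennreal (C2 * unit_ball_vol (real d) * r ^ d))"
    and "(SUP i. \<integral>\<^sup>+(x, P). height_excess d \<Omega> (\<alpha> i) x P (Vs i) \<partial>Vs i) < \<infinity>"
  shows "rectifiable_varifold d \<Omega> V"
proof -
  obtain C1 C2 where C: "0 < C1" "C1 < C2"
    "\<And>i. AE x in mass \<Omega> (Vs i). \<forall>r. \<beta> i < r \<and> ereal r < dist_to_set x (- \<Omega>) \<longrightarrow>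
        ennreal (C1 * unit_ball_vol (real d) * r ^ d) \<le> emeasure (mass \<Omega> (Vs i)) (ball x r) \<and>
        emeasure (mass \<Omega> (Vs i)) (ball x r) \<le> ennreal (C2 * unit_ball_vol (real d) * r ^ d)"
    using assms(14) by blast
  then have "0 < C2" by linarith
  show ?thesis
    by (rule varifold_limit_rectifiable[OF assms(1,3,4,5,6,7,9,10,13,12) C(1) \<open>0 < C2\<close> C(3) assms(15)])
qed

end
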